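(* The moment generating function for a GSE random matrix $A_n$ of order $n$ with variance $\sigma^2$ equals $$(\mathcal{L}p_{GSE,n,\sigma^2})(s)=\mathbb{E}\bigl(\operatorname{Tr}(e^{sA_n})\bigr) = -e^{\frac{\sigma^2s^2}{2}}\sum_{i=0}^{n}\frac{\sigma^{2i}s^{2i}2^i\, n!}{(2i)!\,(n-i)!}\,{}_1F_1\bigl(-(2n-2i);1+2i;-\sigma^{2}s^{2}\bigr) + n\cdot e^{\frac{\sigma^2s^2}{2}}\,{}_1F_1\bigl(1-n;2;-\sigma^2s^2\bigr).$$
   Context: A GSE (Gaussian Symplectic Ensemble) random matrix of order $n$ with variance $\sigma^2$ is a self-adjoint random $n\times n$ matrix $(X_{ij})$ whose entries with $i\le j$ are independent, with $X_{ij}\sim N(0,\sigma^2/2)_{\mathbb{H}}$ (quaternionic Gaussian) for $i<j$ and $X_{ii}\sim N(0,\sigma^2)_{\mathbb{R}}$. The Hermite polynomials are $H_k(x)=(-1)^k e^{x^2}\frac{d^k}{dx^k}e^{-x^2}$ and the Hermite functions are $\phi_k(x)=\frac{1}{\sqrt{2^k k!\sqrt{\pi}}}H_k(x)e^{-x^2/2}$, $k\ge0$. For an integer $m\ge 1$ and $\sigma>0$, $$p_{GUE,m,\sigma^2}(x)=\frac{1}{\sigma\sqrt2}\sum_{k=0}^{m-1}\phi_k\Bigl(\frac{x}{\sigma\sqrt2}\Bigr)^2,\qquad \tau_m(x)=\sqrt{\frac m2}\,\phi_{m-1}(x)\,\frac12\int_{\mathbb{R}}\operatorname{sign}(x-t)\phi_m(t)\,dt,$$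 and the mean density function for GSE is taken to be $$p_{GSE,n,\sigma^2}(x)=p_{GUE,2n+1,\sigma^2}(x)+\frac{1}{\sigma\sqrt2}\,\tau_{2n+1}\Bigl(\frac{x}{\sigma\sqrt2}\Bigr).$$ The moment generating function (bilateral Laplace transform) is $(\mathcal{L}\mu)(s)=\int_{\mathbb{R}}e^{sx}\mu(x)\,dx$. The confluent hypergeometric function is ${}_1F_1(a;b;x)=\sum_{j=0}^\infty\frac{a(a+1)\cdots(a+j-1)}{b(b+1)\cdots(b+j-1)}\frac{x^j}{j!}$ for $b\notin\{0,-1,-2,\dots\}$.
   Formalization: The last summand n·e^{σ²s²/2}·1F1(1−n;2;−σ²s²) is corrected to (2n+1)·e^{σ²s²/2}·1F1(1−(2n+1);2;−σ²s²): as printed, the right side at s=0 is n−1, while the total mass of p_GSE and Tr(I) are 2n, so the printed identity fails for every n≥1. *)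

theory Defs
  imports "HOL-Probability.Probability" "Jordan_Normal_Form.Matrix"
begin

text \<open>The tuple \<open>(a, b, c, d)\<close> stands for the quaternion \<open>a + b i + c j + d k\<close>.\<close>

type_synonym quat = "real \<times> real \<times> real \<times> real"

definition quat_cnj :: "quat \<Rightarrow> quat" where
  "quat_cnj = (\<lambda>(a, b, c, d). (a, - b, - c, - d))"

definition quat_self_adjoint :: "nat \<Rightarrow> quat mat \<Rightarrow> bool" where
  "quat_self_adjoint n A \<longleftrightarrow> A \<in> carrier_mat n n \<and>
     (\<forall>i<n. \<forall>j<n. A $$ (j, i) = quat_cnj (A $$ (i, j)))"

text \<open>The Gaussian law \<open>N(0, v)\<close> on the quaternions: the four real components are independent,
  each of variance \<open>v\<close>. With \<open>v = \<sigma>\<^sup>2 / 2\<close> off the diagonal and real variance \<open>\<sigma>\<^sup>2\<close> on it, the density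
  of a self-adjoint matrix is proportional to \<open>exp (- tr (X\<^sup>2) / (2 \<sigma>\<^sup>2))\<close>, hence invariant under
  the compact symplectic group.\<close>

definition quat_gaussian :: "'w measure \<Rightarrow> ('w \<Rightarrow> quat) \<Rightarrow> real \<Rightarrow> bool" where
  "quat_gaussian M X v \<longleftrightarrow> distributed M lborel X
     (\<lambda>(a, b, c, d). ennreal (normal_density 0 (sqrt v) a * normal_density 0 (sqrt v) b *
                              normal_density 0 (sqrt v) c * normal_density 0 (sqrt v) d))"

text \<open>Diagonal entries of a self-adjoint matrix have vanishing imaginary components, so only their
  real component \<open>fst\<close> needs a law. Note that \<open>normal_density\<close> takes the standard deviation.\<close>

definition GSE :: "'w measure \<Rightarrow> nat \<Rightarrow> real \<Rightarrow> ('w \<Rightarrow> quat mat) \<Rightarrow> bool" where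
  "GSE M n \<sigma> A \<longleftrightarrow> prob_space M \<and>
     (\<forall>\<omega>\<in>space M. quat_self_adjoint n (A \<omega>)) \<and>
     prob_space.indep_vars M (\<lambda>_. borel) (\<lambda>ij \<omega>. A \<omega> $$ ij) {(i, j). i \<le> j \<and> j < n} \<and>
     (\<forall>i j. i < j \<and> j < n \<longrightarrow> quat_gaussian M (\<lambda>\<omega>. A \<omega> $$ (i, j)) (\<sigma>\<^sup>2 / 2)) \<and>
     (\<forall>i<n. distributed M lborel (\<lambda>\<omega>. fst (A \<omega> $$ (i, i))) (\<lambda>x. ennreal (normal_density 0 \<sigma> x)))"

text \<open>The standard embedding of the quaternions into the complex \<open>2 \<times> 2\<close> matrices, applied
  blockwise: an \<open>n \<times> n\<close> quaternionic matrix becomes a \<open>2n \<times> 2n\<close> complex one.\<close>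

definition quat_block :: "quat \<Rightarrow> complex mat" where
  "quat_block = (\<lambda>(a, b, c, d). mat_of_rows_list 2
     [[Complex a b, Complex c d], [Complex (- c) d, Complex a (- b)]])"

definition complex_rep :: "quat mat \<Rightarrow> complex mat" where
  "complex_rep A = mat (2 * dim_row A) (2 * dim_col A)
     (\<lambda>(i, j). quat_block (A $$ (i div 2, j div 2)) $$ (i mod 2, j mod 2))"

definition mat_trace :: "'a :: comm_monoid_add mat \<Rightarrow> 'a" where
  "mat_trace B = (\<Sum>i<dim_row B. B $$ (i, i))"

definition mat_exp :: "complex mat \<Rightarrow> complex mat" where
  "mat_exp B = mat (dim_row B) (dim_col B) (\<lambda>ij. \<Sum>k. (B ^\<^sub>m k) $$ ij / fact k)"

text \<open>The trace of the exponential of \<open>s A\<close>. A quaternionic matrix is regarded as a complex one of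
  twice the size; the density \<open>p_GSE n \<sigma>\<close> below accordingly has total mass \<open>2 n\<close>.\<close>

definition trace_exp :: "complex \<Rightarrow> quat mat \<Rightarrow> complex" where
  "trace_exp s A = mat_trace (mat_exp (s \<cdot>\<^sub>m complex_rep A))"

definition hermite :: "nat \<Rightarrow> real \<Rightarrow> real" where
  "hermite k x = (- 1) ^ k * exp (x\<^sup>2) * (deriv ^^ k) (\<lambda>t. exp (- (t\<^sup>2))) x"

definition hermite_fun :: "nat \<Rightarrow> real \<Rightarrow> real" where
  "hermite_fun k x = 1 / sqrt (2 ^ k * fact k * sqrt pi) * hermite k x * exp (- (x\<^sup>2) / 2)"

definition p_GUE :: "nat \<Rightarrow> real \<Rightarrow> real \<Rightarrow> real" where
  "p_GUE m \<sigma> x = 1 / (\<sigma> * sqrt 2) * (\<Sum>k<m. (hermite_fun k (x / (\<sigma> * sqrt 2)))\<^sup>2)"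

definition tau :: "nat \<Rightarrow> real \<Rightarrow> real" where
  "tau m x = sqrt (real m / 2) * hermite_fun (m - 1) x *
     (1 / 2 * (\<integral>t. sgn (x - t) * hermite_fun m t \<partial>lborel))"

definition p_GSE :: "nat \<Rightarrow> real \<Rightarrow> real \<Rightarrow> real" where
  "p_GSE n \<sigma> x = p_GUE (2 * n + 1) \<sigma> x + 1 / (\<sigma> * sqrt 2) * tau (2 * n + 1) (x / (\<sigma> * sqrt 2))"

definition laplace :: "(real \<Rightarrow> real) \<Rightarrow> complex \<Rightarrow> complex" where
  "laplace \<mu> s = (\<integral>x. exp (s * of_real x) * of_real (\<mu> x) \<partial>lborel)"

definition hyp1F1 :: "complex \<Rightarrow> complex \<Rightarrow> complex \<Rightarrow> complex" where
  "hyp1F1 a b x = (\<Sum>j. pochhammer a j / pochhammer b j * (x ^ j / fact j))"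

text \<open>On the closed form: \<open>p_GUE m \<sigma>\<close> has the moment generating function
  \<open>m * exp (\<sigma>\<^sup>2 s\<^sup>2 / 2) * hyp1F1 (1 - m) 2 (- \<sigma>\<^sup>2 s\<^sup>2)\<close>. It enters the formula for the GSE at
  \<open>m = 2 * n + 1\<close>, the order of the first part of \<open>p_GSE n \<sigma>\<close>. In print this summand appears with
  \<open>m = n\<close>, a slip: at \<open>s = 0\<close> the printed right-hand side is \<open>n - 1\<close>, while the total mass of
  \<open>p_GSE n \<sigma>\<close> and the trace of the identity are both \<open>2 * n\<close>.\<close>

end

theory Submission
  imports Defs "Jordan_Normal_Form.Determinant" "HOL-Real_Asymp.Real_Asymp"
begin

text \<open>The mixed moments of the traces \<open>tr Y\<^sup>k\<close> of a GSE matrix satisfy the loop equations, which come from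
  Gaussian integration by parts and which determine these moments recursively. The same equations hold
  for the power sums of \<open>n\<close> independent Gaussian variables \<open>x i\<close> under the weight
  \<open>\<Prod>j<i. (x i - x j) ^ 4\<close>. This replaces the Weyl integration formula: no change of
  variables from matrices to eigenvalues is needed. The weight is a confluent Vandermonde determinant, and
  expanding it in polynomials that are skew-orthogonal for the Gaussian weight gives the one-point
  density, which telescopes to \<open>p_GSE\<close>. The closed form then follows from
  \<open>\<integral> exp (t x) H\<^sub>j(x) H\<^sub>k(x) exp (- x\<^sup>2) dx\<close>, which is a polynomial in \<open>t\<close> times
  \<open>exp (t\<^sup>2 / 4)\<close>. The matrix \<open>Y\<close> is the complex image of the GSE matrix divided by
  \<open>\<sigma> * sqrt 2\<close>, which turns the weight into \<open>exp (- x\<^sup>2)\<close>.\<close>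

section \<open>Gaussian integration by parts for polynomials\<close>

text \<open>The mixed moments have to be treated together, because integration by parts of one trace
  produces products of two. The two families agree for the following reason. In the matrix model a
  contraction inside one trace gives \<open>1/2 * (tr Y^r * tr Y^l - tr Y^(r+l))\<close>; the second
  term is the symplectic twist. In the eigenvalue model the weight gives
  \<open>1/2 * S r * S l\<close> with a diagonal correction \<open>- k * S (k - 1)\<close>, half of
  which is returned by differentiating \<open>x i ^ k\<close>. The power sums carry a factor 2
  because the eigenvalues of the complex image have even multiplicity. The exponent 4 is even, so
  the weight is a polynomial and integration by parts stays within polynomials. A determinant of
  size 2 n suits the weight since each variable occupies two rows only: by Fubini its integral is a
  sum over permutations of products of pairings, and in a skew-orthogonal basis only the
  permutations that respect blocks survive. The sign integral in \<open>tau\<close> is an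
  antiderivative of a Hermite function, and this is what the even skew-orthogonal polynomials
  are.\<close>

definition gauss_moment :: "real \<Rightarrow> nat \<Rightarrow> real" where
  "gauss_moment v k = (if even k then v ^ (k div 2) * fact k / (2 ^ (k div 2) * fact (k div 2)) else 0)"

lemma gauss_moment_0 [simp]: "gauss_moment v 0 = 1"
  by (simp add: gauss_moment_def)

text \<open>Integration by parts for a single monomial. \<open>gauss_moment v k\<close> is the k-th
  moment of N(0, v), where \<open>v\<close> is the variance and the quotient of factorials and
  powers of 2 is the double factorial of k - 1. At k = 0 the truncated \<open>k - 1\<close> is
  harmless, as the factor \<open>k\<close> vanishes.\<close>

lemma gauss_moment_Suc: "gauss_moment v (Suc k) = v * real k * gauss_moment v (k - 1)"
proof (cases "odd k")
  case True
  then obtain m where m: "k = Suc (2 * m)" by (metis oddE Suc_eq_plus1)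
  have "fact (Suc (Suc (2 * m))) = 2 * (real m + 1) * (2 * real m + 1) * fact (2 * m)"
    by (simp add: algebra_simps)
  moreover have "gauss_moment v (Suc k) = v ^ Suc m * fact (Suc (Suc (2 * m))) / (2 ^ Suc m * fact (Suc m))"
    and "gauss_moment v (k - 1) = v ^ m * fact (2 * m) / (2 ^ m * fact m)"
    unfolding m gauss_moment_def by simp_all
  moreover have "fact (Suc m) = (real m + 1) * fact m"
    by simp
  ultimately have "gauss_moment v (Suc k) = (2 * (real m + 1) * (v * v ^ m * (2 * real m + 1) * fact (2 * m)))
      / (2 * (real m + 1) * (2 ^ m * fact m))"
    by (simp only: power_Suc) (simp only: ac_simps)
  also have "\<dots> = v * v ^ m * (2 * real m + 1) * fact (2 * m) / (2 ^ m * fact m)"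
    by (rule mult_divide_mult_cancel_left) simp
  finally show ?thesis
    unfolding \<open>gauss_moment v (k - 1) = _\<close> by (simp add: m)
next
  case False
  then show ?thesis by (cases k) (auto simp: gauss_moment_def)
qed

lemma normal_density_moment:
  assumes "\<sigma> > 0"
  shows "has_bochner_integral lborel (\<lambda>x. normal_density 0 \<sigma> x * x ^ k) (gauss_moment (\<sigma>\<^sup>2) k)"
proof (cases "even k")
  case True
  then obtain m where m: "k = 2 * m" by blast
  show ?thesis
    using normal_moment_even[OF assms, of 0 m] assms unfolding m gauss_moment_def
    by (simp add: power_divide power_mult field_simps)
next
  case False
  then obtain m where m: "k = 2 * m + 1" by (metis oddE)
  show ?thesis
    using normal_moment_odd[OF assms, of 0 m] unfolding m gauss_moment_def by simp
qed

lemma gauss_moment_scale: "c ^ k * gauss_moment v k = gauss_moment (c\<^sup>2 * v) k" for c :: real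
  by (cases "even k") (auto simp: gauss_moment_def power_mult_distrib elim!: evenE simp flip: power_mult)

text \<open>Normality and independence enter only through the factorised moments of monomials. There
  are two instances: the real coordinates of a GSE matrix, and the coordinates of a product
  measure.\<close>

locale gaussian_moments = prob_space M
  for M :: "'w measure" +
  fixes I :: "'i set" and \<xi> :: "'i \<Rightarrow> 'w \<Rightarrow> real" and v :: "'i \<Rightarrow> real"
  assumes fin_I: "finite I"
    and meas_coord: "\<And>i. i \<in> I \<Longrightarrow> \<xi> i \<in> borel_measurable M"
    and integrable_monom: "\<And>e. integrable M (\<lambda>\<omega>. \<Prod>i\<in>I. \<xi> i \<omega> ^ e i)"
    and expectation_monom: "\<And>e. expectation (\<lambda>\<omega>. \<Prod>i\<in>I. \<xi> i \<omega> ^ e i) = (\<Prod>i\<in>I. gauss_moment (v i) (e i))"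
begin

definition mono :: "('i \<Rightarrow> nat) \<Rightarrow> 'w \<Rightarrow> complex" where
  "mono e \<omega> = (\<Prod>i\<in>I. complex_of_real (\<xi> i \<omega>) ^ e i)"

text \<open>\<open>gder F D\<close>: the random variable \<open>F\<close> is a polynomial in the coordinates and \<open>D i\<close> its formal
  partial derivative in the \<open>i\<close>-th one. The derivative is part of the relation because a random
  variable need not determine the polynomial.\<close>

inductive gder :: "('w \<Rightarrow> complex) \<Rightarrow> ('i \<Rightarrow> 'w \<Rightarrow> complex) \<Rightarrow> bool" where
  gder_mono: "gder (mono e) (\<lambda>i \<omega>. of_nat (e i) * mono (e(i := e i - 1)) \<omega>)"
| gder_add: "gder F D \<Longrightarrow> gder G E \<Longrightarrow> gder (\<lambda>\<omega>. F \<omega> + G \<omega>) (\<lambda>i \<omega>. D i \<omega> + E i \<omega>)"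
| gder_cmult: "gder F D \<Longrightarrow> gder (\<lambda>\<omega>. c * F \<omega>) (\<lambda>i \<omega>. c * D i \<omega>)"
| gder_cong: "gder F D \<Longrightarrow> (\<And>i. i \<in> I \<Longrightarrow> D i = D' i) \<Longrightarrow> gder F D'"

lemma mono_of_real: "mono e = (\<lambda>\<omega>. complex_of_real (\<Prod>i\<in>I. \<xi> i \<omega> ^ e i))"
  by (auto simp: mono_def)

lemma mono_add: "mono e \<omega> * mono f \<omega> = mono (\<lambda>i. e i + f i) \<omega>"
  by (simp add: mono_def prod.distrib power_add)

lemma mono_Suc: "i \<in> I \<Longrightarrow> of_real (\<xi> i \<omega>) * mono e \<omega> = mono (e(i := Suc (e i))) \<omega>"
  using fin_I by (simp add: mono_def prod.remove[of I i])

lemma integrable_mono: "integrable M (mono e)"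
  unfolding mono_of_real by (intro integrable_of_real integrable_monom)

lemma expectation_mono: "integral\<^sup>L M (mono e) = of_real (\<Prod>i\<in>I. gauss_moment (v i) (e i))"
  unfolding mono_of_real expectation_monom[symmetric] by (rule integral_complex_of_real)

text \<open>Both sides are linear in the pair (F, D), so monomials decide, and there the claim is
  the recursion \<open>gauss_moment_Suc\<close> in one coordinate. Integrability travels along in
  the induction because linearity of the integral depends on it.\<close>

lemma stein:
  assumes "gder F D"
  shows "integrable M F \<and> (\<forall>i\<in>I. integrable M (D i) \<and> integrable M (\<lambda>\<omega>. of_real (\<xi> i \<omega>) * F \<omega>) \<and>
     (\<integral>\<omega>. of_real (\<xi> i \<omega>) * F \<omega> \<partial>M) = of_real (v i) * integral\<^sup>L M (D i))"
  using assms
proof induction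
  case (gder_mono e)
  have "(\<integral>\<omega>. of_real (\<xi> i \<omega>) * mono e \<omega> \<partial>M)
      = of_real (v i) * (\<integral>\<omega>. of_nat (e i) * mono (e(i := e i - 1)) \<omega> \<partial>M)" if "i \<in> I" for i
  proof -
    have "(\<integral>\<omega>. of_real (\<xi> i \<omega>) * mono e \<omega> \<partial>M) =
        of_real (\<Prod>j\<in>I. gauss_moment (v j) ((e(i := Suc (e i))) j))"
      by (simp add: mono_Suc[OF that] expectation_mono)
    also have "\<dots> = of_real (v i * real (e i) * (\<Prod>j\<in>I. gauss_moment (v j) ((e(i := e i - 1)) j)))"
      using fin_I that by (simp add: prod.remove[of I i] gauss_moment_Suc)
    finally show ?thesis by (simp add: expectation_mono)
  qed
  then show ?case
    by (auto simp: mono_Suc integrable_mono)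
next
  case (gder_add F D G E)
  then show ?case by (simp add: distrib_left)
next
  case (gder_cmult F D c)
  have eq: "(\<lambda>\<omega>. of_real (\<xi> i \<omega>) * (c * F \<omega>)) = (\<lambda>\<omega>. c * (of_real (\<xi> i \<omega>) * F \<omega>))" for i
    by (simp add: ac_simps)
  show ?case using gder_cmult unfolding eq by (simp add: ac_simps)
next
  case (gder_cong F D D')
  then show ?case by metis
qed

lemma gder_const: "gder (\<lambda>_. c) (\<lambda>_ _. 0)"
proof -
  have "gder (\<lambda>\<omega>. c * mono (\<lambda>_. 0) \<omega>) (\<lambda>i \<omega>. c * (of_nat 0 * mono ((\<lambda>_. 0)(i := 0 - 1)) \<omega>))"
    by (intro gder_cmult gder_mono)
  then show ?thesis by (simp add: mono_def)
qed

lemma gder_coord: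
  assumes "j \<in> I"
  shows "gder (\<lambda>\<omega>. of_real (\<xi> j \<omega>)) (\<lambda>i _. if i = j then 1 else 0)"
proof -
  define e where "e = (\<lambda>i. if i = j then 1 else 0 :: nat)"
  have 1: "mono e = (\<lambda>\<omega>. of_real (\<xi> j \<omega>))"
    using assms fin_I by (auto simp: mono_def e_def prod.remove[of I j])
  have 2: "e(j := 0) = (\<lambda>_. 0)" by (auto simp: e_def)
  have "gder (mono e) (\<lambda>i \<omega>. of_nat (e i) * mono (e(i := e i - 1)) \<omega>)"
    by (rule gder_mono)
  moreover have "(\<lambda>i \<omega>. of_nat (e i) * mono (e(i := e i - 1)) \<omega>) = (\<lambda>i _. if i = j then 1 else 0)"
    by (intro ext) (use 2 in \<open>auto simp: e_def mono_def fun_eq_iff intro!: prod.neutral\<close>)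
  ultimately show ?thesis using 1 by simp
qed

text \<open>The product rule takes two inductions, one for each factor; this is the one over the
  right factor.\<close>

lemma gder_mult_mono:
  assumes "gder G E"
  shows "gder (\<lambda>\<omega>. mono e \<omega> * G \<omega>)
    (\<lambda>i \<omega>. of_nat (e i) * mono (e(i := e i - 1)) \<omega> * G \<omega> + mono e \<omega> * E i \<omega>)"
  using assms
proof induction
  case (gder_mono f)
  have "gder (mono (\<lambda>i. e i + f i)) (\<lambda>i \<omega>. of_nat (e i + f i) * mono ((\<lambda>i. e i + f i)(i := e i + f i - 1)) \<omega>)"
    by (rule gder.gder_mono)
  moreover have "of_nat (e i + f i) * mono ((\<lambda>i. e i + f i)(i := e i + f i - 1)) \<omega> =
     of_nat (e i) * mono (e(i := e i - 1)) \<omega> * mono f \<omega>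
       + mono e \<omega> * (of_nat (f i) * mono (f(i := f i - 1)) \<omega>)" for i \<omega>
  proof -
    have "of_nat (e i) * mono (e(i := e i - 1)) \<omega> * mono f \<omega>
        = of_nat (e i) * mono ((\<lambda>i. e i + f i)(i := e i + f i - 1)) \<omega>"
    \<comment> \<open>For \<open>e i = 0\<close> the truncated exponents do not match, but the
      factor \<open>e i\<close> removes the term.\<close>
    proof (cases "e i")
      case (Suc m)
      have "(\<lambda>k. (e(i := e i - 1)) k + f k) = (\<lambda>i. e i + f i)(i := e i + f i - 1)"
        using Suc by auto
      then show ?thesis by (simp only: mult.assoc mono_add)
    qed simp
    moreover have "mono e \<omega> * (of_nat (f i) * mono (f(i := f i - 1)) \<omega>)
        = of_nat (f i) * mono ((\<lambda>i. e i + f i)(i := e i + f i - 1)) \<omega>"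
    proof (cases "f i")
      case (Suc m)
      have "(\<lambda>k. e k + (f(i := f i - 1)) k) = (\<lambda>i. e i + f i)(i := e i + f i - 1)"
        using Suc by auto
      then show ?thesis by (simp only: mult.left_commute[of "mono e \<omega>"] mono_add)
    qed simp
    ultimately show ?thesis by (simp only: of_nat_add distrib_right)
  qed
  ultimately show ?case by (simp only: mono_add)
next
  case (gder_add F D G E)
  from gder.gder_add[OF gder_add.IH] show ?case by (simp add: algebra_simps)
next
  case (gder_cmult F D c)
  from gder.gder_cmult[OF gder_cmult.IH, of c] show ?case by (simp add: algebra_simps)
next
  case (gder_cong F D D')
  from gder_cong(3) show ?case by (rule gder.gder_cong) (simp add: gder_cong)
qed

lemma gder_mult:
  assumes "gder F D" "gder G E"
  shows "gder (\<lambda>\<omega>. F \<omega> * G \<omega>) (\<lambda>i \<omega>. D i \<omega> * G \<omega> + F \<omega> * E i \<omega>)"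
  using assms(1)
proof induction
  case (gder_mono e)
  show ?case by (rule gder_mult_mono[OF assms(2)])
next
  case (gder_add F D G E)
  from gder.gder_add[OF gder_add.IH] show ?case by (simp add: algebra_simps)
next
  case (gder_cmult F D c)
  from gder.gder_cmult[OF gder_cmult.IH, of c] show ?case by (simp add: algebra_simps)
next
  case (gder_cong F D D')
  from gder_cong(3) show ?case by (rule gder.gder_cong) (simp add: gder_cong)
qed

lemma gder_sum:
  assumes "\<And>k. k \<in> K \<Longrightarrow> gder (F k) (D k)"
  shows "gder (\<lambda>\<omega>. \<Sum>k\<in>K. F k \<omega>) (\<lambda>i \<omega>. \<Sum>k\<in>K. D k i \<omega>)"
  using assms
proof (induction K rule: infinite_finite_induct)
  case (insert k K)
  then show ?case using gder_add[of "F k" "D k"] by simp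
qed (simp_all add: gder_const)

text \<open>Factors are removed by position, not by value, since a list may repeat an index and each
  occurrence has to be differentiated once.\<close>

lemma gder_prod_list:
  assumes "\<And>k. gder (F k) (D k)"
  shows "gder (\<lambda>\<omega>. \<Prod>k\<leftarrow>ks. F k \<omega>)
    (\<lambda>i \<omega>. \<Sum>j<length ks. D (ks ! j) i \<omega> * (\<Prod>k\<leftarrow>take j ks @ drop (Suc j) ks. F k \<omega>))"
proof (induction ks)
  case Nil
  show ?case using gder_const[of 1] by simp
next
  case (Cons k ks)
  have "(\<lambda>i \<omega>. \<Sum>j<length (k # ks). D ((k # ks) ! j) i \<omega> * (\<Prod>k\<leftarrow>take j (k # ks) @ drop (Suc j) (k # ks). F k \<omega>))
    = (\<lambda>i \<omega>. D k i \<omega> * (\<Prod>k\<leftarrow>ks. F k \<omega>) +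
        F k \<omega> * (\<Sum>j<length ks. D (ks ! j) i \<omega> * (\<Prod>k\<leftarrow>take j ks @ drop (Suc j) ks. F k \<omega>)))"
    unfolding list.size by (intro ext, simp add: sum.lessThan_Suc_shift del: sum.lessThan_Suc)
      (simp add: sum_distrib_left ac_simps)
  then show ?case using gder_mult[OF assms Cons.IH, of k] by simp
qed

lemma gder_integrable: "gder F D \<Longrightarrow> integrable M F"
  using stein by blast

end

section \<open>The confluent Vandermonde determinant\<close>

definition vandermonde :: "nat \<Rightarrow> (nat \<Rightarrow> real) \<Rightarrow> real mat" where
  "vandermonde N z = mat N N (\<lambda>(r, c). z r ^ c)"

lemma prod_list_diag_mat: "prod_list (diag_mat A) = (\<Prod>i<dim_row A. A $$ (i, i))"
  by (simp add: prod_list_diag_prod atLeast0LessThan)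

text \<open>Passing from monomials to polynomials with \<open>degree (p c) \<le> c\<close>
  multiplies the Vandermonde matrix by an upper triangular matrix of coefficients.\<close>

lemma det_poly_mat:
  assumes "\<And>c. c < N \<Longrightarrow> degree (p c) \<le> c"
  shows "det (mat N N (\<lambda>(r, c). poly (p c) (z r))) = det (vandermonde N z) * (\<Prod>c<N. coeff (p c) c)"
proof -
  define U where "U = mat N N (\<lambda>(k, c). coeff (p c) k)"
  have "poly (p c) (z r) = (\<Sum>k<N. z r ^ k * coeff (p c) k)" if "c < N" for r c
  proof -
    have "poly (p c) (z r) = (\<Sum>k\<le>degree (p c). coeff (p c) k * z r ^ k)"
      by (rule poly_altdef)
    also have "\<dots> = (\<Sum>k<N. coeff (p c) k * z r ^ k)"
      using assms[OF that] that by (intro sum.mono_neutral_left) (auto simp: coeff_eq_0)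
    finally show ?thesis by (simp add: mult.commute)
  qed
  then have "mat N N (\<lambda>(r, c). poly (p c) (z r)) = vandermonde N z * U"
    by (intro eq_matI) (auto simp: vandermonde_def U_def scalar_prod_def atLeast0LessThan)
  moreover have "det U = (\<Prod>c<N. coeff (p c) c)"
  proof -
    have "upper_triangular U"
      using le_less_trans[OF assms] by (auto simp: upper_triangular_def U_def intro!: coeff_eq_0)
    then have "det U = prod_list (diag_mat U)"
      by (rule det_upper_triangular[where n = N]) (simp add: U_def)
    then show ?thesis
      by (simp add: prod_list_diag_mat) (simp add: U_def)
  qed
  ultimately show ?thesis
    by (simp add: det_mult[where n = N] vandermonde_def U_def)
qed

text \<open>In the Newton basis \<open>p c\<close>, monic of degree c and vanishing at the nodes
  \<open>z r\<close> with r < c, the matrix is lower triangular; by \<open>det_poly_mat\<close> its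
  determinant is that of the monomial basis.\<close>

lemma det_vandermonde: "det (vandermonde N z) = (\<Prod>r<N. \<Prod>k<r. z r - z k)"
proof -
  define p where "p c = (\<Prod>k<c. [:- z k, 1:])" for c
  have deg: "degree (p c) = c" for c
    by (simp add: p_def degree_prod_eq_sum_degree)
  have lc: "coeff (p c) c = 1" for c
    using deg[of c] lead_coeff_prod[of "\<lambda>k. [:- z k, 1:]" "{..<c}"] by (simp add: p_def)
  define L where "L = mat N N (\<lambda>(r, c). poly (p c) (z r))"
  have "det L = prod_list (diag_mat L)"
    by (rule det_lower_triangular[where n = N])
      (auto simp: L_def p_def poly_prod intro!: prod_zero)
  then have "det L = (\<Prod>r<N. \<Prod>k<r. z r - z k)"
    by (simp add: prod_list_diag_mat) (simp add: L_def p_def poly_prod)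
  moreover have "det L = det (vandermonde N z)"
    unfolding L_def by (subst det_poly_mat) (auto simp: deg lc)
  ultimately show ?thesis by simp
qed

lemma prod_lessThan_double: "(\<Prod>r<2 * n. f r) = (\<Prod>i<n. f (2 * i) * f (2 * i + 1))"
  for f :: "nat \<Rightarrow> 'a :: comm_monoid_mult"
  by (induction n) (simp_all add: ac_simps)

lemma tendsto_det:
  fixes A :: "'b \<Rightarrow> real mat"
  assumes "\<And>x. A x \<in> carrier_mat n n" "B \<in> carrier_mat n n"
    and "\<And>i j. i < n \<Longrightarrow> j < n \<Longrightarrow> ((\<lambda>x. A x $$ (i, j)) \<longlongrightarrow> B $$ (i, j)) F"
  shows "((\<lambda>x. det (A x)) \<longlongrightarrow> det B) F"
proof -
  have "p i < n" if "p permutes {0..<n}" "i < n" for p i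
    using permutes_in_image[OF that(1), of i] that(2) by simp
  then show ?thesis
    unfolding det_def'[OF assms(1)] det_def'[OF assms(2)]
    by (intro tendsto_intros assms(3)) auto
qed

text \<open>The double nodes are obtained by letting the pairs of nodes \<open>x i\<close>, \<open>x i + \<epsilon>\<close> merge.\<close>

lemma det_confluent:
  fixes p :: "nat \<Rightarrow> real poly" and x :: "nat \<Rightarrow> real"
  assumes "\<And>c. c < 2 * n \<Longrightarrow> degree (p c) \<le> c"
  shows "det (mat (2 * n) (2 * n) (\<lambda>(r, c). if even r then poly (p c) (x (r div 2))
      else poly (pderiv (p c)) (x (r div 2)) - x (r div 2) * poly (p c) (x (r div 2))))
    = (\<Prod>c<2 * n. coeff (p c) c) * (\<Prod>i<n. \<Prod>j<i. x i - x j) ^ 4" (is "det ?C = ?lc * _")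
proof -
  define z where "z \<epsilon> r = x (r div 2) + (if odd r then \<epsilon> else 0)" for \<epsilon> r
  \<comment> \<open>Left multiplication by \<open>E \<epsilon>\<close> is a row operation on each
    pair: the second row becomes its difference quotient with the first, minus \<open>x i\<close>
    times the first. The limit is the derivative taken with the half weight exp (- x^2 / 2), the
    later \<open>weighted_deriv\<close>.\<close>
  define E where "E \<epsilon> = mat (2 * n) (2 * n) (\<lambda>(r, c). if r = c then if even r then 1 else 1 / \<epsilon>
      else if odd r \<and> c = r - 1 then - 1 / \<epsilon> - x (r div 2) else 0)" for \<epsilon>
  define V where "V \<epsilon> = mat (2 * n) (2 * n) (\<lambda>(r, c). poly (p c) (z \<epsilon> r))" for \<epsilon>
  define C where "C \<epsilon> = mat (2 * n) (2 * n) (\<lambda>(r, c). if even r then poly (p c) (x (r div 2))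
      else (poly (p c) (x (r div 2) + \<epsilon>) - poly (p c) (x (r div 2))) / \<epsilon>
         - x (r div 2) * poly (p c) (x (r div 2)))" for \<epsilon>
  have EV: "C \<epsilon> = E \<epsilon> * V \<epsilon>" for \<epsilon>
  proof (rule eq_matI)
    fix r c assume rc: "r < dim_row (E \<epsilon> * V \<epsilon>)" "c < dim_col (E \<epsilon> * V \<epsilon>)"
    then have rc': "r < 2 * n" "c < 2 * n" by (simp_all add: E_def V_def)
    have "(E \<epsilon> * V \<epsilon>) $$ (r, c) = (\<Sum>k<2 * n. E \<epsilon> $$ (r, k) * V \<epsilon> $$ (k, c))"
      using rc' by (simp add: scalar_prod_def E_def V_def atLeast0LessThan)
    also have "\<dots> = (\<Sum>k\<in>(if even r then {r} else {r, r - 1}). E \<epsilon> $$ (r, k) * V \<epsilon> $$ (k, c))"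
      using rc' by (intro sum.mono_neutral_right) (auto simp: E_def split: if_splits)
    also have "\<dots> = C \<epsilon> $$ (r, c)"
    proof (cases "even r")
      case False
      then obtain m where m: "r = 2 * m + 1" by (rule oddE)
      show ?thesis
        using rc' False by (simp add: m E_def V_def C_def z_def algebra_simps diff_divide_distrib)
    qed (use rc' in \<open>simp add: E_def V_def C_def z_def\<close>)
    finally show "C \<epsilon> $$ (r, c) = (E \<epsilon> * V \<epsilon>) $$ (r, c)" by simp
  qed (simp_all add: C_def E_def V_def)
  have detE: "det (E \<epsilon>) = (1 / \<epsilon>) ^ n" for \<epsilon>
  proof -
    have "det (E \<epsilon>) = prod_list (diag_mat (E \<epsilon>))"
      by (rule det_lower_triangular[where n = "2 * n"]) (auto simp: E_def)
    also have "\<dots> = (\<Prod>r<2 * n. if even r then 1 else 1 / \<epsilon>)"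
      by (simp add: prod_list_diag_mat) (simp add: E_def)
    finally show ?thesis by (simp add: prod_lessThan_double)
  qed
  \<comment> \<open>A pair of merging nodes contributes its own gap \<open>\<epsilon>\<close>; two
    different pairs contribute four differences.\<close>
  have detV: "det (vandermonde (2 * n) (z \<epsilon>)) =
      (\<Prod>i<n. \<epsilon> * (\<Prod>j<i. (x i - x j)\<^sup>2 * ((x i - x j)\<^sup>2 - \<epsilon>\<^sup>2)))" for \<epsilon>
  proof -
    have "(\<Prod>k<2 * i. z \<epsilon> (2 * i) - z \<epsilon> k) * (\<Prod>k<2 * i + 1. z \<epsilon> (2 * i + 1) - z \<epsilon> k)
      = \<epsilon> * (\<Prod>j<i. (x i - x j)\<^sup>2 * ((x i - x j)\<^sup>2 - \<epsilon>\<^sup>2))" for i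
    proof -
      have "(x i - x j) * (x i - (x j + \<epsilon>)) * ((x i + \<epsilon> - x j) * (x i + \<epsilon> - (x j + \<epsilon>)))
         = (x i - x j)\<^sup>2 * ((x i - x j)\<^sup>2 - \<epsilon>\<^sup>2)" for j
        by (simp add: algebra_simps power2_eq_square)
      then have "(\<Prod>j<i. (x i - x j) * (x i - (x j + \<epsilon>))) * (\<Prod>j<i. (x i + \<epsilon> - x j) * (x i + \<epsilon> - (x j + \<epsilon>)))
         = (\<Prod>j<i. (x i - x j)\<^sup>2 * ((x i - x j)\<^sup>2 - \<epsilon>\<^sup>2))"
        unfolding prod.distrib[symmetric] by (rule prod.cong[OF refl])
      moreover have "(\<Prod>k<2 * i. z \<epsilon> (2 * i) - z \<epsilon> k) = (\<Prod>j<i. (x i - x j) * (x i - (x j + \<epsilon>)))"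
        unfolding prod_lessThan_double by (simp add: z_def)
      moreover have "(\<Prod>k<2 * i + 1. z \<epsilon> (2 * i + 1) - z \<epsilon> k)
          = (\<Prod>k<2 * i. z \<epsilon> (2 * i + 1) - z \<epsilon> k) * (z \<epsilon> (2 * i + 1) - z \<epsilon> (2 * i))"
        by simp
      moreover have "(\<Prod>k<2 * i. z \<epsilon> (2 * i + 1) - z \<epsilon> k)
          = (\<Prod>j<i. (x i + \<epsilon> - x j) * (x i + \<epsilon> - (x j + \<epsilon>)))"
        unfolding prod_lessThan_double by (simp add: z_def)
      moreover have "z \<epsilon> (2 * i + 1) - z \<epsilon> (2 * i) = \<epsilon>"
        by (simp add: z_def)
      ultimately show ?thesis by (simp only: mult.commute mult.left_commute mult.assoc)
    qed
    then show ?thesis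
      unfolding det_vandermonde prod_lessThan_double[of "\<lambda>r. \<Prod>k<r. _ r k"] by (rule prod.cong[OF refl])
  qed
  \<comment> \<open>The \<open>n\<close> gaps cancel against \<open>det (E \<epsilon>)\<close>, so
    what remains is continuous at 0.\<close>
  have detC: "det (C \<epsilon>) = ?lc * (\<Prod>i<n. \<Prod>j<i. (x i - x j)\<^sup>2 * ((x i - x j)\<^sup>2 - \<epsilon>\<^sup>2))" if "\<epsilon> \<noteq> 0" for \<epsilon>
  proof -
    have "det (C \<epsilon>) = det (E \<epsilon>) * det (V \<epsilon>)"
      unfolding EV by (rule det_mult[where n = "2 * n"]) (simp_all add: E_def V_def)
    also have "det (V \<epsilon>) = det (vandermonde (2 * n) (z \<epsilon>)) * ?lc"
      unfolding V_def using assms by (rule det_poly_mat)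
    finally show ?thesis
      using that by (simp add: detE detV prod.distrib power_divide del: prod.lessThan_Suc)
  qed
  have "((\<lambda>\<epsilon>. det (C \<epsilon>)) \<longlongrightarrow> det ?C) (at 0)"
  proof (rule tendsto_det[where n = "2 * n"])
    fix r c assume "r < 2 * n" "c < 2 * n"
    moreover have "((\<lambda>\<epsilon>. (poly (p c) (x (r div 2) + \<epsilon>) - poly (p c) (x (r div 2))) / \<epsilon>)
        \<longlongrightarrow> poly (pderiv (p c)) (x (r div 2))) (at 0)"
      using poly_DERIV[of "p c" "x (r div 2)"] unfolding DERIV_def .
    ultimately show "((\<lambda>\<epsilon>. C \<epsilon> $$ (r, c)) \<longlongrightarrow> ?C $$ (r, c)) (at 0)"
      by (auto simp: C_def intro!: tendsto_diff)
  qed (simp_all add: C_def)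
  moreover have "((\<lambda>\<epsilon>. det (C \<epsilon>)) \<longlongrightarrow>
      ?lc * (\<Prod>i<n. \<Prod>j<i. (x i - x j)\<^sup>2 * ((x i - x j)\<^sup>2 - 0\<^sup>2))) (at 0)"
  proof (rule Lim_transform_eventually)
    show "((\<lambda>\<epsilon>. ?lc * (\<Prod>i<n. \<Prod>j<i. (x i - x j)\<^sup>2 * ((x i - x j)\<^sup>2 - \<epsilon>\<^sup>2))) \<longlongrightarrow>
        ?lc * (\<Prod>i<n. \<Prod>j<i. (x i - x j)\<^sup>2 * ((x i - x j)\<^sup>2 - 0\<^sup>2))) (at 0)"
      by (intro tendsto_intros)
    show "\<forall>\<^sub>F \<epsilon> in at 0. ?lc * (\<Prod>i<n. \<Prod>j<i. (x i - x j)\<^sup>2 * ((x i - x j)\<^sup>2 - \<epsilon>\<^sup>2)) = det (C \<epsilon>)"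
      by (auto simp: eventually_at_filter detC)
  qed
  ultimately have "det ?C = ?lc * (\<Prod>i<n. \<Prod>j<i. (x i - x j)\<^sup>2 * ((x i - x j)\<^sup>2 - 0\<^sup>2))"
    by (rule tendsto_unique[rotated]) simp
  also have "(\<Prod>i<n. \<Prod>j<i. (x i - x j)\<^sup>2 * ((x i - x j)\<^sup>2 - 0\<^sup>2)) = (\<Prod>i<n. \<Prod>j<i. x i - x j) ^ 4"
  proof -
    have "(x i - x j)\<^sup>2 * ((x i - x j)\<^sup>2 - 0\<^sup>2) = (x i - x j) ^ 4" for i j
      by (simp add: power2_eq_square power4_eq_xxxx)
    then show ?thesis by (simp only: prod_power_distrib)
  qed
  finally show ?thesis .
qed

section \<open>Covariance of the entries of a GSE matrix\<close>

text \<open>\<open>partner\<close> and \<open>sg\<close> encode the symplectic matrix J, whose only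
  nonzero entries are \<open>sg a\<close> at \<open>(a, partner a)\<close>.\<close>

definition partner :: "nat \<Rightarrow> nat" where
  "partner a = (if even a then a + 1 else a - 1)"

definition sg :: "nat \<Rightarrow> complex" where
  "sg a = (if even a then 1 else - 1)"

lemma partner_partner [simp]: "partner (partner a) = a"
  by (auto simp: partner_def elim!: oddE)

lemma sg_partner [simp]: "sg (partner a) = - sg a"
  by (auto simp: partner_def sg_def)

lemma sg_mult_self [simp]: "sg a * sg a = 1" "sg a * (sg a * z) = z"
  by (auto simp: sg_def)

lemma partner_less: "a < 2 * n \<Longrightarrow> partner a < 2 * n"
  by (auto simp: partner_def elim!: evenE oddE)

lemma sum_partner: "(\<Sum>b<2 * n. f (partner b)) = (\<Sum>b<2 * n. f b)"
  by (rule sum.reindex_bij_witness[of _ partner partner]) (auto dest: partner_less)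

text \<open>The four unit quaternions as complex \<open>2 \<times> 2\<close> blocks, and the sign of each one under conjugation.\<close>

definition quat_unit :: "nat \<Rightarrow> nat \<Rightarrow> nat \<Rightarrow> complex" where
  "quat_unit c u v = (if c = 0 then (if u = v then 1 else 0)
     else if c = 1 then (if u = v then sg u * \<i> else 0)
     else if c = 2 then (if u = v then 0 else sg u)
     else (if u = v then 0 else \<i>))"

definition cnj_sign :: "nat \<Rightarrow> complex" where
  "cnj_sign c = (if c = 0 then 1 else - 1)"

text \<open>\<open>(i, j, c)\<close> names the c-th quaternionic component of the entry in row i and
  column j. Only the free real parameters are listed: the upper triangle, and on the diagonal the
  real component alone.\<close>

definition gse_index :: "nat \<Rightarrow> (nat \<times> nat \<times> nat) set" where
  "gse_index n = (SIGMA i:{..<n}. SIGMA j:{i..<n}. if i = j then {0} else {..<4})"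

text \<open>Variances after division by \<open>\<sigma> * sqrt 2\<close>:
  \<open>\<sigma>\<^sup>2\<close> on the diagonal and \<open>\<sigma>\<^sup>2 / 2\<close> for each
  component off it, both divided by \<open>2 * \<sigma>\<^sup>2\<close>.\<close>

definition gse_var :: "nat \<times> nat \<times> nat \<Rightarrow> real" where
  "gse_var = (\<lambda>(i, j, c). if i = j then 1 / 2 else 1 / 4)"

text \<open>The \<open>(a, b)\<close> entry of the complex image of the self-adjoint matrix whose
  only nonzero coordinate is the given one, equal to 1. The second branch fills the lower triangle
  with the conjugate quaternion.\<close>

definition gse_basis :: "nat \<times> nat \<times> nat \<Rightarrow> nat \<Rightarrow> nat \<Rightarrow> complex" where
  "gse_basis = (\<lambda>(i, j, c) a b.
     if a div 2 = i \<and> b div 2 = j then quat_unit c (a mod 2) (b mod 2)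
     else if a div 2 = j \<and> b div 2 = i then cnj_sign c * quat_unit c (a mod 2) (b mod 2)
     else 0)"

lemma finite_gse_index [simp]: "finite (gse_index n)"
  unfolding gse_index_def by (intro finite_SigmaI) auto

lemma mem_gse_index [simp]:
  "(i, j, c) \<in> gse_index n \<longleftrightarrow> i \<le> j \<and> j < n \<and> (if i = j then c = 0 else c < 4)"
  unfolding gse_index_def by (cases "i = j") auto

text \<open>An index pair lies in exactly one 2 by 2 block, so only the components of that block
  contribute. The weight \<open>f\<close> is left free because it stands for the coordinates
  themselves as well as for covariances.\<close>

lemma sum_gse_index_basis:
  assumes "a < 2 * n" "b < 2 * n"
  shows "(\<Sum>\<alpha>\<in>gse_index n. gse_basis \<alpha> a b * f \<alpha>) =
    (let p = a div 2; q = b div 2; u = a mod 2; v = b mod 2 in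
     if p = q then quat_unit 0 u v * f (p, p, 0)
     else if p < q then (\<Sum>c<4. quat_unit c u v * f (p, q, c))
     else (\<Sum>c<4. cnj_sign c * quat_unit c u v * f (q, p, c)))"
proof -
  define p q where "p = a div 2" and "q = b div 2"
  define S where "S = (if p = q then {(p, p, 0)} else if p < q then (\<lambda>c. (p, q, c)) ` {..<4}
     else (\<lambda>c. (q, p, c)) ` {..<4 :: nat})"
  have pq: "p < n" "q < n" using assms by (auto simp: p_def q_def)
  have "S \<subseteq> gse_index n"
    using pq by (cases "p = q"; cases "p < q") (auto simp: S_def)
  then have "(\<Sum>\<alpha>\<in>gse_index n. gse_basis \<alpha> a b * f \<alpha>) = (\<Sum>\<alpha>\<in>S. gse_basis \<alpha> a b * f \<alpha>)"
  proof (intro sum.mono_neutral_right ballI)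
    fix \<alpha> assume "\<alpha> \<in> gse_index n - S"
    then show "gse_basis \<alpha> a b * f \<alpha> = 0"
      by (cases \<alpha>; cases "p = q"; cases "p < q")
        (auto simp: S_def gse_basis_def p_def[symmetric] q_def[symmetric] split: if_split_asm)
  qed simp_all
  also have "\<dots> = (if p = q then quat_unit 0 (a mod 2) (b mod 2) * f (p, p, 0)
     else if p < q then (\<Sum>c<4. quat_unit c (a mod 2) (b mod 2) * f (p, q, c))
     else (\<Sum>c<4. cnj_sign c * quat_unit c (a mod 2) (b mod 2) * f (q, p, c)))"
    by (cases "p = q"; cases "p < q")
      (simp_all add: S_def sum.reindex inj_on_def gse_basis_def p_def[symmetric] q_def[symmetric])
  finally show ?thesis unfolding Let_def p_def q_def .
qed

text \<open>Completeness relations of the quaternion units. Four units of variance 1/4 off the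
  diagonal and one of variance 1/2 on it lead to the same constant 1/2, which is why a single
  covariance formula holds for all entries.\<close>

lemma quat_unit_contract:
  assumes "u < 2" "v < 2" "u' < 2" "v' < 2"
  shows "(\<Sum>c<4. quat_unit c u v * quat_unit c u' v') =
      2 * ((if u' = partner u then sg u else 0) * (if v' = partner v then sg v else 0))"
    and "(\<Sum>c<4. cnj_sign c * quat_unit c u v * quat_unit c u' v') =
      2 * ((if u = v' then 1 else 0) * (if v = u' then 1 else 0))"
    and "quat_unit 0 u v * quat_unit 0 u' v' =
      (if u = v' then 1 else 0) * (if v = u' then 1 else 0)
      + (if u' = partner u then sg u else 0) * (if v' = partner v then sg v else 0)"
proof -
  have sum4: "(\<Sum>c<4. f c) = f 0 + f 1 + f 2 + f 3" for f :: "nat \<Rightarrow> complex"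
    by (simp add: lessThan_nat_numeral lessThan_Suc numeral_3_eq_3 numeral_2_eq_2)
  have bits: "u = 0 \<or> u = 1" "v = 0 \<or> v = 1" "u' = 0 \<or> u' = 1" "v' = 0 \<or> v' = 1"
    using assms by auto
  note defs = sum4 quat_unit_def sg_def cnj_sign_def partner_def
  show "(\<Sum>c<4. quat_unit c u v * quat_unit c u' v') =
      2 * ((if u' = partner u then sg u else 0) * (if v' = partner v then sg v else 0))"
    using bits by (elim disjE; simp add: defs)
  show "(\<Sum>c<4. cnj_sign c * quat_unit c u v * quat_unit c u' v') =
      2 * ((if u = v' then 1 else 0) * (if v = u' then 1 else 0))"
    using bits by (elim disjE; simp add: defs)
  show "quat_unit 0 u v * quat_unit 0 u' v' =
      (if u = v' then 1 else 0) * (if v = u' then 1 else 0)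
      + (if u' = partner u then sg u else 0) * (if v' = partner v then sg v else 0)"
    using bits by (elim disjE; simp add: defs)
qed

lemma eq_iff_div_mod_2: "a = b \<longleftrightarrow> a div 2 = b div 2 \<and> a mod 2 = b mod (2 :: nat)"
  by (metis div_mult_mod_eq)

lemma eq_partner_iff: "c = partner a \<longleftrightarrow> c div 2 = a div 2 \<and> c mod 2 = partner (a mod 2)"
  by (auto simp: partner_def elim!: evenE oddE) presburger+

lemma sg_mod_2 [simp]: "sg (a mod 2) = sg a"
  by (simp add: sg_def)

text \<open>The first term is the covariance of a Hermitian matrix, the second its twist
  \<open>J a c * J b d\<close>. The cases are the positions of the block of \<open>(a, b)\<close>:
  on, above or below the diagonal.\<close>

lemma gse_covariance:
  assumes "a < 2 * n" "b < 2 * n" "c < 2 * n" "d < 2 * n"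
  shows "(\<Sum>\<alpha>\<in>gse_index n. of_real (gse_var \<alpha>) * (gse_basis \<alpha> a b * gse_basis \<alpha> c d)) =
    1 / 2 * ((if a = d then 1 else 0) * (if b = c then 1 else 0)
       + (if c = partner a then sg a else 0) * (if d = partner b then sg b else 0))"
proof -
  have m: "a mod 2 < 2" "b mod 2 < 2" "c mod 2 < 2" "d mod 2 < 2" by auto
  have "(\<Sum>\<alpha>\<in>gse_index n. of_real (gse_var \<alpha>) * (gse_basis \<alpha> a b * gse_basis \<alpha> c d)) =
    (\<Sum>\<alpha>\<in>gse_index n. gse_basis \<alpha> a b * (of_real (gse_var \<alpha>) * gse_basis \<alpha> c d))"
    by (intro sum.cong) (auto simp: ac_simps)
  also have "\<dots> = 1 / 2 * ((if a = d then 1 else 0) * (if b = c then 1 else 0)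
       + (if c = partner a then sg a else 0) * (if d = partner b then sg b else 0))"
  proof -
    consider "a div 2 = b div 2" | "a div 2 < b div 2" | "b div 2 < a div 2" by linarith
    then show ?thesis
    proof cases
      case 1
      show ?thesis
        unfolding sum_gse_index_basis[OF assms(1,2)] eq_iff_div_mod_2[of a d] eq_iff_div_mod_2[of b c]
          eq_partner_iff[of c a] eq_partner_iff[of d b]
        using 1 quat_unit_contract(3)[OF m]
        by (auto simp: Let_def gse_basis_def gse_var_def)
    next
      case 2
      have "(\<Sum>k<4. quat_unit k (a mod 2) (b mod 2) *
           (of_real (gse_var (a div 2, b div 2, k)) * gse_basis (a div 2, b div 2, k) c d)) =
        (if c div 2 = a div 2 \<and> d div 2 = b div 2 then
            1 / 4 * (\<Sum>k<4. quat_unit k (a mod 2) (b mod 2) * quat_unit k (c mod 2) (d mod 2))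
         else if c div 2 = b div 2 \<and> d div 2 = a div 2 then
            1 / 4 * (\<Sum>k<4. cnj_sign k * quat_unit k (a mod 2) (b mod 2) * quat_unit k (c mod 2) (d mod 2))
         else 0)"
        using 2 by (auto simp: gse_basis_def gse_var_def sum_distrib_left ac_simps)
      then show ?thesis
        unfolding sum_gse_index_basis[OF assms(1,2)] eq_iff_div_mod_2[of a d] eq_iff_div_mod_2[of b c]
          eq_partner_iff[of c a] eq_partner_iff[of d b]
        using 2 quat_unit_contract(1,2)[OF m]
        by (auto simp: Let_def)
    next
      case 3
      \<comment> \<open>Below the diagonal both factors may be conjugate blocks; the two signs then
        cancel.\<close>
      have cs: "cnj_sign k * cnj_sign k = 1" for k by (simp add: cnj_sign_def)
      have "(\<Sum>k<4. cnj_sign k * quat_unit k (a mod 2) (b mod 2) *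
           (of_real (gse_var (b div 2, a div 2, k)) * gse_basis (b div 2, a div 2, k) c d)) =
        (if c div 2 = a div 2 \<and> d div 2 = b div 2 then
            1 / 4 * (\<Sum>k<4. (cnj_sign k * cnj_sign k) * (quat_unit k (a mod 2) (b mod 2) * quat_unit k (c mod 2) (d mod 2)))
         else if c div 2 = b div 2 \<and> d div 2 = a div 2 then
            1 / 4 * (\<Sum>k<4. cnj_sign k * quat_unit k (a mod 2) (b mod 2) * quat_unit k (c mod 2) (d mod 2))
         else 0)"
        using 3 by (auto simp: gse_basis_def gse_var_def sum_distrib_left ac_simps)
      then show ?thesis
        unfolding sum_gse_index_basis[OF assms(1,2)] eq_iff_div_mod_2[of a d] eq_iff_div_mod_2[of b c]
          eq_partner_iff[of c a] eq_partner_iff[of d b] cs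
        using 3 quat_unit_contract(1,2)[OF m]
        by (auto simp: Let_def)
    qed
  qed
  finally show ?thesis .
qed

lemma sum_gse_covariance:
  assumes "a < 2 * n" "b < 2 * n"
  shows "(\<Sum>c<2 * n. \<Sum>d<2 * n. (\<Sum>\<alpha>\<in>gse_index n. of_real (gse_var \<alpha>) * (gse_basis \<alpha> a b * gse_basis \<alpha> c d)) * g c d)
    = 1 / 2 * (g b a + sg a * sg b * g (partner a) (partner b))"
proof -
  have "(\<Sum>c<2 * n. \<Sum>d<2 * n. (\<Sum>\<alpha>\<in>gse_index n. of_real (gse_var \<alpha>) * (gse_basis \<alpha> a b * gse_basis \<alpha> c d)) * g c d)
    = (\<Sum>c<2 * n. \<Sum>d<2 * n. 1 / 2 * ((if d = a then if c = b then g c d else 0 else 0)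
        + (if d = partner b then if c = partner a then sg a * sg b * g c d else 0 else 0)))"
    by (intro sum.cong refl) (simp add: gse_covariance[OF assms] if_distrib cong: if_cong)
  also have "\<dots> = 1 / 2 * ((\<Sum>c<2 * n. \<Sum>d<2 * n. if d = a then if c = b then g c d else 0 else 0)
        + (\<Sum>c<2 * n. \<Sum>d<2 * n. if d = partner b then if c = partner a then sg a * sg b * g c d else 0 else 0))"
    by (simp only: sum.distrib sum_distrib_left[symmetric])
  also have "\<dots> = 1 / 2 * (g b a + sg a * sg b * g (partner a) (partner b))"
    using assms partner_less[OF assms(1)] partner_less[OF assms(2)]
    by simp
  finally show ?thesis .
qed

text \<open>The complex image of a self-adjoint quaternionic matrix satisfies \<open>X\<^sup>T = J X J\<^sup>-\<^sup>1\<close>.\<close>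

definition self_dual :: "nat \<Rightarrow> (nat \<Rightarrow> nat \<Rightarrow> complex) \<Rightarrow> bool" where
  "self_dual N X \<longleftrightarrow> (\<forall>a<N. \<forall>b<N. X (partner a) (partner b) = sg a * sg b * X b a)"

text \<open>Of the two covariance terms, one splits the trace in two. The twisted one inserts the
  transpose of X conjugated by J, which self-duality turns back into X, with the sign of J^2 =
  -1.\<close>

lemma gse_contract_1:
  assumes "self_dual (2 * n) X"
  shows "(\<Sum>\<alpha>\<in>gse_index n. of_real (gse_var \<alpha>) * (\<Sum>a<2 * n. \<Sum>b<2 * n. \<Sum>c<2 * n. \<Sum>d<2 * n.
      gse_basis \<alpha> a b * X b c * gse_basis \<alpha> c d * Z d a))
    = 1 / 2 * ((\<Sum>a<2 * n. X a a) * (\<Sum>a<2 * n. Z a a) - (\<Sum>a<2 * n. \<Sum>b<2 * n. X a b * Z b a))"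
proof -
  have "(\<Sum>\<alpha>\<in>gse_index n. of_real (gse_var \<alpha>) * (\<Sum>a<2 * n. \<Sum>b<2 * n. \<Sum>c<2 * n. \<Sum>d<2 * n.
      gse_basis \<alpha> a b * X b c * gse_basis \<alpha> c d * Z d a)) =
    (\<Sum>a<2 * n. \<Sum>b<2 * n. \<Sum>c<2 * n. \<Sum>d<2 * n.
      (\<Sum>\<alpha>\<in>gse_index n. of_real (gse_var \<alpha>) * (gse_basis \<alpha> a b * gse_basis \<alpha> c d)) * (X b c * Z d a))"
    unfolding sum_distrib_left sum_distrib_right sum.swap[of _ "{..<2 * n}" "gse_index n"]
    by (intro sum.cong refl) (simp add: ac_simps)
  also have "\<dots> = (\<Sum>a<2 * n. \<Sum>b<2 * n. 1 / 2 * (X b b * Z a a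
      + sg a * sg b * (X b (partner a) * Z (partner b) a)))"
    by (intro sum.cong refl) (simp add: sum_gse_covariance[where g = "\<lambda>c d. X _ c * Z d _"])
  also have "\<dots> = (\<Sum>a<2 * n. \<Sum>b<2 * n. 1 / 2 * (X b b * Z a a - X a (partner b) * Z (partner b) a))"
  proof (intro sum.cong refl)
    fix a b assume ab: "a \<in> {..<2 * n}" "b \<in> {..<2 * n}"
    then have "X (partner (partner b)) (partner a) = sg (partner b) * sg a * X a (partner b)"
      using assms partner_less[of b n] unfolding self_dual_def by blast
    then have "X b (partner a) = - sg b * sg a * X a (partner b)" by simp
    then show "1 / 2 * (X b b * Z a a + sg a * sg b * (X b (partner a) * Z (partner b) a)) =
        1 / 2 * (X b b * Z a a - X a (partner b) * Z (partner b) a)"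
      by (simp add: sg_def)
  qed
  also have "\<dots> = 1 / 2 * ((\<Sum>a<2 * n. X a a) * (\<Sum>a<2 * n. Z a a)
      - (\<Sum>a<2 * n. \<Sum>b<2 * n. X a (partner b) * Z (partner b) a))"
    unfolding sum_product sum.swap[of "\<lambda>i j. X i i * Z j j"]
    by (simp only: sum_subtractf sum_distrib_left[symmetric])
  finally show ?thesis
    by (simp add: sum_partner[of "\<lambda>b. X _ b * Z b _"])
qed

text \<open>Between two separate traces both covariance terms join them. Self-duality makes the two
  contributions equal, so that the factor 1/2 disappears.\<close>

lemma gse_contract_2:
  assumes "self_dual (2 * n) Z"
  shows "(\<Sum>\<alpha>\<in>gse_index n. of_real (gse_var \<alpha>) * ((\<Sum>a<2 * n. \<Sum>b<2 * n. gse_basis \<alpha> a b * X b a)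
      * (\<Sum>c<2 * n. \<Sum>d<2 * n. gse_basis \<alpha> c d * Z d c)))
    = (\<Sum>a<2 * n. \<Sum>b<2 * n. X a b * Z b a)"
proof -
  have "(\<Sum>\<alpha>\<in>gse_index n. of_real (gse_var \<alpha>) * ((\<Sum>a<2 * n. \<Sum>b<2 * n. gse_basis \<alpha> a b * X b a)
      * (\<Sum>c<2 * n. \<Sum>d<2 * n. gse_basis \<alpha> c d * Z d c))) =
    (\<Sum>a<2 * n. \<Sum>b<2 * n. \<Sum>c<2 * n. \<Sum>d<2 * n.
      (\<Sum>\<alpha>\<in>gse_index n. of_real (gse_var \<alpha>) * (gse_basis \<alpha> a b * gse_basis \<alpha> c d)) * (X b a * Z d c))"
    unfolding sum_distrib_right unfolding sum_distrib_left sum.swap[of _ "{..<2 * n}" "gse_index n"]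
    by (intro sum.cong refl) (simp add: ac_simps)
  also have "\<dots> = (\<Sum>a<2 * n. \<Sum>b<2 * n. 1 / 2 * (X b a * Z a b
      + sg a * sg b * (X b a * Z (partner b) (partner a))))"
    by (intro sum.cong refl) (simp add: sum_gse_covariance[where g = "\<lambda>c d. X _ _ * Z d c"])
  also have "\<dots> = (\<Sum>a<2 * n. \<Sum>b<2 * n. X b a * Z a b)"
  proof (intro sum.cong refl)
    fix a b assume ab: "a \<in> {..<2 * n}" "b \<in> {..<2 * n}"
    then have "Z (partner b) (partner a) = sg b * sg a * Z a b"
      using assms unfolding self_dual_def by blast
    then show "1 / 2 * (X b a * Z a b + sg a * sg b * (X b a * Z (partner b) (partner a))) = X b a * Z a b"
      by (simp add: sg_def)
  qed
  also have "\<dots> = (\<Sum>b<2 * n. \<Sum>a<2 * n. X b a * Z a b)" by (rule sum.swap)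
  finally show ?thesis .
qed

section \<open>Loop equations for the GSE\<close>

lemma index_mult_mat_sum:
  assumes "X \<in> carrier_mat N N" "Z \<in> carrier_mat N N" "a < N" "b < N"
  shows "(X * Z) $$ (a, b) = (\<Sum>c<N. X $$ (a, c) * Z $$ (c, b))"
  using assms by (simp add: scalar_prod_def atLeast0LessThan)

lemma mat_trace_mult:
  assumes "X \<in> carrier_mat N N" "Z \<in> carrier_mat N N"
  shows "mat_trace (X * Z) = (\<Sum>a<N. \<Sum>b<N. X $$ (a, b) * Z $$ (b, a))"
  using assms by (auto simp: mat_trace_def index_mult_mat_sum[OF assms] simp del: index_mult_mat(1) intro!: sum.cong)

lemma mat_trace_comm:
  fixes X Z :: "'a :: comm_semiring_0 mat"
  assumes "X \<in> carrier_mat N N" "Z \<in> carrier_mat N N"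
  shows "mat_trace (X * Z) = mat_trace (Z * X)"
  unfolding mat_trace_mult[OF assms] mat_trace_mult[OF assms(2,1)]
  by (subst sum.swap) (simp add: mult.commute)

lemma mat_trace_add:
  assumes "X \<in> carrier_mat N N" "Z \<in> carrier_mat N N"
  shows "mat_trace (X + Z) = mat_trace X + mat_trace Z"
  using assms by (simp add: mat_trace_def sum.distrib)

lemma pow_mat_add:
  fixes X :: "'a :: semiring_1 mat"
  assumes "X \<in> carrier_mat N N"
  shows "X ^\<^sub>m (k + l) = X ^\<^sub>m k * X ^\<^sub>m l"
  using assms by (induction l) (simp_all add: assoc_mult_mat[of _ N N _ N _ N])

text \<open>The result of integrating by parts in one factor Y of \<open>tr Y^(k+1)\<close>. The
  derivative hits another factor of the same trace, which gives the first line, or one of the traces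
  listed in \<open>ks\<close>, which gives the second. Truncated subtractions occur only beside a
  factor that is zero.\<close>

definition loop_rhs :: "(nat list \<Rightarrow> complex) \<Rightarrow> nat \<Rightarrow> nat list \<Rightarrow> complex" where
  "loop_rhs \<Phi> k ks =
     1 / 2 * ((\<Sum>r<k. \<Phi> (r # (k - 1 - r) # ks)) - of_nat k * \<Phi> ((k - 1) # ks))
     + (\<Sum>j<length ks. of_nat (ks ! j) * \<Phi> ((k + ks ! j - 1) # take j ks @ drop (Suc j) ks))"

definition loop_equations :: "complex \<Rightarrow> (nat list \<Rightarrow> complex) \<Rightarrow> bool" where
  "loop_equations N \<Phi> \<longleftrightarrow>
     (\<forall>ks. \<Phi> (0 # ks) = N * \<Phi> ks) \<and> (\<forall>k ks. \<Phi> (Suc k # ks) = loop_rhs \<Phi> k ks)"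

lemma loop_equations_scale: "loop_equations N \<Phi> \<Longrightarrow> loop_equations N (\<lambda>ks. c * \<Phi> ks)"
proof -
  have "loop_rhs (\<lambda>ks. c * \<Phi> ks) k ks = c * loop_rhs \<Phi> k ks" for k ks
    unfolding loop_rhs_def
    by (simp only: distrib_left right_diff_distrib sum_distrib_left mult.left_commute[of c])
  then show "loop_equations N \<Phi> \<Longrightarrow> ?thesis"
    unfolding loop_equations_def by simp
qed

lemma integral_loop_rhs:
  assumes "\<And>ks. integrable M (F ks)"
  shows "(\<integral>\<omega>. loop_rhs (\<lambda>ks. F ks \<omega>) k ks \<partial>M) = loop_rhs (\<lambda>ks. integral\<^sup>L M (F ks)) k ks"
  unfolding loop_rhs_def using assms by simp

lemma sum_list_remove_nth:
  "j < length ks \<Longrightarrow> sum_list (take j ks @ drop (Suc j) ks) + ks ! j = sum_list (ks :: nat list)"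
  by (subst (3) id_take_nth_drop[of j ks]) simp_all

text \<open>Each of the equations lowers the total degree plus the number of factors.\<close>

lemma loop_equations_unique:
  assumes "loop_equations N \<Phi>" "loop_equations N \<Psi>" "\<Phi> [] = \<Psi> []"
  shows "\<Phi> ks = \<Psi> ks"
proof (induction "sum_list ks + length ks" arbitrary: ks rule: less_induct)
  case less
  show ?case
  proof (cases ks)
    case Nil
    then show ?thesis using assms(3) by simp
  next
    case (Cons k' ks')
    show ?thesis
    proof (cases k')
      case 0
      then show ?thesis using assms(1,2) less[of ks'] by (simp add: Cons loop_equations_def)
    next
      case (Suc k)
      \<comment> \<open>The critical case: a split takes two from the degree and adds one factor, a
        net loss of one.\<close>
      have 1: "\<Phi> (r # (k - 1 - r) # ks') = \<Psi> (r # (k - 1 - r) # ks')" if "r < k" for r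
        by (rule less) (use that Cons Suc in simp)
      have 2: "of_nat k * \<Phi> ((k - 1) # ks') = of_nat k * \<Psi> ((k - 1) # ks')"
      proof (cases k)
        case (Suc m)
        then show ?thesis using less[of "m # ks'"] Cons \<open>k' = Suc k\<close> by simp
      qed simp
      have 3: "of_nat (ks' ! j) * \<Phi> ((k + ks' ! j - 1) # take j ks' @ drop (Suc j) ks')
          = of_nat (ks' ! j) * \<Psi> ((k + ks' ! j - 1) # take j ks' @ drop (Suc j) ks')"
        if "j < length ks'" for j
      proof (cases "ks' ! j")
        case (Suc m)
        have "\<Phi> ((k + ks' ! j - 1) # take j ks' @ drop (Suc j) ks')
            = \<Psi> ((k + ks' ! j - 1) # take j ks' @ drop (Suc j) ks')"
          by (rule less) (use that Cons \<open>k' = Suc k\<close> sum_list_remove_nth[OF that] Suc in simp)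
        then show ?thesis by simp
      qed simp
      have S1: "(\<Sum>r<k. \<Phi> (r # (k - 1 - r) # ks')) = (\<Sum>r<k. \<Psi> (r # (k - 1 - r) # ks'))"
        by (rule sum.cong[OF refl]) (rule 1, simp)
      have S3: "(\<Sum>j<length ks'. of_nat (ks' ! j) * \<Phi> ((k + ks' ! j - 1) # take j ks' @ drop (Suc j) ks'))
          = (\<Sum>j<length ks'. of_nat (ks' ! j) * \<Psi> ((k + ks' ! j - 1) # take j ks' @ drop (Suc j) ks'))"
        by (rule sum.cong[OF refl]) (rule 3, simp)
      have "loop_rhs \<Phi> k ks' = loop_rhs \<Psi> k ks'"
        unfolding loop_rhs_def S1 2 S3 ..
      then show ?thesis
        using assms(1,2) unfolding Cons Suc loop_equations_def by simp
    qed
  qed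
qed

lemma quat_unit_partner:
  assumes "u < 2" "v < 2"
  shows "quat_unit c (partner u) (partner v) = sg u * sg v * (cnj_sign c * quat_unit c v u)"
proof -
  have bits: "u = 0 \<or> u = 1" "v = 0 \<or> v = 1" using assms by auto
  then show ?thesis
    by (elim disjE; simp add: quat_unit_def sg_def cnj_sign_def partner_def)
qed

lemma partner_div_2 [simp]: "partner a div 2 = a div 2"
  using eq_partner_iff[of "partner a" a] by simp

lemma partner_mod_2 [simp]: "partner a mod 2 = partner (a mod 2)"
  using eq_partner_iff[of "partner a" a] by simp

text \<open>Conjugation by J turns a quaternionic block into the transpose of its conjugate
  quaternion; self-adjointness places that quaternion at the transposed position.\<close>

lemma gse_basis_partner:
  assumes "\<alpha> \<in> gse_index n"
  shows "gse_basis \<alpha> (partner a) (partner b) = sg a * sg b * gse_basis \<alpha> b a"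
proof -
  obtain i j c where \<alpha>: "\<alpha> = (i, j, c)" by (cases \<alpha>) auto
  define u v where "u = a mod 2" and "v = b mod 2"
  have Q: "quat_unit c (partner u) (partner v) = sg a * sg b * (cnj_sign c * quat_unit c v u)"
    using quat_unit_partner[of u v c] by (simp add: u_def v_def)
  have cs: "cnj_sign c = 1 \<or> cnj_sign c = - 1" by (simp add: cnj_sign_def)
  have L: "gse_basis \<alpha> (partner a) (partner b) =
     (if a div 2 = i \<and> b div 2 = j then quat_unit c (partner u) (partner v)
      else if a div 2 = j \<and> b div 2 = i then cnj_sign c * quat_unit c (partner u) (partner v) else 0)"
    unfolding \<alpha> gse_basis_def u_def v_def by simp
  have R: "gse_basis \<alpha> b a =
     (if b div 2 = i \<and> a div 2 = j then quat_unit c v u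
      else if b div 2 = j \<and> a div 2 = i then cnj_sign c * quat_unit c v u else 0)"
    unfolding \<alpha> gse_basis_def u_def v_def by simp
  show ?thesis
  proof (cases "i = j")
    case True
    \<comment> \<open>A diagonal coordinate has c = 0; an imaginary unit there would break
      self-duality.\<close>
    then have "cnj_sign c = 1" using assms by (simp add: \<alpha> cnj_sign_def)
    then show ?thesis unfolding L R Q using True by simp
  next
    case False
    then show ?thesis unfolding L R Q using cs by (elim disjE) simp_all
  qed
qed

section \<open>Differentiating traces of powers of the normalised matrix\<close>

locale gse_coords = gaussian_moments M "gse_index n" \<xi> gse_var
  for M :: "'w measure" and n :: nat and \<xi>
begin

definition Y :: "'w \<Rightarrow> complex mat" where
  "Y \<omega> = mat (2 * n) (2 * n) (\<lambda>(a, b). \<Sum>\<alpha>\<in>gse_index n. gse_basis \<alpha> a b * of_real (\<xi> \<alpha> \<omega>))"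

definition H :: "nat \<times> nat \<times> nat \<Rightarrow> complex mat" where
  "H \<alpha> = mat (2 * n) (2 * n) (\<lambda>(a, b). gse_basis \<alpha> a b)"

lemma Y_carrier [simp]: "Y \<omega> \<in> carrier_mat (2 * n) (2 * n)"
  by (simp add: Y_def)

lemma dim_row_Y [simp]: "dim_row (Y \<omega>) = 2 * n"
  by (simp add: Y_def)

lemma H_index [simp]: "a < 2 * n \<Longrightarrow> b < 2 * n \<Longrightarrow> H \<alpha> $$ (a, b) = gse_basis \<alpha> a b"
  by (simp add: H_def)

lemma H_carrier [simp]: "H \<alpha> \<in> carrier_mat (2 * n) (2 * n)"
  by (simp add: H_def)

lemma Y_pow_carrier [simp]: "Y \<omega> ^\<^sub>m k \<in> carrier_mat (2 * n) (2 * n)"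
  by (rule pow_carrier_mat) simp

lemma Y_comm_pow: "Y \<omega> * Y \<omega> ^\<^sub>m k = Y \<omega> ^\<^sub>m k * Y \<omega>"
  using pow_mat_add[of "Y \<omega>" "2 * n" 1 k] pow_mat_add[of "Y \<omega>" "2 * n" k 1] by (simp add: add.commute)

text \<open>Transposition reverses products, so the induction step arrives at \<open>Y * Y^k\<close>
  and concludes by commutation.\<close>

lemma self_dual_Y_pow: "self_dual (2 * n) (\<lambda>a b. (Y \<omega> ^\<^sub>m k) $$ (a, b))"
  unfolding self_dual_def
proof (induction k)
  case 0
  have "partner a = partner b \<longleftrightarrow> a = b" for a b by (metis partner_partner)
  moreover have "dim_row (Y \<omega>) = 2 * n" by (simp add: Y_def)
  ultimately show ?case by (auto simp: partner_less)
next
  case (Suc k)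
  show ?case
  proof (intro allI impI)
    fix a b assume ab: "a < 2 * n" "b < 2 * n"
    note pab = partner_less[OF ab(1)] partner_less[OF ab(2)]
    have Yp: "Y \<omega> $$ (partner c, partner b) = sg c * sg b * Y \<omega> $$ (b, c)" if "c < 2 * n" for c
      using that ab partner_less[OF that] pab
      by (auto simp: Y_def gse_basis_partner sum_distrib_left ac_simps intro!: sum.cong)
    have "(Y \<omega> ^\<^sub>m Suc k) $$ (partner a, partner b)
        = (\<Sum>c<2 * n. (Y \<omega> ^\<^sub>m k) $$ (partner a, c) * Y \<omega> $$ (c, partner b))"
      using pab by (simp add: index_mult_mat_sum[of _ "2 * n"] del: index_mult_mat(1))
    also have "\<dots> = (\<Sum>c<2 * n. (Y \<omega> ^\<^sub>m k) $$ (partner a, partner c) * Y \<omega> $$ (partner c, partner b))"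
      by (rule sum_partner[symmetric])
    also have "\<dots> = (\<Sum>c<2 * n. sg a * sg b * (Y \<omega> $$ (b, c) * (Y \<omega> ^\<^sub>m k) $$ (c, a)))"
    proof (intro sum.cong refl)
      fix c assume "c \<in> {..<2 * n}"
      then have "c < 2 * n" by simp
      then have "(Y \<omega> ^\<^sub>m k) $$ (partner a, partner c) = sg a * sg c * (Y \<omega> ^\<^sub>m k) $$ (c, a)"
        using Suc ab by blast
      then show "(Y \<omega> ^\<^sub>m k) $$ (partner a, partner c) * Y \<omega> $$ (partner c, partner b)
          = sg a * sg b * (Y \<omega> $$ (b, c) * (Y \<omega> ^\<^sub>m k) $$ (c, a))"
        unfolding Yp[OF \<open>c < 2 * n\<close>] by (simp add: sg_def)
    qed
    also have "\<dots> = sg a * sg b * (Y \<omega> * Y \<omega> ^\<^sub>m k) $$ (b, a)"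
      using ab by (simp add: index_mult_mat_sum[of _ "2 * n"] sum_distrib_left del: index_mult_mat(1))
    finally show "(Y \<omega> ^\<^sub>m Suc k) $$ (partner a, partner b) = sg a * sg b * (Y \<omega> ^\<^sub>m Suc k) $$ (b, a)"
      by (simp only: Y_comm_pow pow_mat.simps)
  qed
qed

text \<open>The partial derivative of the k-th power in direction \<alpha>, by the Leibniz rule on
  \<open>Y^k * Y\<close>, with \<open>H \<alpha>\<close> the derivative of \<open>Y\<close>.\<close>

fun dpow :: "nat \<Rightarrow> nat \<times> nat \<times> nat \<Rightarrow> 'w \<Rightarrow> complex mat" where
  "dpow 0 \<alpha> \<omega> = 0\<^sub>m (2 * n) (2 * n)"
| "dpow (Suc k) \<alpha> \<omega> = dpow k \<alpha> \<omega> * Y \<omega> + Y \<omega> ^\<^sub>m k * H \<alpha>"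

lemma dpow_carrier [simp]: "dpow k \<alpha> \<omega> \<in> carrier_mat (2 * n) (2 * n)"
  by (induction k) (auto intro!: add_carrier_mat mult_carrier_mat[of _ _ "2 * n"])

lemma gder_Y:
  assumes "a < 2 * n" "b < 2 * n"
  shows "gder (\<lambda>\<omega>. Y \<omega> $$ (a, b)) (\<lambda>\<alpha> _. H \<alpha> $$ (a, b))"
proof (rule gder_cong)
  have "gder (\<lambda>\<omega>. \<Sum>\<beta>\<in>gse_index n. gse_basis \<beta> a b * of_real (\<xi> \<beta> \<omega>))
      (\<lambda>\<alpha> _. \<Sum>\<beta>\<in>gse_index n. gse_basis \<beta> a b * (if \<alpha> = \<beta> then 1 else 0))"
    by (intro gder_sum gder_cmult gder_coord)
  then show "gder (\<lambda>\<omega>. Y \<omega> $$ (a, b))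
      (\<lambda>\<alpha> _. \<Sum>\<beta>\<in>gse_index n. gse_basis \<beta> a b * (if \<alpha> = \<beta> then 1 else 0))"
    using assms by (simp add: Y_def)
qed (use assms in \<open>auto simp: H_def if_distrib cong: if_cong\<close>)

lemma gder_Y_pow:
  assumes "a < 2 * n" "b < 2 * n"
  shows "gder (\<lambda>\<omega>. (Y \<omega> ^\<^sub>m k) $$ (a, b)) (\<lambda>\<alpha> \<omega>. dpow k \<alpha> \<omega> $$ (a, b))"
  using assms
proof (induction k arbitrary: a b)
  case 0
  have "dim_row (Y \<omega>) = 2 * n" for \<omega> by (simp add: Y_def)
  then show ?case using 0 gder_const[of "1\<^sub>m (2 * n) $$ (a, b)"] by simp
next
  case (Suc k)
  have "gder (\<lambda>\<omega>. \<Sum>c<2 * n. (Y \<omega> ^\<^sub>m k) $$ (a, c) * Y \<omega> $$ (c, b))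
      (\<lambda>\<alpha> \<omega>. \<Sum>c<2 * n. dpow k \<alpha> \<omega> $$ (a, c) * Y \<omega> $$ (c, b) + (Y \<omega> ^\<^sub>m k) $$ (a, c) * H \<alpha> $$ (c, b))"
    using Suc by (intro gder_sum gder_mult gder_Y) auto
  moreover have "(Y \<omega> ^\<^sub>m Suc k) $$ (a, b) = (\<Sum>c<2 * n. (Y \<omega> ^\<^sub>m k) $$ (a, c) * Y \<omega> $$ (c, b))" for \<omega>
    using Suc.prems by (simp add: index_mult_mat_sum[of _ "2 * n"] del: index_mult_mat(1))
  moreover have "dpow (Suc k) \<alpha> \<omega> $$ (a, b)
      = (\<Sum>c<2 * n. dpow k \<alpha> \<omega> $$ (a, c) * Y \<omega> $$ (c, b) + (Y \<omega> ^\<^sub>m k) $$ (a, c) * H \<alpha> $$ (c, b))" for \<alpha> \<omega>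
  proof -
    have "dpow (Suc k) \<alpha> \<omega> $$ (a, b) = (dpow k \<alpha> \<omega> * Y \<omega>) $$ (a, b) + (Y \<omega> ^\<^sub>m k * H \<alpha>) $$ (a, b)"
      using Suc.prems by (simp add: H_def Y_def del: index_mult_mat(1))
    then show ?thesis
      using Suc.prems by (simp add: index_mult_mat_sum[of _ "2 * n"] sum.distrib del: index_mult_mat(1))
  qed
  ultimately show ?case by simp
qed

text \<open>The factor X is arbitrary because the induction moves the last \<open>Y\<close>
  cyclically to the front, where X absorbs it.\<close>

lemma mat_trace_mult_dpow:
  assumes "X \<in> carrier_mat (2 * n) (2 * n)"
  shows "mat_trace (X * dpow k \<alpha> \<omega>) =
    (\<Sum>r<k. mat_trace (X * (Y \<omega> ^\<^sub>m r * (H \<alpha> * Y \<omega> ^\<^sub>m (k - 1 - r)))))"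
  using assms
proof (induction k arbitrary: X)
  case 0
  then show ?case by (simp add: mat_trace_def)
next
  case (Suc k)
  note assoc = assoc_mult_mat[of _ "2 * n" "2 * n" _ "2 * n" _ "2 * n"]
  have c: "A * B \<in> carrier_mat (2 * n) (2 * n)"
    if "A \<in> carrier_mat (2 * n) (2 * n)" "B \<in> carrier_mat (2 * n) (2 * n)" for A B :: "complex mat"
    using that by (rule mult_carrier_mat)
  have comm: "mat_trace (A * B) = mat_trace (B * A)"
    if "A \<in> carrier_mat (2 * n) (2 * n)" "B \<in> carrier_mat (2 * n) (2 * n)" for A B :: "complex mat"
    using that by (rule mat_trace_comm)
  have "mat_trace (X * dpow (Suc k) \<alpha> \<omega>) =
      mat_trace (X * (dpow k \<alpha> \<omega> * Y \<omega>)) + mat_trace (X * (Y \<omega> ^\<^sub>m k * H \<alpha>))"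
    using Suc.prems
    by (simp add: mult_add_distrib_mat[of _ "2 * n" "2 * n" _ "2 * n"] c mat_trace_add[of _ "2 * n"])
  also have "mat_trace (X * (dpow k \<alpha> \<omega> * Y \<omega>)) = mat_trace ((Y \<omega> * X) * dpow k \<alpha> \<omega>)"
    using comm[of "X * dpow k \<alpha> \<omega>" "Y \<omega>"] Suc.prems by (simp add: assoc c)
  also have "\<dots> = (\<Sum>r<k. mat_trace ((Y \<omega> * X) * (Y \<omega> ^\<^sub>m r * (H \<alpha> * Y \<omega> ^\<^sub>m (k - 1 - r)))))"
    by (rule Suc.IH) (simp add: c Suc.prems)
  also have "\<dots> = (\<Sum>r<k. mat_trace (X * (Y \<omega> ^\<^sub>m r * (H \<alpha> * Y \<omega> ^\<^sub>m (Suc k - 1 - r)))))"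
  proof (rule sum.cong[OF refl])
    fix r assume "r \<in> {..<k}"
    then have "Suc k - 1 - r = Suc (k - 1 - r)" by auto
    then have "X * (Y \<omega> ^\<^sub>m r * (H \<alpha> * Y \<omega> ^\<^sub>m (Suc k - 1 - r)))
        = X * (Y \<omega> ^\<^sub>m r * (H \<alpha> * Y \<omega> ^\<^sub>m (k - 1 - r))) * Y \<omega>"
      using Suc.prems by (simp add: assoc c)
    then show "mat_trace ((Y \<omega> * X) * (Y \<omega> ^\<^sub>m r * (H \<alpha> * Y \<omega> ^\<^sub>m (k - 1 - r))))
        = mat_trace (X * (Y \<omega> ^\<^sub>m r * (H \<alpha> * Y \<omega> ^\<^sub>m (Suc k - 1 - r))))"
      using comm[of "X * (Y \<omega> ^\<^sub>m r * (H \<alpha> * Y \<omega> ^\<^sub>m (k - 1 - r)))" "Y \<omega>"] Suc.prems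
      by (simp add: assoc c)
  qed
  finally show ?case
    using Suc.prems by (simp add: assoc c right_mult_one_mat[OF H_carrier])
qed

definition T :: "nat \<Rightarrow> 'w \<Rightarrow> complex" where
  "T k \<omega> = mat_trace (Y \<omega> ^\<^sub>m k)"

definition prodT :: "nat list \<Rightarrow> 'w \<Rightarrow> complex" where
  "prodT ks \<omega> = (\<Prod>k\<leftarrow>ks. T k \<omega>)"

definition dT :: "nat \<Rightarrow> nat \<times> nat \<times> nat \<Rightarrow> 'w \<Rightarrow> complex" where
  "dT k \<alpha> \<omega> = of_nat k * mat_trace (H \<alpha> * Y \<omega> ^\<^sub>m (k - 1))"

definition dprodT :: "nat list \<Rightarrow> nat \<times> nat \<times> nat \<Rightarrow> 'w \<Rightarrow> complex" where
  "dprodT ks \<alpha> \<omega> = (\<Sum>j<length ks. dT (ks ! j) \<alpha> \<omega> * prodT (take j ks @ drop (Suc j) ks) \<omega>)"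

text \<open>By cyclicity all k terms of the derivative have the same trace.\<close>

lemma mat_trace_dpow: "mat_trace (dpow k \<alpha> \<omega>) = dT k \<alpha> \<omega>"
proof -
  have "mat_trace (Y \<omega> ^\<^sub>m r * (H \<alpha> * Y \<omega> ^\<^sub>m (k - 1 - r))) = mat_trace (H \<alpha> * Y \<omega> ^\<^sub>m (k - 1))"
    if "r < k" for r
  proof -
    have "mat_trace (Y \<omega> ^\<^sub>m r * (H \<alpha> * Y \<omega> ^\<^sub>m (k - 1 - r)))
        = mat_trace (H \<alpha> * Y \<omega> ^\<^sub>m (k - 1 - r) * Y \<omega> ^\<^sub>m r)"
      by (intro mat_trace_comm[where N = "2 * n"] mult_carrier_mat[of _ _ "2 * n"]) auto
    also have "H \<alpha> * Y \<omega> ^\<^sub>m (k - 1 - r) * Y \<omega> ^\<^sub>m r = H \<alpha> * Y \<omega> ^\<^sub>m (k - 1 - r + r)"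
      by (simp add: pow_mat_add[of _ "2 * n"] assoc_mult_mat[of _ "2 * n" "2 * n" _ "2 * n" _ "2 * n"])
    finally show ?thesis using that by simp
  qed
  then have "mat_trace (1\<^sub>m (2 * n) * dpow k \<alpha> \<omega>) = dT k \<alpha> \<omega>"
    by (subst mat_trace_mult_dpow)
      (simp_all add: dT_def left_mult_one_mat[of _ "2 * n" "2 * n"] mult_carrier_mat[of _ _ "2 * n"])
  then show ?thesis by (simp add: left_mult_one_mat[of _ "2 * n" "2 * n"])
qed

lemma mat_trace_sum: "X \<in> carrier_mat N N \<Longrightarrow> mat_trace X = (\<Sum>a<N. X $$ (a, a))"
  by (auto simp: mat_trace_def)

lemma gder_T: "gder (T k) (dT k)"
proof -
  have "gder (\<lambda>\<omega>. \<Sum>a<2 * n. (Y \<omega> ^\<^sub>m k) $$ (a, a)) (\<lambda>\<alpha> \<omega>. \<Sum>a<2 * n. dpow k \<alpha> \<omega> $$ (a, a))"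
    by (intro gder_sum gder_Y_pow) auto
  moreover have "T k = (\<lambda>\<omega>. \<Sum>a<2 * n. (Y \<omega> ^\<^sub>m k) $$ (a, a))"
    by (simp add: fun_eq_iff T_def mat_trace_sum[OF Y_pow_carrier])
  moreover have "dT k = (\<lambda>\<alpha> \<omega>. \<Sum>a<2 * n. dpow k \<alpha> \<omega> $$ (a, a))"
    by (simp add: fun_eq_iff mat_trace_dpow[symmetric] mat_trace_sum[OF dpow_carrier])
  ultimately show ?thesis by simp
qed

lemma gder_trace_H: "gder (\<lambda>\<omega>. mat_trace (H \<beta> * Y \<omega> ^\<^sub>m k)) (\<lambda>\<alpha> \<omega>. mat_trace (H \<beta> * dpow k \<alpha> \<omega>))"
  unfolding mat_trace_mult[OF H_carrier Y_pow_carrier] mat_trace_mult[OF H_carrier dpow_carrier]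
  by (intro gder_sum gder_cmult gder_Y_pow) auto

lemma gder_prodT: "gder (prodT ks) (dprodT ks)"
  unfolding prodT_def[abs_def] dprodT_def[abs_def] by (rule gder_prod_list) (rule gder_T)

text \<open>Expanding one factor in coordinates exhibits the trace as a sum of products of a
  coordinate and a polynomial, the form that \<open>stein\<close> treats.\<close>

lemma T_Suc: "T (Suc k) \<omega> = (\<Sum>\<alpha>\<in>gse_index n. of_real (\<xi> \<alpha> \<omega>) * mat_trace (H \<alpha> * Y \<omega> ^\<^sub>m k))"
proof -
  have "T (Suc k) \<omega> = mat_trace (Y \<omega> * Y \<omega> ^\<^sub>m k)"
    by (simp add: T_def Y_comm_pow)
  also have "\<dots> = (\<Sum>a<2 * n. \<Sum>b<2 * n. \<Sum>\<alpha>\<in>gse_index n.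
      of_real (\<xi> \<alpha> \<omega>) * (H \<alpha> $$ (a, b) * (Y \<omega> ^\<^sub>m k) $$ (b, a)))"
    unfolding mat_trace_mult[OF Y_carrier Y_pow_carrier]
    by (intro sum.cong refl) (simp add: Y_def[of \<omega>] H_def sum_distrib_right ac_simps)
  also have "\<dots> = (\<Sum>\<alpha>\<in>gse_index n. of_real (\<xi> \<alpha> \<omega>) * mat_trace (H \<alpha> * Y \<omega> ^\<^sub>m k))"
    unfolding mat_trace_mult[OF H_carrier Y_pow_carrier] sum_distrib_left
      sum.swap[of _ "{..<2 * n}" "gse_index n"] ..
  finally show ?thesis .
qed

lemma contract_1:
  "(\<Sum>\<alpha>\<in>gse_index n. of_real (gse_var \<alpha>) * mat_trace (H \<alpha> * (Y \<omega> ^\<^sub>m r * (H \<alpha> * Y \<omega> ^\<^sub>m l))))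
    = 1 / 2 * (T r \<omega> * T l \<omega> - T (r + l) \<omega>)"
proof -
  have "mat_trace (H \<alpha> * (Y \<omega> ^\<^sub>m r * (H \<alpha> * Y \<omega> ^\<^sub>m l))) =
    (\<Sum>a<2 * n. \<Sum>b<2 * n. \<Sum>c<2 * n. \<Sum>d<2 * n.
      gse_basis \<alpha> a b * (Y \<omega> ^\<^sub>m r) $$ (b, c) * gse_basis \<alpha> c d * (Y \<omega> ^\<^sub>m l) $$ (d, a))" for \<alpha>
  proof -
    have c: "H \<alpha> * Y \<omega> ^\<^sub>m l \<in> carrier_mat (2 * n) (2 * n)"
      "Y \<omega> ^\<^sub>m r * (H \<alpha> * Y \<omega> ^\<^sub>m l) \<in> carrier_mat (2 * n) (2 * n)"
      by (intro mult_carrier_mat[of _ _ "2 * n"]; simp)+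
    show ?thesis
      unfolding mat_trace_mult[OF H_carrier c(2)]
      by (intro sum.cong refl)
        (simp add: index_mult_mat_sum[OF Y_pow_carrier c(1)] index_mult_mat_sum[OF H_carrier Y_pow_carrier]
          sum_distrib_left mult.assoc del: index_mult_mat(1))
  qed
  then show ?thesis
    by (simp add: gse_contract_1[OF self_dual_Y_pow] T_def pow_mat_add[OF Y_carrier]
      mat_trace_mult[OF Y_pow_carrier Y_pow_carrier] mat_trace_sum[OF Y_pow_carrier])
qed

lemma contract_2:
  "(\<Sum>\<alpha>\<in>gse_index n. of_real (gse_var \<alpha>) * (mat_trace (H \<alpha> * Y \<omega> ^\<^sub>m k) * mat_trace (H \<alpha> * Y \<omega> ^\<^sub>m l)))
    = T (k + l) \<omega>"
proof -
  have "mat_trace (H \<alpha> * Y \<omega> ^\<^sub>m k) = (\<Sum>a<2 * n. \<Sum>b<2 * n. gse_basis \<alpha> a b * (Y \<omega> ^\<^sub>m k) $$ (b, a))" for \<alpha> k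
    unfolding mat_trace_mult[OF H_carrier Y_pow_carrier] by (intro sum.cong refl) (simp add: H_def)
  then show ?thesis
    by (simp only: gse_contract_2[OF self_dual_Y_pow] T_def pow_mat_add[OF Y_carrier]
      mat_trace_mult[OF Y_pow_carrier Y_pow_carrier])
qed

theorem loop_equations_prodT: "loop_equations (of_nat (2 * n)) (\<lambda>ks. expectation (prodT ks))"
  unfolding loop_equations_def
proof (intro conjI allI)
  fix ks
  have "T 0 \<omega> = of_nat (2 * n)" for \<omega>
    by (simp add: T_def mat_trace_def Y_def)
  then show "expectation (prodT (0 # ks)) = of_nat (2 * n) * expectation (prodT ks)"
    by (simp add: prodT_def[abs_def])
next
  fix k ks
  \<comment> \<open>The derivative in direction \<alpha> of \<open>tr (H \<alpha> * Y^k)\<close>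
    times the remaining traces: the first term yields the splits, the second the joins.\<close>
  define g where "g \<alpha> \<omega> = mat_trace (H \<alpha> * dpow k \<alpha> \<omega>) * prodT ks \<omega>
      + mat_trace (H \<alpha> * Y \<omega> ^\<^sub>m k) * dprodT ks \<alpha> \<omega>" for \<alpha> \<omega>
  have st: "integrable M (g \<alpha>)"
    "integrable M (\<lambda>\<omega>. of_real (\<xi> \<alpha> \<omega>) * (mat_trace (H \<alpha> * Y \<omega> ^\<^sub>m k) * prodT ks \<omega>))"
    "expectation (\<lambda>\<omega>. of_real (\<xi> \<alpha> \<omega>) * (mat_trace (H \<alpha> * Y \<omega> ^\<^sub>m k) * prodT ks \<omega>)) = of_real (gse_var \<alpha>) * expectation (g \<alpha>)"
    if "\<alpha> \<in> gse_index n" for \<alpha>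
    using stein[OF gder_mult[OF gder_trace_H[of \<alpha> k] gder_prodT[of ks]]] that by (auto simp: g_def[abs_def])
  have "expectation (prodT (Suc k # ks))
      = expectation (\<lambda>\<omega>. \<Sum>\<alpha>\<in>gse_index n. of_real (\<xi> \<alpha> \<omega>) * (mat_trace (H \<alpha> * Y \<omega> ^\<^sub>m k) * prodT ks \<omega>))"
    by (simp add: prodT_def[of "_ # _", abs_def] T_Suc sum_distrib_right mult.assoc prodT_def[symmetric])
  also have "\<dots> = (\<Sum>\<alpha>\<in>gse_index n. of_real (gse_var \<alpha>) * expectation (g \<alpha>))"
    by (subst Bochner_Integration.integral_sum) (auto simp: st)
  also have "\<dots> = expectation (\<lambda>\<omega>. \<Sum>\<alpha>\<in>gse_index n. of_real (gse_var \<alpha>) * g \<alpha> \<omega>)"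
    by (subst Bochner_Integration.integral_sum) (auto simp: st)
  also have "(\<lambda>\<omega>. \<Sum>\<alpha>\<in>gse_index n. of_real (gse_var \<alpha>) * g \<alpha> \<omega>) = (\<lambda>\<omega>. loop_rhs (\<lambda>ks. prodT ks \<omega>) k ks)"
  proof
    fix \<omega>
    have "(\<Sum>\<alpha>\<in>gse_index n. of_real (gse_var \<alpha>) * mat_trace (H \<alpha> * dpow k \<alpha> \<omega>)) =
      (\<Sum>r<k. \<Sum>\<alpha>\<in>gse_index n. of_real (gse_var \<alpha>) *
          mat_trace (H \<alpha> * (Y \<omega> ^\<^sub>m r * (H \<alpha> * Y \<omega> ^\<^sub>m (k - 1 - r)))))"
      by (subst sum.swap) (simp add: mat_trace_mult_dpow sum_distrib_left)
    also have "\<dots> = (\<Sum>r<k. 1 / 2 * (T r \<omega> * T (k - 1 - r) \<omega> - T (k - 1) \<omega>))"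
      unfolding contract_1 by (intro sum.cong refl) simp
    also have "\<dots> = 1 / 2 * ((\<Sum>r<k. T r \<omega> * T (k - 1 - r) \<omega>) - of_nat k * T (k - 1) \<omega>)"
      unfolding sum_distrib_left[symmetric] by (simp add: sum_subtractf)
    finally have 1: "(\<Sum>\<alpha>\<in>gse_index n. of_real (gse_var \<alpha>) * mat_trace (H \<alpha> * dpow k \<alpha> \<omega>)) =
      1 / 2 * ((\<Sum>r<k. T r \<omega> * T (k - 1 - r) \<omega>) - of_nat k * T (k - 1) \<omega>)" .
    have "(\<Sum>\<alpha>\<in>gse_index n. of_real (gse_var \<alpha>) * (mat_trace (H \<alpha> * Y \<omega> ^\<^sub>m k) * dprodT ks \<alpha> \<omega>)) =
      (\<Sum>j<length ks. of_nat (ks ! j) * (\<Sum>\<alpha>\<in>gse_index n. of_real (gse_var \<alpha>) *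
         (mat_trace (H \<alpha> * Y \<omega> ^\<^sub>m k) * mat_trace (H \<alpha> * Y \<omega> ^\<^sub>m (ks ! j - 1))))
         * prodT (take j ks @ drop (Suc j) ks) \<omega>)"
      unfolding dprodT_def dT_def sum_distrib_left sum_distrib_right
      by (subst sum.swap) (simp add: ac_simps)
    also have "\<dots> = (\<Sum>j<length ks. of_nat (ks ! j) * prodT ((k + ks ! j - 1) # take j ks @ drop (Suc j) ks) \<omega>)"
    proof (intro sum.cong refl)
      fix j
      show "of_nat (ks ! j) * (\<Sum>\<alpha>\<in>gse_index n. of_real (gse_var \<alpha>) *
         (mat_trace (H \<alpha> * Y \<omega> ^\<^sub>m k) * mat_trace (H \<alpha> * Y \<omega> ^\<^sub>m (ks ! j - 1))))
         * prodT (take j ks @ drop (Suc j) ks) \<omega>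
        = of_nat (ks ! j) * prodT ((k + ks ! j - 1) # take j ks @ drop (Suc j) ks) \<omega>"
        unfolding contract_2 by (cases "ks ! j") (simp_all add: prodT_def)
    qed
    finally have 2: "(\<Sum>\<alpha>\<in>gse_index n. of_real (gse_var \<alpha>) * (mat_trace (H \<alpha> * Y \<omega> ^\<^sub>m k) * dprodT ks \<alpha> \<omega>))
      = (\<Sum>j<length ks. of_nat (ks ! j) * prodT ((k + ks ! j - 1) # take j ks @ drop (Suc j) ks) \<omega>)" .
    have "(\<Sum>\<alpha>\<in>gse_index n. of_real (gse_var \<alpha>) * g \<alpha> \<omega>) =
      (\<Sum>\<alpha>\<in>gse_index n. of_real (gse_var \<alpha>) * mat_trace (H \<alpha> * dpow k \<alpha> \<omega>)) * prodT ks \<omega>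
      + (\<Sum>\<alpha>\<in>gse_index n. of_real (gse_var \<alpha>) * (mat_trace (H \<alpha> * Y \<omega> ^\<^sub>m k) * dprodT ks \<alpha> \<omega>))"
      by (simp add: g_def distrib_left sum.distrib sum_distrib_right mult.assoc)
    then show "(\<Sum>\<alpha>\<in>gse_index n. of_real (gse_var \<alpha>) * g \<alpha> \<omega>) = loop_rhs (\<lambda>ks. prodT ks \<omega>) k ks"
      unfolding 1 2 loop_rhs_def
      by (simp add: prodT_def sum_distrib_right sum_distrib_left left_diff_distrib right_diff_distrib mult.assoc)
  qed
  finally show "expectation (prodT (Suc k # ks)) = loop_rhs (\<lambda>ks. expectation (prodT ks)) k ks"
    unfolding integral_loop_rhs[of M prodT, OF gder_integrable[OF gder_prodT]] .
qed

end

section \<open>Hermite polynomials and Gaussian integrals\<close>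

fun hermite_poly :: "nat \<Rightarrow> real poly" where
  "hermite_poly 0 = 1"
| "hermite_poly (Suc k) = [:0, 2:] * hermite_poly k - pderiv (hermite_poly k)"

lemma higher_deriv_gaussian:
  "(deriv ^^ k) (\<lambda>t. exp (- (t\<^sup>2))) = (\<lambda>x. (- 1) ^ k * poly (hermite_poly k) x * exp (- (x\<^sup>2)))"
proof (induction k)
  case (Suc k)
  have "((\<lambda>x. (- 1) ^ k * poly (hermite_poly k) x * exp (- (x\<^sup>2))) has_field_derivative
      (- 1) ^ Suc k * poly (hermite_poly (Suc k)) x * exp (- (x\<^sup>2))) (at x)" for x
    by (auto intro!: derivative_eq_intros poly_DERIV simp: algebra_simps)
  then show ?case
    by (simp only: funpow.simps o_def Suc) (auto intro!: DERIV_imp_deriv)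
qed simp

lemma hermite_eq_poly: "hermite k x = poly (hermite_poly k) x"
proof -
  have "hermite k x = ((- 1) ^ k * (- 1) ^ k) * (exp (x\<^sup>2) * exp (- (x\<^sup>2))) * poly (hermite_poly k) x"
    unfolding hermite_def higher_deriv_gaussian by (simp only: ac_simps)
  also have "(- 1) ^ k * (- 1) ^ k = (1 :: real)"
    by (simp flip: power_mult_distrib)
  also have "exp (x\<^sup>2) * exp (- (x\<^sup>2)) = 1"
    by (simp flip: exp_add)
  finally show ?thesis by simp
qed

text \<open>Differentiating the recursion and inserting the induction hypothesis reproduces the
  recursion one index lower.\<close>

lemma pderiv_hermite_poly: "pderiv (hermite_poly (Suc k)) = Polynomial.smult (2 * real (Suc k)) (hermite_poly k)"
proof (induction k)
  case (Suc k)
  have "pderiv (hermite_poly (Suc (Suc k))) = Polynomial.smult 2 (hermite_poly (Suc k))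
      + Polynomial.smult (2 * real (Suc k)) ([:0, 2:] * hermite_poly k - pderiv (hermite_poly k))"
    unfolding hermite_poly.simps(2)[of "Suc k"] pderiv_diff pderiv_mult Suc pderiv_smult
    by (simp add: pderiv_pCons algebra_simps smult_diff_right del: hermite_poly.simps)
  also have "\<dots> = Polynomial.smult (2 + 2 * real (Suc k)) (hermite_poly (Suc k))"
    unfolding hermite_poly.simps(2)[of k, symmetric] by (rule smult_add_left[symmetric])
  also have "2 + 2 * real (Suc k) = 2 * real (Suc (Suc k))" by simp
  finally show ?case .
qed (simp add: pderiv_pCons)

lemma hermite_poly_rec:
  "hermite_poly (Suc k) = [:0, 2:] * hermite_poly k - Polynomial.smult (2 * real k) (hermite_poly (k - 1))"
proof (cases k)
  case (Suc m)
  then show ?thesis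
    by (simp only: hermite_poly.simps(2)[of "Suc m"] pderiv_hermite_poly diff_Suc_1)
qed simp

declare hermite_poly.simps(2) [simp del]

lemma degree_coeff_hermite_poly: "degree (hermite_poly k) \<le> k \<and> coeff (hermite_poly k) k = 2 ^ k"
proof (induction k)
  case (Suc k)
  have "degree (pderiv (hermite_poly k)) \<le> k"
    using Suc unfolding degree_pderiv by linarith
  then have c: "coeff (pderiv (hermite_poly k)) (Suc k) = 0" and d: "degree (pderiv (hermite_poly k)) \<le> Suc k"
    by (auto intro: coeff_eq_0)
  have "degree ([:0, 2:] * hermite_poly k) \<le> Suc k"
    using degree_mult_le[of "[:0, 2:]" "hermite_poly k"] Suc by simp
  then show ?case
    using c d Suc by (simp add: hermite_poly.simps(2) degree_diff_le)
qed simp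

section \<open>Integrals of polynomials against the Gaussian weight\<close>

abbreviation gweight :: "real \<Rightarrow> real" where "gweight x \<equiv> exp (- (x\<^sup>2))"

text \<open>Completing the square leaves a normal density of mean \<open>a / 2\<close>, and the
  power is expanded about that mean.\<close>

lemma integrable_power_gaussian: "integrable lborel (\<lambda>x :: real. x ^ k * exp (a * x - x\<^sup>2))"
proof -
  have s: "0 < 1 / sqrt (2 :: real)" by simp
  have *: "integrable lborel (\<lambda>x. normal_density (a / 2) (1 / sqrt 2) x * (x - a / 2) ^ j)" for j
    by (rule integrable_normal_moment[OF s])
  have "x ^ k * exp (a * x - x\<^sup>2) = (\<Sum>j\<le>k. (real (k choose j) * (a / 2) ^ (k - j) * (sqrt pi * exp (a\<^sup>2 / 4)))
      * (normal_density (a / 2) (1 / sqrt 2) x * (x - a / 2) ^ j))" for x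
  proof -
    have "exp (a * x - x\<^sup>2) = sqrt pi * exp (a\<^sup>2 / 4) * normal_density (a / 2) (1 / sqrt 2) x"
    proof -
      have "a * x - x\<^sup>2 = a\<^sup>2 / 4 + - ((x - a / 2)\<^sup>2)"
        by (simp add: power2_eq_square algebra_simps)
      then have "exp (a * x - x\<^sup>2) = exp (a\<^sup>2 / 4) * exp (- ((x - a / 2)\<^sup>2))"
        by (simp only: exp_add)
      then show ?thesis
        by (simp add: normal_density_def power_divide)
    qed
    moreover have "x ^ k = (\<Sum>j\<le>k. real (k choose j) * (x - a / 2) ^ j * (a / 2) ^ (k - j))"
      using binomial_ring[of "x - a / 2" "a / 2" k] by simp
    ultimately show ?thesis by (simp add: sum_distrib_right sum_distrib_left ac_simps)
  qed
  then show ?thesis by (simp only:) (intro Bochner_Integration.integrable_sum integrable_mult_right *)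
qed

lemma integrable_poly_gaussian: "integrable lborel (\<lambda>x :: real. poly P x * exp (a * x - x\<^sup>2))"
proof -
  have "poly P x * exp (a * x - x\<^sup>2) = (\<Sum>i\<le>degree P. coeff P i * (x ^ i * exp (a * x - x\<^sup>2)))" for x
    by (simp add: poly_altdef sum_distrib_right mult.assoc)
  then show ?thesis
    by (simp only:) (intro Bochner_Integration.integrable_sum integrable_mult_right integrable_power_gaussian)
qed

lemma gweight_exp: "exp (a * x - x\<^sup>2) = exp (x * a) * gweight x"
  by (simp add: mult.commute flip: exp_add)

lemma integrable_poly_gaussian_complex:
  "integrable lborel (\<lambda>x. exp (t * complex_of_real x) * of_real (poly P x * gweight x))"
proof (rule Bochner_Integration.integrable_bound)
  show "integrable lborel (\<lambda>x. poly P x * exp (Re t * x - x\<^sup>2))"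
    by (rule integrable_poly_gaussian)
  have "norm (exp (t * complex_of_real x) * of_real (poly P x * gweight x))
      = norm (poly P x * exp (Re t * x - x\<^sup>2))" for x
    using gweight_exp[of "Re t" x] by (simp add: norm_mult abs_mult)
  then show "AE x in lborel. norm (exp (t * complex_of_real x) * of_real (poly P x * gweight x))
      \<le> norm (poly P x * exp (Re t * x - x\<^sup>2))"
    by simp
  have "(\<lambda>x. exp (t * complex_of_real x) * of_real (poly P x * gweight x)) \<in> borel_measurable borel"
    by (intro borel_measurable_continuous_onI continuous_intros)
  then show "(\<lambda>x. exp (t * complex_of_real x) * of_real (poly P x * gweight x)) \<in> borel_measurable lborel"
    by simp
qed

text \<open>A functional on polynomials rather than on functions: integrability is then automatic,
  and linearity holds without side conditions.\<close>

definition gauss_int :: "complex \<Rightarrow> real poly \<Rightarrow> complex" where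
  "gauss_int t P = (\<integral>x. exp (t * complex_of_real x) * of_real (poly P x * gweight x) \<partial>lborel)"

lemma gauss_int_add: "gauss_int t (P + Q) = gauss_int t P + gauss_int t Q"
proof -
  have "exp (t * complex_of_real x) * of_real (poly (P + Q) x * gweight x) =
      exp (t * complex_of_real x) * of_real (poly P x * gweight x)
      + exp (t * complex_of_real x) * of_real (poly Q x * gweight x)" for x
    by (simp add: algebra_simps)
  then show ?thesis
    unfolding gauss_int_def
    by (simp only: Bochner_Integration.integral_add[OF integrable_poly_gaussian_complex integrable_poly_gaussian_complex])
qed

lemma gauss_int_smult: "gauss_int t (Polynomial.smult c P) = of_real c * gauss_int t P"
proof -
  have "exp (t * complex_of_real x) * of_real (poly (Polynomial.smult c P) x * gweight x) =
      of_real c * (exp (t * complex_of_real x) * of_real (poly P x * gweight x))" for x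
    by simp
  then show ?thesis
    unfolding gauss_int_def by (simp only: integral_mult_right_zero)
qed

lemma gauss_int_uminus: "gauss_int t (- P) = - gauss_int t P"
  using gauss_int_smult[of t "-1" P] by simp

lemma gauss_int_diff: "gauss_int t (P - Q) = gauss_int t P - gauss_int t Q"
  using gauss_int_add[of t P "- Q"] by (simp add: gauss_int_uminus)

lemma gauss_int_0 [simp]: "gauss_int t 0 = 0"
  using gauss_int_smult[of t 0 0] by simp

lemma gauss_int_sum: "gauss_int t (\<Sum>i\<in>A. P i) = (\<Sum>i\<in>A. gauss_int t (P i))"
  by (induction A rule: infinite_finite_induct) (simp_all add: gauss_int_add)

lemma gauss_int_at_0: "gauss_int 0 P = of_real (\<integral>x. poly P x * gweight x \<partial>lborel)"
  unfolding gauss_int_def by (simp del: of_real_mult)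

lemma power_exp_gaussian_tendsto:
  fixes a :: real
  shows "((\<lambda>x. x ^ k * exp (a * x - x\<^sup>2)) \<longlongrightarrow> 0) at_top"
  by real_asymp

lemma poly_gaussian_at_top:
  fixes a :: real
  shows "((\<lambda>x. poly P x * exp (a * x - x\<^sup>2)) \<longlongrightarrow> 0) at_top"
proof -
  have "((\<lambda>x. \<Sum>i\<le>degree P. coeff P i * (x ^ i * exp (a * x - x\<^sup>2))) \<longlongrightarrow> (\<Sum>i\<le>degree P. coeff P i * 0)) at_top"
    by (intro tendsto_intros power_exp_gaussian_tendsto)
  then show ?thesis by (simp add: poly_altdef sum_distrib_right mult.assoc)
qed

lemma poly_gaussian_at_bot:
  fixes a :: real
  shows "((\<lambda>x. poly P x * exp (a * x - x\<^sup>2)) \<longlongrightarrow> 0) at_bot"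
  using poly_gaussian_at_top[of "pcompose P [:0, -1:]" "- a"]
  unfolding filterlim_at_bot_mirror by (simp add: poly_pcompose)

text \<open>The polynomial on the left plus \<open>t * P\<close>, times the exponential and the
  weight, is the derivative of a function that vanishes at both ends.\<close>

lemma gauss_int_by_parts: "gauss_int t (pderiv P - [:0, 2:] * P) = - t * gauss_int t P"
proof -
  define F where "F x = exp (t * complex_of_real x) * of_real (poly P x * gweight x)" for x
  define f where "f x = exp (t * complex_of_real x) * of_real (poly (pderiv P - [:0, 2:] * P) x * gweight x)
     + t * F x" for x
  have nF: "norm (F x) = \<bar>poly P x * exp (Re t * x - x\<^sup>2)\<bar>" for x
    using gweight_exp[of "Re t" x] by (simp add: F_def norm_mult abs_mult)
  have int: "integrable lborel f"
    unfolding f_def F_def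
    by (intro Bochner_Integration.integrable_add integrable_mult_right integrable_poly_gaussian_complex)
  have D: "(F has_vector_derivative f x) (at x)" for x
  proof -
    have 1: "((\<lambda>x. exp (t * complex_of_real x)) has_vector_derivative (t * exp (t * complex_of_real x))) (at x)"
      by (rule has_vector_derivative_real_field) (auto intro!: derivative_eq_intros)
    have "((\<lambda>x. poly P x * gweight x) has_field_derivative (poly (pderiv P - [:0, 2:] * P) x * gweight x)) (at x)"
      by (auto intro!: derivative_eq_intros poly_DERIV simp: algebra_simps)
    then have 2: "((\<lambda>x. complex_of_real (poly P x * gweight x)) has_vector_derivative
        of_real (poly (pderiv P - [:0, 2:] * P) x * gweight x)) (at x)"
      by (intro has_vector_derivative_of_real) (simp add: has_real_derivative_iff_has_vector_derivative)
    show ?thesis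
      using has_vector_derivative_mult[OF 1 2] by (simp add: F_def[abs_def] f_def algebra_simps)
  qed
  have "(LBINT x=-\<infinity>..\<infinity>. f x) = 0 - 0"
  proof (rule interval_integral_FTC_integrable[where F = F])
    show "(F has_vector_derivative f x) (at x)" for x by (rule D)
    show "isCont f x" for x unfolding f_def F_def by (intro continuous_intros)
    show "set_integrable lborel (einterval (- \<infinity>) \<infinity>) f"
      using int by (simp only: set_integrable_def einterval_eq_UNIV indicator_UNIV scaleR_one)
    show "((F \<circ> real_of_ereal) \<longlongrightarrow> 0) (at_right (- \<infinity>))"
      unfolding ereal_tendsto_simps1(4) using poly_gaussian_at_bot[of P "Re t"]
      by (intro tendsto_norm_zero_cancel[of F]) (simp only: nF tendsto_rabs_zero)
    show "((F \<circ> real_of_ereal) \<longlongrightarrow> 0) (at_left \<infinity>)"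
      unfolding ereal_tendsto_simps1(3) using poly_gaussian_at_top[of P "Re t"]
      by (intro tendsto_norm_zero_cancel[of F]) (simp only: nF tendsto_rabs_zero)
  qed simp
  then have "integral\<^sup>L lborel f = 0"
    by (simp add: interval_lebesgue_integral_def set_lebesgue_integral_def)
  moreover have "integral\<^sup>L lborel f = gauss_int t (pderiv P - [:0, 2:] * P) + t * gauss_int t P"
    unfolding f_def F_def gauss_int_def
    by (simp only: Bochner_Integration.integral_add integrable_poly_gaussian_complex
        integrable_mult_right integral_mult_right_zero)
  ultimately show ?thesis by (simp add: add_eq_0_iff)
qed

text \<open>By the recursion of \<open>hermite_poly\<close> and integration by parts, one Hermite
  index is traded for a derivative of the other factor or for a factor t.\<close>

lemma gauss_int_hermite_rec:
  "gauss_int t (hermite_poly (Suc j) * Q) = gauss_int t (hermite_poly j * pderiv Q) + t * gauss_int t (hermite_poly j * Q)"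
proof -
  have "hermite_poly (Suc j) * Q = hermite_poly j * pderiv Q - (pderiv (hermite_poly j * Q) - [:0, 2:] * (hermite_poly j * Q))"
    by (simp add: hermite_poly.simps(2) pderiv_mult algebra_simps)
  then have "gauss_int t (hermite_poly (Suc j) * Q) = gauss_int t (hermite_poly j * pderiv Q)
      - gauss_int t (pderiv (hermite_poly j * Q) - [:0, 2:] * (hermite_poly j * Q))"
    by (simp only: gauss_int_diff)
  then show ?thesis
    unfolding gauss_int_by_parts by simp
qed

lemma gauss_int_1: "gauss_int t 1 = of_real (sqrt pi) * exp (t\<^sup>2 / 4)"
proof -
  define a b where "a = Re t" and "b = Im t"
  have t: "t = Complex a b" by (simp add: a_def b_def)
  \<comment> \<open>The substitution centres the weight at \<open>a / 2\<close> and rescales it to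
    the standard normal density. This absorbs the real part of t; the imaginary part is left to the
    characteristic function.\<close>
  define u where "u x = a / 2 + 1 / sqrt 2 * x" for x
  define e where "e = of_real (a\<^sup>2 / 4) + \<i> * of_real (a * b / 2)"
  have "gauss_int t 1 = \<bar>1 / sqrt 2\<bar> *\<^sub>R (\<integral>x. exp (t * complex_of_real (u x)) * of_real (poly 1 (u x) * gweight (u x)) \<partial>lborel)"
    unfolding gauss_int_def u_def by (rule lborel_integral_real_affine) simp
  also have "\<dots> = of_real (1 / sqrt 2) * (\<integral>x. exp (t * complex_of_real (u x)) * of_real (gweight (u x)) \<partial>lborel)"
    by (simp only: poly_1 mult_1 scaleR_conv_of_real abs_of_nonneg zero_le_divide_1_iff real_sqrt_ge_zero zero_le_numeral)
  also have "(\<lambda>x. exp (t * complex_of_real (u x)) * of_real (gweight (u x)))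
    = (\<lambda>x. of_real (sqrt (2 * pi)) * exp e * (of_real (std_normal_density x) * iexp (b / sqrt 2 * x)))"
  proof
    fix x
    have "t * complex_of_real (u x) + of_real (- ((u x)\<^sup>2)) = e + (of_real (- (x\<^sup>2) / 2) + \<i> * of_real (b / sqrt 2 * x))"
      unfolding u_def e_def by (simp add: t complex_eq_iff power2_eq_square field_simps)
    then have "exp (t * complex_of_real (u x)) * exp (of_real (- ((u x)\<^sup>2)))
      = exp e * (exp (of_real (- (x\<^sup>2) / 2)) * iexp (b / sqrt 2 * x))"
      by (simp only: exp_add[symmetric])
    then show "exp (t * complex_of_real (u x)) * of_real (gweight (u x)) =
      of_real (sqrt (2 * pi)) * exp e * (of_real (std_normal_density x) * iexp (b / sqrt 2 * x))"
      unfolding exp_of_real[symmetric] normal_density_def by (simp only: exp_of_real) (simp add: exp_of_real)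
  qed
  also have "(\<integral>x. of_real (sqrt (2 * pi)) * exp e * (of_real (std_normal_density x) * iexp (b / sqrt 2 * x)) \<partial>lborel)
      = of_real (sqrt (2 * pi)) * exp e * char std_normal_distribution (b / sqrt 2)"
    unfolding char_def by (subst integral_density) (auto simp: scaleR_conv_of_real)
  also have "char std_normal_distribution (b / sqrt 2) = exp (of_real (- (b\<^sup>2) / 4))"
    unfolding char_std_normal_distribution by (simp add: power_divide flip: exp_of_real)
  also have "of_real (1 / sqrt 2) * (of_real (sqrt (2 * pi)) * exp e * exp (of_real (- (b\<^sup>2) / 4)))
    = of_real (sqrt pi) * exp (e + of_real (- (b\<^sup>2) / 4))"
    unfolding exp_add by (simp add: real_sqrt_mult)
  also have "e + of_real (- (b\<^sup>2) / 4) = t\<^sup>2 / 4"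
    by (simp add: e_def t complex_eq_iff power2_eq_square)
  finally show ?thesis .
qed

text \<open>The summation index l counts the contractions between the two Hermite factors, each
  worth 2; every uncontracted index gives a factor t.\<close>

lemma gauss_int_hermite_hermite:
  "gauss_int t (hermite_poly j * hermite_poly k) = of_real (sqrt pi) * exp (t\<^sup>2 / 4) *
     (\<Sum>l\<le>j. of_nat (j choose l) * of_nat (k choose l) * 2 ^ l * fact l * t ^ (j - l) * t ^ (k - l))"
proof (induction j arbitrary: k)
  case 0
  show ?case
  proof (induction k)
    case 0
    show ?case by (simp add: gauss_int_1)
  next
    case (Suc k)
    have "gauss_int t (hermite_poly (Suc k) * 1) = t * gauss_int t (hermite_poly k * 1)"
      by (subst gauss_int_hermite_rec) simp
    then show ?case using Suc by (simp add: ac_simps)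
  qed
next
  case (Suc j)
  define f where "f j k l = of_nat (k choose l) * 2 ^ l * fact l * t ^ (j - l) * t ^ (k - l)" for j k l
  define S where "S j k = (\<Sum>l\<le>j. of_nat (j choose l) * f j k l)" for j k
  have rec: "gauss_int t (hermite_poly (Suc j) * hermite_poly k)
      = of_real (2 * real k) * gauss_int t (hermite_poly j * hermite_poly (k - 1)) + t * gauss_int t (hermite_poly j * hermite_poly k)"
  proof (cases k)
    case 0
    then show ?thesis by (subst gauss_int_hermite_rec) simp
  next
    case (Suc m)
    then show ?thesis
      by (subst gauss_int_hermite_rec) (simp add: pderiv_hermite_poly gauss_int_smult del: of_nat_Suc)
  qed
  have "S (Suc j) k = 2 * of_nat k * S j (k - 1) + t * S j k"
  proof -
    have bin: "(Suc l) * (k choose Suc l) = k * ((k - 1) choose l)" for l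
      by (cases k) (simp_all only: binomial_eq_0_iff Suc_times_binomial_eq diff_Suc_1 mult.commute, simp_all)
    have f_Suc: "f (Suc j) k (Suc l) = 2 * of_nat k * f j (k - 1) l" for l
    proof -
      have "of_nat (k choose Suc l) * fact (Suc l) = of_nat ((Suc l) * (k choose Suc l)) * (fact l :: complex)"
        by (simp add: algebra_simps)
      then have *: "x * (of_nat (k choose Suc l) * fact (Suc l)) = x * (of_nat k * of_nat ((k - 1) choose l) * fact l)"
        for x :: complex unfolding bin by simp
      have "f (Suc j) k (Suc l) = 2 * 2 ^ l * t ^ (j - l) * t ^ (k - 1 - l) * (of_nat (k choose Suc l) * fact (Suc l))"
        unfolding f_def diff_Suc_Suc by (simp only: power_Suc diff_Suc_eq_diff_pred) (simp only: ac_simps)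
      also note *
      finally show ?thesis by (simp only: f_def ac_simps)
    qed
    have "S (Suc j) k = f (Suc j) k 0 + (\<Sum>l\<le>j. of_nat (Suc j choose Suc l) * f (Suc j) k (Suc l))"
      unfolding S_def sum.atMost_Suc_shift by simp
    \<comment> \<open>Pascal's rule: the part with \<open>j choose Suc l\<close> reassembles to
      \<open>t * S j k\<close>, the part with \<open>j choose l\<close> to
      \<open>2 * k * S j (k - 1)\<close>, matching \<open>rec\<close>.\<close>
    also have "\<dots> = (f (Suc j) k 0 + (\<Sum>l\<le>j. of_nat (j choose Suc l) * f (Suc j) k (Suc l)))
       + (\<Sum>l\<le>j. of_nat (j choose l) * f (Suc j) k (Suc l))"
      unfolding add.assoc sum.distrib[symmetric]
      by (intro arg_cong2[where f = "(+)"] refl sum.cong) (simp add: ring_distribs)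
    also have "f (Suc j) k 0 + (\<Sum>l\<le>j. of_nat (j choose Suc l) * f (Suc j) k (Suc l))
        = (\<Sum>l\<le>Suc j. of_nat (j choose l) * f (Suc j) k l)"
      unfolding sum.atMost_Suc_shift by simp
    also have "\<dots> = t * S j k"
      unfolding S_def sum.atMost_Suc by (simp add: f_def sum_distrib_left Suc_diff_le ac_simps)
    also have "(\<Sum>l\<le>j. of_nat (j choose l) * f (Suc j) k (Suc l)) = 2 * of_nat k * S j (k - 1)"
      unfolding S_def sum_distrib_left f_Suc by (simp only: ac_simps)
    finally show ?thesis by simp
  qed
  moreover have G: "gauss_int t (hermite_poly j * hermite_poly k) = of_real (sqrt pi) * exp (t\<^sup>2 / 4) * S j k" for k
    unfolding Suc S_def f_def by (simp only: mult.assoc)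
  ultimately have "gauss_int t (hermite_poly (Suc j) * hermite_poly k) = of_real (sqrt pi) * exp (t\<^sup>2 / 4) * S (Suc j) k"
    unfolding rec G by (simp add: algebra_simps)
  then show ?case
    unfolding S_def f_def by (simp only: mult.assoc)
qed

lemma gauss_int_0_hermite:
  "gauss_int 0 (hermite_poly j * hermite_poly k) = (if j = k then of_real (sqrt pi * 2 ^ k * fact k) else 0)"
proof -
  have "(\<Sum>l\<le>j. of_nat (j choose l) * of_nat (k choose l) * 2 ^ l * fact l * 0 ^ (j - l) * 0 ^ (k - l) :: complex)
     = (\<Sum>l\<in>{j}. of_nat (j choose l) * of_nat (k choose l) * 2 ^ l * fact l * 0 ^ (j - l) * 0 ^ (k - l))"
    by (intro sum.mono_neutral_right) auto
  \<comment> \<open>The surviving term l = j carries a power of 0 that excludes k > j, and a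
    binomial coefficient that excludes k < j.\<close>
  also have "\<dots> = (if j = k then 2 ^ k * fact k else 0)"
    by (auto simp: not_less binomial_eq_0 zero_power intro: ccontr)
  finally show ?thesis
    unfolding gauss_int_hermite_hermite by simp
qed

section \<open>Skew-orthogonal polynomials and the mean density\<close>

text \<open>The squared norm of \<open>hermite_poly k\<close> in the Gaussian weight.\<close>

definition hnorm :: "nat \<Rightarrow> real" where "hnorm k = sqrt pi * 2 ^ k * fact k"

lemma hnorm_pos [simp]: "hnorm k > 0" by (simp add: hnorm_def)

lemma hnorm_nonzero [simp]: "hnorm k \<noteq> 0" using hnorm_pos[of k] by linarith

lemma hnorm_Suc: "hnorm (Suc k) = 2 * real (Suc k) * hnorm k"
  by (simp add: hnorm_def)

text \<open>\<open>exp (x\<^sup>2 / 2)\<close> times the derivative of \<open>P x * exp (- x\<^sup>2 / 2)\<close>.\<close>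

definition weighted_deriv :: "real poly \<Rightarrow> real poly" where
  "weighted_deriv P = pderiv P - [:0, 1:] * P"

text \<open>\<open>skew_even j * exp (- x\<^sup>2 / 2)\<close> is the decaying antiderivative of
  \<open>- 1/2 * hermite_poly (2 j + 1) * exp (- x\<^sup>2 / 2)\<close>.\<close>

fun skew_even :: "nat \<Rightarrow> real poly" where
  "skew_even 0 = 1"
| "skew_even (Suc j) = hermite_poly (2 * j + 2) + Polynomial.smult (4 * real (Suc j)) (skew_even j)"

lemma weighted_deriv_add: "weighted_deriv (P + Q) = weighted_deriv P + weighted_deriv Q"
  by (simp add: weighted_deriv_def pderiv_add algebra_simps)

lemma weighted_deriv_smult: "weighted_deriv (Polynomial.smult c P) = Polynomial.smult c (weighted_deriv P)"
  by (simp add: weighted_deriv_def pderiv_smult smult_diff_right)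

lemma poly_eqI_poly: "(\<And>x. poly p x = poly q x) \<Longrightarrow> p = q" for p q :: "real poly"
  by (simp add: poly_eq_poly_eq_iff[symmetric] fun_eq_iff)

lemma poly_weighted_deriv: "poly (weighted_deriv P) x = poly (pderiv P) x - x * poly P x"
  by (simp add: weighted_deriv_def)

lemma poly_hermite_Suc: "poly (hermite_poly (Suc k)) x = 2 * x * poly (hermite_poly k) x - 2 * real k * poly (hermite_poly (k - 1)) x"
  by (simp add: hermite_poly_rec)

lemma poly_pderiv_hermite: "poly (pderiv (hermite_poly k)) x = 2 * real k * poly (hermite_poly (k - 1)) x"
proof (cases k)
  case (Suc m)
  then show ?thesis using pderiv_hermite_poly[of m] by (simp only: poly_smult diff_Suc_1)
qed simp

lemma poly_weighted_deriv_hermite: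
  "poly (weighted_deriv (hermite_poly k)) x = real k * poly (hermite_poly (k - 1)) x - 1 / 2 * poly (hermite_poly (Suc k)) x"
  unfolding poly_weighted_deriv poly_pderiv_hermite poly_hermite_Suc by (simp add: field_simps)

text \<open>The recursion of \<open>skew_even\<close> is made for this: the lowering term of the new
  Hermite polynomial, of index 2 j + 1, cancels against the contribution of
  \<open>skew_even j\<close>, and only the raised index remains.\<close>

lemma poly_weighted_deriv_skew_even: "poly (weighted_deriv (skew_even j)) x = - 1 / 2 * poly (hermite_poly (2 * j + 1)) x"
proof (induction j)
  case 0
  show ?case by (simp add: poly_weighted_deriv hermite_poly.simps(2))
next
  case (Suc j)
  have "poly (weighted_deriv (skew_even (Suc j))) x =
      real (2 * j + 2) * poly (hermite_poly (2 * j + 2 - 1)) x - 1 / 2 * poly (hermite_poly (Suc (2 * j + 2))) x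
      + 4 * real (Suc j) * (- 1 / 2 * poly (hermite_poly (2 * j + 1)) x)"
    by (simp only: skew_even.simps weighted_deriv_add weighted_deriv_smult poly_add poly_smult Suc poly_weighted_deriv_hermite)
  moreover have "2 * j + 2 - 1 = 2 * j + 1" "Suc (2 * j + 2) = 2 * Suc j + 1" by simp_all
  ultimately show ?case
    by (simp only:) (simp add: algebra_simps del: skew_even.simps)
qed

lemma weighted_deriv_hermite:
  "weighted_deriv (hermite_poly k) = Polynomial.smult (real k) (hermite_poly (k - 1)) - Polynomial.smult (1 / 2) (hermite_poly (Suc k))"
  by (rule poly_eqI_poly) (simp add: poly_weighted_deriv_hermite)

lemma weighted_deriv_skew_even: "weighted_deriv (skew_even j) = Polynomial.smult (- 1 / 2) (hermite_poly (2 * j + 1))"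
  by (rule poly_eqI_poly) (simp add: poly_weighted_deriv_skew_even)

text \<open>By antisymmetry this is half the integral of P R' - P' R against the weight, the skew
  form that belongs to the exponent 4. It is what two consecutive rows of the confluent determinant
  produce when their variable is integrated out.\<close>

definition skew_pairing :: "real poly \<Rightarrow> real poly \<Rightarrow> complex" where
  "skew_pairing P R = gauss_int 0 (P * weighted_deriv R)"

text \<open>The symmetric part is the integral of the derivative of P R exp (- x^2).\<close>

lemma skew_pairing_antisym: "skew_pairing P R = - skew_pairing R P"
proof -
  have "P * weighted_deriv R + R * weighted_deriv P = pderiv (P * R) - [:0, 2:] * (P * R)"
  proof (rule poly_eqI_poly)
    show "poly (P * weighted_deriv R + R * weighted_deriv P) x = poly (pderiv (P * R) - [:0, 2:] * (P * R)) x" for x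
      by (simp add: poly_weighted_deriv pderiv_mult algebra_simps)
  qed
  then have "skew_pairing P R + skew_pairing R P = 0"
    unfolding skew_pairing_def gauss_int_add[symmetric] by (simp only: gauss_int_by_parts) simp
  then show ?thesis by (simp add: add_eq_0_iff)
qed

lemma skew_even_hermite_odd: "gauss_int 0 (skew_even j * hermite_poly (2 * m + 1)) = 0"
proof (induction j)
  case 0
  show ?case using gauss_int_0_hermite[of 0 "2 * m + 1"] by simp
next
  case (Suc j)
  have "skew_even (Suc j) * hermite_poly (2 * m + 1) = hermite_poly (2 * j + 2) * hermite_poly (2 * m + 1)
      + Polynomial.smult (4 * real (Suc j)) (skew_even j * hermite_poly (2 * m + 1))"
    by (simp only: skew_even.simps distrib_right mult_smult_left)
  moreover have "2 * j + 2 \<noteq> 2 * m + 1" by presburger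
  ultimately show ?case
    by (simp only: gauss_int_add gauss_int_smult Suc gauss_int_0_hermite if_False) simp
qed

text \<open>A skew-orthogonal basis with one member of each degree. The odd members are divided by
  \<open>hnorm\<close> so that all nonzero pairings have absolute value 1/2.\<close>

definition skew_poly :: "nat \<Rightarrow> real poly" where
  "skew_poly c = (if even c then skew_even (c div 2) else Polynomial.smult (1 / hnorm c) (hermite_poly c))"

lemma degree_skew_even: "degree (skew_even j) \<le> 2 * j \<and> coeff (skew_even j) (2 * j) \<noteq> 0"
proof (induction j)
  case (Suc j)
  have "coeff (skew_even j) (2 * j + 2) = 0" using Suc by (intro coeff_eq_0) simp
  then show ?case
    using Suc degree_coeff_hermite_poly[of "2 * j + 2"]
    by (auto intro!: degree_add_le order.trans[OF degree_smult_le])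
qed simp

lemma degree_skew_poly: "degree (skew_poly c) \<le> c" and coeff_skew_poly: "coeff (skew_poly c) c \<noteq> 0"
proof -
  have "degree (skew_poly c) \<le> c \<and> coeff (skew_poly c) c \<noteq> 0"
  proof (cases "even c")
    case True
    then obtain j where "c = 2 * j" by blast
    then show ?thesis using degree_skew_even[of j] by (simp add: skew_poly_def)
  next
    case False
    then show ?thesis using degree_coeff_hermite_poly[of c]
      by (auto simp: skew_poly_def intro: order.trans[OF degree_smult_le])
  qed
  then show "degree (skew_poly c) \<le> c" "coeff (skew_poly c) c \<noteq> 0" by auto
qed

lemma skew_pairing_odd_even:
  "skew_pairing (skew_poly (2 * m + 1)) (skew_poly (2 * j)) = (if m = j then - 1 / 2 else 0)"
proof -
  have "skew_poly (2 * m + 1) * weighted_deriv (skew_poly (2 * j))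
      = Polynomial.smult (- 1 / 2 / hnorm (2 * m + 1)) (hermite_poly (2 * m + 1) * hermite_poly (2 * j + 1))"
    by (simp add: skew_poly_def weighted_deriv_skew_even)
  then have "skew_pairing (skew_poly (2 * m + 1)) (skew_poly (2 * j)) =
    of_real (- 1 / 2 / hnorm (2 * m + 1)) * (if 2 * m + 1 = 2 * j + 1 then of_real (hnorm (2 * j + 1)) else 0)"
    unfolding skew_pairing_def by (simp only: gauss_int_smult gauss_int_0_hermite hnorm_def)
  then show ?thesis by auto
qed

text \<open>Equal parities only meet Hermite polynomials of opposite parity and pair to zero. Mixed
  parities reduce to the orthogonality of odd Hermite polynomials, because the weighted derivative
  of \<open>skew_even\<close> is a multiple of a single one.\<close>

lemma skew_pairing_skew_poly:
  "skew_pairing (skew_poly a) (skew_poly b) =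
    (if b = (if even a then a + 1 else a - 1) then if even a then 1 / 2 else - 1 / 2 else 0)"
proof -
  consider (ee) j m where "a = 2 * j" "b = 2 * m" | (eo) j m where "a = 2 * j" "b = 2 * m + 1"
    | (oe) j m where "a = 2 * j + 1" "b = 2 * m" | (oo) j m where "a = 2 * j + 1" "b = 2 * m + 1"
    by (metis evenE oddE)
  then show ?thesis
  proof cases
    case ee
    have "skew_poly a * weighted_deriv (skew_poly b) = Polynomial.smult (- 1 / 2) (skew_even j * hermite_poly (2 * m + 1))"
      by (simp add: ee skew_poly_def weighted_deriv_skew_even)
    then have "skew_pairing (skew_poly a) (skew_poly b) = 0"
      unfolding skew_pairing_def by (simp only: gauss_int_smult skew_even_hermite_odd mult_zero_right)
    moreover have "2 * m \<noteq> 2 * j + 1" by presburger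
    ultimately show ?thesis by (simp add: ee)
  next
    case eo
    then show ?thesis
      using skew_pairing_odd_even[of m j] skew_pairing_antisym[of "skew_poly a" "skew_poly b"] by auto
  next
    case oe
    then show ?thesis using skew_pairing_odd_even[of j m] by auto
  next
    case oo
    have "skew_poly a * weighted_deriv (skew_poly b) =
       Polynomial.smult (1 / hnorm a * (1 / hnorm b) * real b) (hermite_poly (2 * j + 1) * hermite_poly (2 * m))
       - Polynomial.smult (1 / hnorm a * (1 / hnorm b) * (1 / 2)) (hermite_poly (2 * j + 1) * hermite_poly (2 * m + 2))"
      by (simp add: oo skew_poly_def weighted_deriv_smult weighted_deriv_hermite smult_diff_right right_diff_distrib ac_simps)
    moreover have "2 * j + 1 \<noteq> 2 * m" "2 * j + 1 \<noteq> 2 * m + 2" by presburger+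
    ultimately have "skew_pairing (skew_poly a) (skew_poly b) = 0"
      unfolding skew_pairing_def by (simp only: gauss_int_diff gauss_int_smult gauss_int_0_hermite if_False) simp
    moreover have "2 * m + 1 \<noteq> 2 * j" by presburger
    ultimately show ?thesis by (simp add: oo)
  qed
qed

text \<open>\<open>p_GSE\<close> in the variable \<open>x / (\<sigma> * sqrt 2)\<close>, without the
  Gaussian weight and the factor from the change of scale: the unitary part of order 2 n + 1, and
  \<open>tau\<close> with its sign integral evaluated.\<close>

definition gse_density :: "nat \<Rightarrow> real poly" where
  "gse_density n = (\<Sum>k<2 * n + 1. Polynomial.smult (1 / hnorm k) (hermite_poly k * hermite_poly k))
     - Polynomial.smult (1 / hnorm (2 * n)) (hermite_poly (2 * n) * skew_even n)"

text \<open>The skew kernel sums to the unitary kernel of order \<open>2 n + 1\<close> plus a rank-one term.\<close>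

lemma gse_density_skew:
  "(\<Sum>l<n. skew_poly (2 * l) * weighted_deriv (skew_poly (2 * l + 1)) - skew_poly (2 * l + 1) * weighted_deriv (skew_poly (2 * l)))
    = Polynomial.smult (1 / 2) (gse_density n)"
proof (induction n)
  case 0
  have "hnorm 0 \<noteq> 0" by simp
  then show ?case by (simp add: gse_density_def)
next
  case (Suc n)
  have "skew_poly (2 * n) * weighted_deriv (skew_poly (2 * n + 1)) - skew_poly (2 * n + 1) * weighted_deriv (skew_poly (2 * n))
    = Polynomial.smult (1 / 2) (gse_density (Suc n)) - Polynomial.smult (1 / 2) (gse_density n)"
  proof (rule poly_eqI_poly)
    fix x
    define q a b c h where "q = poly (skew_even n) x" and "a = poly (hermite_poly (2 * n)) x"
      and "b = poly (hermite_poly (2 * n + 1)) x" and "c = poly (hermite_poly (2 * n + 2)) x" and "h = hnorm (2 * n)"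
    have h: "hnorm (2 * n + 1) = 2 * real (2 * n + 1) * h" "hnorm (2 * n + 2) = 2 * real (2 * n + 2) * (2 * real (2 * n + 1) * h)"
      using hnorm_Suc[of "2 * n"] hnorm_Suc[of "2 * n + 1"] by (simp_all add: h_def)
    have "h > 0" by (simp add: h_def)
    have "poly (skew_poly (2 * n) * weighted_deriv (skew_poly (2 * n + 1)) - skew_poly (2 * n + 1) * weighted_deriv (skew_poly (2 * n))) x
      = 1 / hnorm (2 * n + 1) * (q * (real (2 * n + 1) * a - 1 / 2 * c) + 1 / 2 * b * b)"
      by (simp add: skew_poly_def weighted_deriv_smult poly_weighted_deriv_hermite weighted_deriv_skew_even q_def a_def b_def c_def algebra_simps)
    \<comment> \<open>\<open>c + 4 * (n + 1) * q\<close> is the value of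
      \<open>skew_even (Suc n)\<close>, so the squares of c cancel: the rank-one term of order n + 1
      enters and that of order n leaves.\<close>
    also have "\<dots> = 1 / 2 * (1 / hnorm (2 * n + 1) * (b * b) + 1 / hnorm (2 * n + 2) * (c * c)
       - 1 / hnorm (2 * n + 2) * (c * (c + 4 * real (Suc n) * q)) + 1 / h * (a * q))"
      unfolding h using \<open>h > 0\<close> by (simp add: divide_simps) (simp add: algebra_simps)
    also have "\<dots> = poly (Polynomial.smult (1 / 2) (gse_density (Suc n)) - Polynomial.smult (1 / 2) (gse_density n)) x"
    proof -
      have "(\<Sum>k<2 * Suc n + 1. Polynomial.smult (1 / hnorm k) (hermite_poly k * hermite_poly k))
        = (\<Sum>k<2 * n + 1. Polynomial.smult (1 / hnorm k) (hermite_poly k * hermite_poly k))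
         + Polynomial.smult (1 / hnorm (2 * n + 1)) (hermite_poly (2 * n + 1) * hermite_poly (2 * n + 1))
         + Polynomial.smult (1 / hnorm (2 * n + 2)) (hermite_poly (2 * n + 2) * hermite_poly (2 * n + 2))"
        by simp
      then show ?thesis
        unfolding gse_density_def skew_even.simps
        by (simp add: q_def a_def b_def c_def h_def algebra_simps)
    qed
    finally show "poly (skew_poly (2 * n) * weighted_deriv (skew_poly (2 * n + 1)) - skew_poly (2 * n + 1) * weighted_deriv (skew_poly (2 * n))) x
      = poly (Polynomial.smult (1 / 2) (gse_density (Suc n)) - Polynomial.smult (1 / 2) (gse_density n)) x" .
  qed
  then show ?case using Suc by simp
qed

section \<open>The sign integral and the polynomial form of \<open>p_GSE\<close>\<close>

lemma poly_gauss_half_at_top: "((\<lambda>x :: real. poly P x * exp (- (x\<^sup>2) / 2)) \<longlongrightarrow> 0) at_top"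
proof -
  have *: "((\<lambda>x :: real. x ^ i * exp (- (x\<^sup>2) / 2)) \<longlongrightarrow> 0) at_top" for i
    by real_asymp
  have "((\<lambda>x. \<Sum>i\<le>degree P. coeff P i * (x ^ i * exp (- (x\<^sup>2) / 2))) \<longlongrightarrow> (\<Sum>i\<le>degree P. coeff P i * 0)) at_top"
    by (intro tendsto_intros *)
  then show ?thesis by (simp add: poly_altdef sum_distrib_right mult.assoc)
qed

lemma poly_gauss_half_at_bot: "((\<lambda>x :: real. poly P x * exp (- (x\<^sup>2) / 2)) \<longlongrightarrow> 0) at_bot"
  using poly_gauss_half_at_top[of "pcompose P [:0, -1:]"]
  unfolding filterlim_at_bot_mirror by (simp add: poly_pcompose)

lemma integrable_poly_gauss_half: "integrable lborel (\<lambda>x :: real. poly P x * exp (- (x\<^sup>2) / 2))"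
proof -
  have "integrable lborel (\<lambda>x :: real. x ^ i * exp (- (x\<^sup>2) / 2))" for i
  proof -
    have "integrable lborel (\<lambda>x. sqrt (2 * pi) * (normal_density 0 1 x * (x - 0) ^ i))"
      by (intro integrable_mult_right integrable_normal_moment) simp
    moreover have "sqrt (2 * pi) * (normal_density 0 1 x * (x - 0) ^ i) = x ^ i * exp (- (x\<^sup>2) / 2)" for x
      by (simp add: normal_density_def)
    ultimately show ?thesis by (simp only:)
  qed
  then have "integrable lborel (\<lambda>x :: real. \<Sum>i\<le>degree P. coeff P i * (x ^ i * exp (- (x\<^sup>2) / 2)))"
    by (intro Bochner_Integration.integrable_sum integrable_mult_right)
  then show ?thesis by (simp add: poly_altdef sum_distrib_right mult.assoc)
qed

text \<open>\<open>P\<close> times exp (- t^2 / 2) is an antiderivative that decays at both ends, so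
  each half-line contributes its value at x, and the sign function makes the two contributions add
  up.\<close>

lemma integral_sgn_weighted_deriv:
  "(\<integral>t. sgn (x - t) * (poly (weighted_deriv P) t * exp (- (t\<^sup>2) / 2)) \<partial>lborel) = 2 * (poly P x * exp (- (x\<^sup>2) / 2))"
proof -
  define F where "F t = poly P t * exp (- (t\<^sup>2) / 2)" for t
  define f where "f t = poly (weighted_deriv P) t * exp (- (t\<^sup>2) / 2)" for t
  have D: "(F has_vector_derivative f t) (at t)" for t
    unfolding F_def f_def poly_weighted_deriv has_real_derivative_iff_has_vector_derivative[symmetric]
    by (auto intro!: derivative_eq_intros poly_DERIV simp: algebra_simps)
  have cont: "isCont f t" "isCont F t" for t
    unfolding f_def F_def by (auto intro!: continuous_intros)
  have int: "integrable lborel f" unfolding f_def by (rule integrable_poly_gauss_half)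
  have inta: "set_integrable lborel A f" if "A \<in> sets borel" for A
    unfolding set_integrable_def using integrable_mult_indicator[OF _ int, of A] that by simp
  have lim: "(F \<longlongrightarrow> 0) at_bot" "(F \<longlongrightarrow> 0) at_top"
    unfolding F_def by (rule poly_gauss_half_at_bot poly_gauss_half_at_top)+
  have "(LBINT t=-\<infinity>..ereal x. f t) = F x - 0"
  proof (rule interval_integral_FTC_integrable[where F = F])
    show "((F \<circ> real_of_ereal) \<longlongrightarrow> 0) (at_right (- \<infinity>))"
      unfolding ereal_tendsto_simps1 by (rule lim)
    show "((F \<circ> real_of_ereal) \<longlongrightarrow> F x) (at_left (ereal x))"
      unfolding ereal_tendsto_simps1 using cont(2)[of x] by (simp add: isCont_def filterlim_at_split)
    show "set_integrable lborel (einterval (- \<infinity>) (ereal x)) f" by (rule inta) simp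
  qed (simp_all add: D cont)
  then have L: "(LBINT t:{..<x}. f t) = F x"
    by (simp add: interval_lebesgue_integral_def)
  have "(LBINT t=ereal x..\<infinity>. f t) = 0 - F x"
  proof (rule interval_integral_FTC_integrable[where F = F])
    show "((F \<circ> real_of_ereal) \<longlongrightarrow> 0) (at_left \<infinity>)"
      unfolding ereal_tendsto_simps1 by (rule lim)
    show "((F \<circ> real_of_ereal) \<longlongrightarrow> F x) (at_right (ereal x))"
      unfolding ereal_tendsto_simps1 using cont(2)[of x] by (simp add: isCont_def filterlim_at_split)
    show "set_integrable lborel (einterval (ereal x) \<infinity>) f" by (rule inta) simp
  qed (simp_all add: D cont)
  then have R: "(LBINT t:{x<..}. f t) = - F x"
    by (simp add: interval_lebesgue_integral_def)
  have "(\<integral>t. sgn (x - t) * f t \<partial>lborel) = (\<integral>t. indicator {..<x} t *\<^sub>R f t - indicator {x<..} t *\<^sub>R f t \<partial>lborel)"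
    by (intro Bochner_Integration.integral_cong refl) (auto simp: sgn_real_def indicator_def)
  also have "\<dots> = (LBINT t:{..<x}. f t) - (LBINT t:{x<..}. f t)"
    unfolding set_lebesgue_integral_def
    by (intro Bochner_Integration.integral_diff inta[unfolded set_integrable_def]) simp_all
  finally show ?thesis unfolding L R by (simp add: F_def f_def)
qed

lemma hermite_fun_eq: "hermite_fun k x = poly (hermite_poly k) x * exp (- (x\<^sup>2) / 2) / sqrt (hnorm k)"
  by (simp add: hermite_fun_def hermite_eq_poly hnorm_def mult.commute mult.left_commute)

lemma exp_half_sq: "exp (- (x\<^sup>2) / 2) * exp (- (x\<^sup>2) / 2) = gweight x"
  by (simp flip: exp_add)

lemma tau_eq: "tau (2 * n + 1) x = - (poly (hermite_poly (2 * n)) x * poly (skew_even n) x * gweight x / hnorm (2 * n))"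
proof -
  let ?e = "exp (- (x\<^sup>2) / 2)"
  have "(\<integral>t. sgn (x - t) * hermite_fun (2 * n + 1) t \<partial>lborel)
     = (\<integral>t. (- 2 / sqrt (hnorm (2 * n + 1))) * (sgn (x - t) * (poly (weighted_deriv (skew_even n)) t * exp (- (t\<^sup>2) / 2))) \<partial>lborel)"
    by (intro Bochner_Integration.integral_cong refl) (simp add: hermite_fun_eq poly_weighted_deriv_skew_even)
  also have "\<dots> = - 4 / sqrt (hnorm (2 * n + 1)) * (poly (skew_even n) x * ?e)"
    by (simp only: integral_mult_right_zero integral_sgn_weighted_deriv)
  finally have int: "(\<integral>t. sgn (x - t) * hermite_fun (2 * n + 1) t \<partial>lborel)
     = - 4 / sqrt (hnorm (2 * n + 1)) * (poly (skew_even n) x * ?e)" .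
  \<comment> \<open>The factorisation that lets the prefactor sqrt (m / 2) of \<open>tau\<close>
    cancel.\<close>
  have "hnorm (2 * n + 1) = 4 * (real (2 * n + 1) / 2) * hnorm (2 * n)"
    using hnorm_Suc[of "2 * n"] by simp
  then have s: "sqrt (hnorm (2 * n + 1)) = 2 * sqrt (real (2 * n + 1) / 2) * sqrt (hnorm (2 * n))"
    by (simp only: real_sqrt_mult real_sqrt_four)
  have ss: "sqrt (hnorm (2 * n)) * sqrt (hnorm (2 * n)) = hnorm (2 * n)" by (simp add: abs_of_pos)
  have "tau (2 * n + 1) x = sqrt (real (2 * n + 1) / 2) * (poly (hermite_poly (2 * n)) x * ?e / sqrt (hnorm (2 * n)))
     * (1 / 2 * (- 4 / sqrt (hnorm (2 * n + 1)) * (poly (skew_even n) x * ?e)))"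
    unfolding tau_def int by (simp add: hermite_fun_eq)
  also have "\<dots> = - (poly (hermite_poly (2 * n)) x * poly (skew_even n) x * (?e * ?e) / (sqrt (hnorm (2 * n)) * sqrt (hnorm (2 * n))))"
  proof -
    have "z * (p / r) * (1 / 2 * (- 4 / (2 * z * r) * q)) = - (p * q / (r * r))" if "z > 0" "r > 0" for z p q r :: real
      using that by (simp add: field_simps)
    from this[of "sqrt (real (2 * n + 1) / 2)" "sqrt (hnorm (2 * n))"]
    show ?thesis unfolding s by (simp add: ac_simps)
  qed
  finally show ?thesis unfolding ss exp_half_sq by simp
qed

lemma p_GSE_eq:
  "p_GSE n \<sigma> x = 1 / (\<sigma> * sqrt 2) * (poly (gse_density n) (x / (\<sigma> * sqrt 2)) * gweight (x / (\<sigma> * sqrt 2)))"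
proof -
  define y where "y = x / (\<sigma> * sqrt 2)"
  have "(hermite_fun k y)\<^sup>2 = 1 / hnorm k * (poly (hermite_poly k) y * poly (hermite_poly k) y) * gweight y" for k
    unfolding hermite_fun_eq exp_half_sq[symmetric] using hnorm_pos[of k]
    by (simp add: power2_eq_square field_simps abs_of_pos[OF hnorm_pos])
  then have "(\<Sum>k<m. (hermite_fun k y)\<^sup>2)
      = poly (\<Sum>k<m. Polynomial.smult (1 / hnorm k) (hermite_poly k * hermite_poly k)) y * gweight y" for m
    by (simp add: poly_sum sum_distrib_right)
  then show ?thesis
    unfolding p_GSE_def p_GUE_def tau_eq y_def[symmetric] gse_density_def poly_diff
    by (simp add: algebra_simps)
qed

section \<open>The Laplace transform of the mean density\<close>

lemma laplace_p_GSE: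
  assumes "\<sigma> > 0"
  shows "integrable lborel (\<lambda>x. exp (s * of_real x) * of_real (p_GSE n \<sigma> x) :: complex)"
    and "laplace (p_GSE n \<sigma>) s = gauss_int (s * of_real (\<sigma> * sqrt 2)) (gse_density n)"
proof -
  define c where "c = \<sigma> * sqrt 2"
  have c: "c > 0" using assms by (simp add: c_def)
  define f where "f x = exp (s * of_real x) * complex_of_real (p_GSE n \<sigma> x)" for x
  have f: "f (0 + c * y) = of_real (1 / c) * (exp (s * of_real c * of_real y) * of_real (poly (gse_density n) y * gweight y))" for y
    using c unfolding f_def p_GSE_eq c_def[symmetric] by (simp add: ac_simps)
  have "integrable lborel (\<lambda>y. f (0 + c * y))"
    unfolding f by (intro integrable_mult_right integrable_poly_gaussian_complex)
  then show "integrable lborel (\<lambda>x. exp (s * of_real x) * of_real (p_GSE n \<sigma> x) :: complex)"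
    using c by (subst (asm) lborel_integrable_real_affine_iff) (auto simp: f_def[abs_def])
  have "laplace (p_GSE n \<sigma>) s = \<bar>c\<bar> *\<^sub>R (\<integral>y. f (0 + c * y) \<partial>lborel)"
    unfolding laplace_def f_def[symmetric] by (rule lborel_integral_real_affine) (use c in simp)
  also have "\<dots> = gauss_int (s * of_real c) (gse_density n)"
    unfolding f gauss_int_def integral_mult_right_zero using c by (simp add: scaleR_conv_of_real)
  finally show "laplace (p_GSE n \<sigma>) s = gauss_int (s * of_real (\<sigma> * sqrt 2)) (gse_density n)"
    by (simp only: c_def)
qed

text \<open>The series ends at r = m, and the signs of the Pochhammer symbol and of the argument
  cancel.\<close>

lemma hyp1F1_neg_of_nat:
  "hyp1F1 (- of_nat m) (1 + of_nat b) (- y) = (\<Sum>r\<le>m. of_nat (m choose r) * fact b / fact (b + r) * y ^ r)"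
proof -
  have p1: "pochhammer (- of_nat m :: complex) r = (- 1) ^ r * fact r * of_nat (m choose r)" for r
  proof -
    have "fact r * of_nat (m choose r) = (- 1) ^ r * pochhammer (- of_nat m :: complex) r"
      by (simp add: binomial_gbinomial gbinomial_pochhammer)
    then have "(- 1) ^ r * (fact r * of_nat (m choose r)) = ((- 1) ^ r * (- 1) ^ r) * pochhammer (- of_nat m :: complex) r"
      by (simp only: mult.assoc)
    then show ?thesis by (simp add: mult.assoc flip: power_mult_distrib)
  qed
  have p2: "pochhammer (1 + of_nat b :: complex) r = fact (b + r) / fact b" for r
    using pochhammer_product'[of "1 :: complex" b r] by (simp add: pochhammer_fact[symmetric])
  have "hyp1F1 (- of_nat m) (1 + of_nat b) (- y) =
    (\<Sum>r\<le>m. pochhammer (- of_nat m) r / pochhammer (1 + of_nat b) r * ((- y) ^ r / fact r))"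
    unfolding hyp1F1_def by (rule suminf_finite) (auto simp: p1 not_le)
  also have "\<dots> = (\<Sum>r\<le>m. of_nat (m choose r) * fact b / fact (b + r) * y ^ r)"
  proof (intro sum.cong refl)
    fix r
    have "((- 1) ^ r * (- y) ^ r) = y ^ r" by (simp flip: power_mult_distrib)
    then have "(- 1) ^ r * fact r * of_nat (m choose r) / (fact (b + r) / fact b) * ((- y) ^ r / fact r)
       = of_nat (m choose r) * fact b / fact (b + r) * y ^ r"
      by (simp add: field_simps)
    then show "pochhammer (- of_nat m) r / pochhammer (1 + of_nat b) r * ((- y) ^ r / fact r)
       = of_nat (m choose r) * fact b / fact (b + r) * y ^ r"
      unfolding p1 p2 .
  qed
  finally show ?thesis .
qed

text \<open>The distance of the indices is even, so the powers of t combine to powers of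
  \<open>t\<^sup>2\<close>. Reversing the sum by r = m - l gives, up to a factorial, the terminating
  series of \<open>hyp1F1_neg_of_nat\<close>.\<close>

lemma gauss_int_hermite_le:
  assumes "t\<^sup>2 = 2 * y"
  shows "gauss_int t (hermite_poly m * hermite_poly (m + 2 * i)) / of_real (hnorm (m + 2 * i)) =
    exp (y / 2) * (y ^ i / 2 ^ i * (\<Sum>r\<le>m. of_nat (m choose r) / fact (2 * i + r) * y ^ r))"
proof -
  have t4: "t\<^sup>2 / 4 = y / 2" unfolding assms by simp
  have "(\<Sum>l\<le>m. of_nat (m choose l) * of_nat ((m + 2 * i) choose l) * 2 ^ l * fact l * t ^ (m - l) * t ^ (m + 2 * i - l))
    = (\<Sum>r\<le>m. of_nat (m choose (m - r)) * of_nat ((m + 2 * i) choose (m - r)) * 2 ^ (m - r) * fact (m - r)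
         * t ^ (m - (m - r)) * t ^ (m + 2 * i - (m - r)))"
    by (rule sum.reindex_bij_witness[of _ "\<lambda>r. m - r" "\<lambda>l. m - l"]) auto
  also have "\<dots> = (\<Sum>r\<le>m. (2 ^ (m + 2 * i) * fact (m + 2 * i)) * (y ^ i / 2 ^ i * (of_nat (m choose r) / fact (2 * i + r) * y ^ r)))"
  proof (intro sum.cong refl)
    fix r assume "r \<in> {..m}"
    then obtain k where k: "m = r + k" by (auto simp: le_iff_add)
    have b1: "m choose (m - r) = m choose r" using binomial_symmetric[of r m] k by simp
    have b2: "of_nat ((m + 2 * i) choose (m - r)) * fact k = (fact (m + 2 * i) / fact (2 * i + r) :: complex)"
    proof -
      have "fact k * fact (2 * i + r) * ((m + 2 * i) choose k) = (fact (m + 2 * i) :: nat)"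
        using binomial_fact_lemma[of k "m + 2 * i"] k by (simp add: algebra_simps)
      then have "of_nat (fact k * fact (2 * i + r) * ((m + 2 * i) choose k)) = (of_nat (fact (m + 2 * i)) :: complex)"
        by simp
      then show ?thesis using k by (simp add: field_simps)
    qed
    have t: "t ^ (m - (m - r)) * t ^ (m + 2 * i - (m - r)) = 2 ^ (i + r) * y ^ (i + r)"
    proof -
      have "t ^ (m - (m - r)) * t ^ (m + 2 * i - (m - r)) = t ^ (2 * (i + r))"
        unfolding power_add[symmetric] using k by (simp add: algebra_simps)
      also have "\<dots> = (2 * y) ^ (i + r)" by (simp only: power_mult assms)
      finally show ?thesis by (simp only: power_mult_distrib)
    qed
    have p: "(2 :: complex) ^ k * 2 ^ (i + r) * 2 ^ i = 2 ^ (m + 2 * i)"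
      unfolding power_add[symmetric] k by (rule arg_cong[where f = "(^) 2"]) simp
    have "of_nat (m choose (m - r)) * of_nat ((m + 2 * i) choose (m - r)) * 2 ^ (m - r) * fact (m - r)
         * t ^ (m - (m - r)) * t ^ (m + 2 * i - (m - r))
      = of_nat (m choose r) * (of_nat ((m + 2 * i) choose (m - r)) * fact k) * 2 ^ k * (t ^ (m - (m - r)) * t ^ (m + 2 * i - (m - r)))"
      unfolding b1 using k by simp
    also have "\<dots> = (2 ^ k * 2 ^ (i + r) * 2 ^ i) * fact (m + 2 * i) * (y ^ i / 2 ^ i * (of_nat (m choose r) / fact (2 * i + r) * y ^ r))"
      unfolding b2 t by (simp add: power_add field_simps)
    finally show "of_nat (m choose (m - r)) * of_nat ((m + 2 * i) choose (m - r)) * 2 ^ (m - r) * fact (m - r)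
         * t ^ (m - (m - r)) * t ^ (m + 2 * i - (m - r))
      = (2 ^ (m + 2 * i) * fact (m + 2 * i)) * (y ^ i / 2 ^ i * (of_nat (m choose r) / fact (2 * i + r) * y ^ r))"
      unfolding p .
  qed
  finally have *: "(\<Sum>l\<le>m. of_nat (m choose l) * of_nat ((m + 2 * i) choose l) * 2 ^ l * fact l * t ^ (m - l) * t ^ (m + 2 * i - l))
     = (2 ^ (m + 2 * i) * fact (m + 2 * i)) * (y ^ i / 2 ^ i * (\<Sum>r\<le>m. of_nat (m choose r) / fact (2 * i + r) * y ^ r))"
    by (simp only: sum_distrib_left)
  have h: "complex_of_real (hnorm k) = of_real (sqrt pi) * (2 ^ k * fact k)" for k
    by (simp add: hnorm_def)
  have "of_real (sqrt pi) * e * (a * b) / (of_real (sqrt pi) * a) = e * b" if "a \<noteq> 0" for e a b :: complex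
    using that by simp
  then show ?thesis
    unfolding gauss_int_hermite_hermite t4 * h by simp
qed

text \<open>The unrolled recursion; its coefficients are the origin of n! / (n - i)! in the closed
  form.\<close>

lemma skew_even_eq_sum:
  "skew_even n = (\<Sum>i\<le>n. Polynomial.smult (4 ^ i * fact n / fact (n - i)) (hermite_poly (2 * (n - i))))"
proof (induction n)
  case (Suc n)
  have "skew_even (Suc n) = hermite_poly (2 * Suc n) +
    (\<Sum>i\<le>n. Polynomial.smult (4 * real (Suc n) * (4 ^ i * fact n / fact (n - i))) (hermite_poly (2 * (n - i))))"
    by (rule poly_eqI_poly) (simp add: Suc poly_sum sum_distrib_left mult.assoc)
  also have "\<dots> = (\<Sum>i\<le>Suc n. Polynomial.smult (4 ^ i * fact (Suc n) / fact (Suc n - i)) (hermite_poly (2 * (Suc n - i))))"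
  proof -
    have "0 < fact n + fact n * real n" by (intro add_pos_nonneg) simp_all
    then show ?thesis unfolding sum.atMost_Suc_shift by (simp add: algebra_simps)
  qed
  finally show ?case .
qed simp

lemma sum_choose_lessThan: "(\<Sum>k<m. k choose r) = m choose Suc r"
  by (induction m) simp_all

lemma gauss_int_gse_density:
  assumes "t\<^sup>2 = 2 * y"
  shows "gauss_int t (gse_density n) =
     - exp (y / 2) * (\<Sum>i=0..n. y ^ i * 2 ^ i * fact n / (fact (2 * i) * fact (n - i)) *
          hyp1F1 (- of_nat (2 * n - 2 * i)) (1 + 2 * of_nat i) (- y))
      + of_nat (2 * n + 1) * exp (y / 2) * hyp1F1 (1 - of_nat (2 * n + 1)) 2 (- y)"
proof -
  have "gauss_int t (\<Sum>k<2 * n + 1. Polynomial.smult (1 / hnorm k) (hermite_poly k * hermite_poly k))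
     = (\<Sum>k<2 * n + 1. gauss_int t (hermite_poly k * hermite_poly (k + 2 * 0)) / of_real (hnorm (k + 2 * 0)))"
    unfolding gauss_int_sum gauss_int_smult by (intro sum.cong refl) simp
  also have "\<dots> = (\<Sum>k<2 * n + 1. exp (y / 2) * (\<Sum>r\<le>k. of_nat (k choose r) / fact r * y ^ r))"
    unfolding gauss_int_hermite_le[OF assms] by simp
  \<comment> \<open>Binomial coefficients with r > k vanish, so the inner range can be made
    independent of k and the sums exchanged; the sum over k is then the hockey-stick
    identity.\<close>
  also have "\<dots> = (\<Sum>k<2 * n + 1. exp (y / 2) * (\<Sum>r\<le>2 * n. of_nat (k choose r) / fact r * y ^ r))"
    by (intro sum.cong refl arg_cong2[where f = "(*)"] sum.mono_neutral_left) auto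
  also have "\<dots> = exp (y / 2) * (\<Sum>r\<le>2 * n. \<Sum>k<2 * n + 1. of_nat (k choose r) / fact r * y ^ r)"
    unfolding sum_distrib_left[symmetric] by (subst sum.swap) (rule refl)
  also have "\<dots> = exp (y / 2) * (\<Sum>r\<le>2 * n. of_nat (2 * n + 1) * (of_nat (2 * n choose r) * fact 1 / fact (1 + r) * y ^ r))"
  proof (intro arg_cong2[where f = "(*)"] sum.cong refl)
    fix r
    have "(\<Sum>k<2 * n + 1. of_nat (k choose r) / fact r * y ^ r) = of_nat (\<Sum>k<2 * n + 1. k choose r) / fact r * y ^ r"
      unfolding of_nat_sum sum_divide_distrib sum_distrib_right ..
    also have "\<dots> = of_nat (Suc r * (Suc (2 * n) choose Suc r)) / (of_nat (Suc r) * fact r) * y ^ r"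
      unfolding sum_choose_lessThan of_nat_mult by (simp del: of_nat_Suc binomial_Suc_Suc)
    also have "\<dots> = of_nat (2 * n + 1) * (of_nat (2 * n choose r) * fact 1 / fact (1 + r) * y ^ r)"
      unfolding Suc_times_binomial by (simp del: of_nat_Suc) (simp add: algebra_simps)
    finally show "(\<Sum>k<2 * n + 1. of_nat (k choose r) / fact r * y ^ r) =
      of_nat (2 * n + 1) * (of_nat (2 * n choose r) * fact 1 / fact (1 + r) * y ^ r)" .
  qed
  also have "\<dots> = of_nat (2 * n + 1) * exp (y / 2) * hyp1F1 (- of_nat (2 * n)) (1 + of_nat 1) (- y)"
    unfolding hyp1F1_neg_of_nat sum_distrib_left[symmetric] by (simp only: ac_simps)
  finally have A: "gauss_int t (\<Sum>k<2 * n + 1. Polynomial.smult (1 / hnorm k) (hermite_poly k * hermite_poly k))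
     = of_nat (2 * n + 1) * exp (y / 2) * hyp1F1 (1 - of_nat (2 * n + 1)) 2 (- y)"
    by simp
  have "gauss_int t (Polynomial.smult (1 / hnorm (2 * n)) (hermite_poly (2 * n) * skew_even n)) =
     (\<Sum>i\<le>n. of_real (4 ^ i * fact n / fact (n - i)) *
        (gauss_int t (hermite_poly (2 * (n - i)) * hermite_poly (2 * n)) / of_real (hnorm (2 * n))))"
    unfolding skew_even_eq_sum sum_distrib_left gauss_int_smult gauss_int_sum mult_smult_right
    by (intro sum.cong refl) (simp add: mult.commute)
  also have "\<dots> = (\<Sum>i\<le>n. exp (y / 2) * (y ^ i * 2 ^ i * fact n / (fact (2 * i) * fact (n - i)) *
          hyp1F1 (- of_nat (2 * n - 2 * i)) (1 + 2 * of_nat i) (- y)))"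
  proof (intro sum.cong refl)
    fix i assume "i \<in> {..n}"
    then have e: "2 * (n - i) = 2 * n - 2 * i" "2 * n = (2 * n - 2 * i) + 2 * i" by auto
    have "gauss_int t (hermite_poly (2 * (n - i)) * hermite_poly (2 * n)) / of_real (hnorm (2 * n)) =
      exp (y / 2) * (y ^ i / 2 ^ i * (\<Sum>r\<le>2 * n - 2 * i. of_nat ((2 * n - 2 * i) choose r) / fact (2 * i + r) * y ^ r))"
      using gauss_int_hermite_le[OF assms, of "2 * n - 2 * i" i] e by simp
    moreover have "hyp1F1 (- of_nat (2 * n - 2 * i)) (1 + 2 * of_nat i) (- y) =
      fact (2 * i) * (\<Sum>r\<le>2 * n - 2 * i. of_nat ((2 * n - 2 * i) choose r) / fact (2 * i + r) * y ^ r)"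
      using hyp1F1_neg_of_nat[of "2 * n - 2 * i" "2 * i" y] by (simp add: sum_distrib_left ac_simps)
    moreover have "(4 :: complex) ^ i = 2 ^ i * 2 ^ i" by (simp flip: power_mult_distrib)
    ultimately show "of_real (4 ^ i * fact n / fact (n - i)) *
        (gauss_int t (hermite_poly (2 * (n - i)) * hermite_poly (2 * n)) / of_real (hnorm (2 * n))) =
       exp (y / 2) * (y ^ i * 2 ^ i * fact n / (fact (2 * i) * fact (n - i)) *
          hyp1F1 (- of_nat (2 * n - 2 * i)) (1 + 2 * of_nat i) (- y))"
      by simp
  qed
  finally have B: "gauss_int t (Polynomial.smult (1 / hnorm (2 * n)) (hermite_poly (2 * n) * skew_even n)) =
     exp (y / 2) * (\<Sum>i=0..n. y ^ i * 2 ^ i * fact n / (fact (2 * i) * fact (n - i)) *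
          hyp1F1 (- of_nat (2 * n - 2 * i)) (1 + 2 * of_nat i) (- y))"
    by (simp only: sum_distrib_left atLeast0AtMost)
  show ?thesis
    unfolding gse_density_def gauss_int_diff A B by simp
qed

section \<open>Loop equations for the eigenvalue density\<close>

context gaussian_moments
begin

lemma gder_power:
  assumes "j \<in> I"
  shows "gder (\<lambda>\<omega>. of_real (\<xi> j \<omega>) ^ k) (\<lambda>i \<omega>. if i = j then of_nat k * of_real (\<xi> j \<omega>) ^ (k - 1) else 0)"
proof (induction k)
  case 0
  have "(\<lambda>i \<omega>. if i = j then of_nat 0 * complex_of_real (\<xi> j \<omega>) ^ (0 - 1) else 0) = (\<lambda>_ _. 0)"
    by (simp add: fun_eq_iff)
  then show ?case using gder_const[of 1] by simp
next
  case (Suc k)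
  have "(\<lambda>i \<omega>. (if i = j then 1 else 0) * complex_of_real (\<xi> j \<omega>) ^ k
      + of_real (\<xi> j \<omega>) * (if i = j then of_nat k * of_real (\<xi> j \<omega>) ^ (k - 1) else 0))
    = (\<lambda>i \<omega>. if i = j then of_nat (Suc k) * of_real (\<xi> j \<omega>) ^ (Suc k - 1) else 0)"
    by (cases k) (auto simp: fun_eq_iff algebra_simps)
  then show ?case
    using gder_mult[OF gder_coord[OF assms] Suc] by simp
qed

text \<open>\<open>log_deriv F g\<close>: the vector field \<open>\<Sum>i. \<xi> i ^ k \<partial>\<^sub>i\<close> multiplies the polynomial \<open>F\<close> by \<open>g k\<close>.\<close>

definition log_deriv :: "('w \<Rightarrow> complex) \<Rightarrow> (nat \<Rightarrow> 'w \<Rightarrow> complex) \<Rightarrow> bool" where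
  "log_deriv F g \<longleftrightarrow> (\<exists>D. gder F D \<and> (\<forall>k \<omega>. (\<Sum>i\<in>I. of_real (\<xi> i \<omega>) ^ k * D i \<omega>) = g k \<omega> * F \<omega>))"

lemma log_deriv_1: "log_deriv (\<lambda>_. 1) (\<lambda>_ _. 0)"
  unfolding log_deriv_def by (rule exI[of _ "\<lambda>_ _. 0"]) (simp add: gder_const)

lemma log_deriv_mult:
  assumes "log_deriv F g" "log_deriv G h"
  shows "log_deriv (\<lambda>\<omega>. F \<omega> * G \<omega>) (\<lambda>k \<omega>. g k \<omega> + h k \<omega>)"
proof -
  obtain D where D: "gder F D" "\<And>k \<omega>. (\<Sum>i\<in>I. of_real (\<xi> i \<omega>) ^ k * D i \<omega>) = g k \<omega> * F \<omega>"
    using assms(1) unfolding log_deriv_def by blast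
  obtain E where E: "gder G E" "\<And>k \<omega>. (\<Sum>i\<in>I. of_real (\<xi> i \<omega>) ^ k * E i \<omega>) = h k \<omega> * G \<omega>"
    using assms(2) unfolding log_deriv_def by blast
  have "(\<Sum>i\<in>I. of_real (\<xi> i \<omega>) ^ k * (D i \<omega> * G \<omega> + F \<omega> * E i \<omega>)) = (g k \<omega> + h k \<omega>) * (F \<omega> * G \<omega>)" for k \<omega>
  proof -
    have "(\<Sum>i\<in>I. of_real (\<xi> i \<omega>) ^ k * (D i \<omega> * G \<omega> + F \<omega> * E i \<omega>)) =
      (\<Sum>i\<in>I. of_real (\<xi> i \<omega>) ^ k * D i \<omega>) * G \<omega> + F \<omega> * (\<Sum>i\<in>I. of_real (\<xi> i \<omega>) ^ k * E i \<omega>)"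
      unfolding sum_distrib_left sum_distrib_right sum.distrib[symmetric]
      by (intro sum.cong refl) (simp add: algebra_simps)
    then show ?thesis unfolding D(2) E(2) by (simp add: algebra_simps)
  qed
  then show ?thesis
    unfolding log_deriv_def using gder_mult[OF D(1) E(1)] by blast
qed

lemma log_deriv_prod:
  assumes "finite A" "\<And>a. a \<in> A \<Longrightarrow> log_deriv (F a) (g a)"
  shows "log_deriv (\<lambda>\<omega>. \<Prod>a\<in>A. F a \<omega>) (\<lambda>k \<omega>. \<Sum>a\<in>A. g a k \<omega>)"
  using assms
proof (induction A rule: finite_induct)
  case empty
  show ?case by (simp add: log_deriv_1)
next
  case (insert a A)
  then show ?case using log_deriv_mult[of "F a" "g a"] by simp
qed

text \<open>The quotient of \<open>\<xi> i ^ k - \<xi> j ^ k\<close> by the difference is written as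
  a polynomial, which avoids a division where two coordinates coincide.\<close>

lemma log_deriv_diff:
  assumes "i \<in> I" "j \<in> I"
  shows "log_deriv (\<lambda>\<omega>. of_real (\<xi> i \<omega> - \<xi> j \<omega>))
    (\<lambda>k \<omega>. \<Sum>r<k. of_real (\<xi> j \<omega>) ^ (k - Suc r) * of_real (\<xi> i \<omega>) ^ r)"
proof -
  have "gder (\<lambda>\<omega>. of_real (\<xi> i \<omega>) + (- 1) * of_real (\<xi> j \<omega>))
      (\<lambda>m _. (if m = i then 1 else 0) + (- 1) * (if m = j then 1 else 0))"
    by (intro gder_add gder_cmult gder_coord assms)
  moreover have "(\<Sum>m\<in>I. of_real (\<xi> m \<omega>) ^ k * ((if m = i then 1 else 0) + (- 1) * (if m = j then 1 else 0)))
     = (\<Sum>r<k. of_real (\<xi> j \<omega>) ^ (k - Suc r) * of_real (\<xi> i \<omega>) ^ r) * complex_of_real (\<xi> i \<omega> - \<xi> j \<omega>)" for k \<omega>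
  proof -
    have "(\<Sum>m\<in>I. of_real (\<xi> m \<omega>) ^ k * ((if m = i then 1 else 0) + (- 1) * (if m = j then 1 else 0)))
      = (\<Sum>m\<in>I. if m = i then complex_of_real (\<xi> m \<omega>) ^ k else 0) - (\<Sum>m\<in>I. if m = j then of_real (\<xi> m \<omega>) ^ k else 0)"
      unfolding sum_subtractf[symmetric] by (intro sum.cong refl) simp
    also have "\<dots> = complex_of_real (\<xi> i \<omega>) ^ k - of_real (\<xi> j \<omega>) ^ k"
      using assms fin_I by simp
    finally show ?thesis by (simp add: power_diff_sumr2 mult.commute)
  qed
  ultimately show ?thesis unfolding log_deriv_def by (intro exI conjI allI) auto
qed

end

locale beta4_ensemble = gaussian_moments M "{..<n}" \<xi> "\<lambda>_. 1 / 2"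
  for M :: "'w measure" and n :: nat and \<xi>
begin

definition disc :: "'w \<Rightarrow> real" where
  "disc \<omega> = (\<Prod>i<n. \<Prod>j<i. \<xi> i \<omega> - \<xi> j \<omega>) ^ 4"

text \<open>The factor 2 matches the double eigenvalues of the complex image; it makes
  \<open>S 0\<close> equal to the size 2 n of that matrix.\<close>

definition S :: "nat \<Rightarrow> 'w \<Rightarrow> complex" where
  "S k \<omega> = 2 * (\<Sum>i<n. of_real (\<xi> i \<omega>) ^ k)"

definition prodS :: "nat list \<Rightarrow> 'w \<Rightarrow> complex" where
  "prodS ks \<omega> = (\<Prod>k\<leftarrow>ks. S k \<omega>)"

definition dS :: "nat \<Rightarrow> nat \<Rightarrow> 'w \<Rightarrow> complex" where
  "dS k i \<omega> = 2 * (of_nat k * of_real (\<xi> i \<omega>) ^ (k - 1))"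

definition dprodS :: "nat list \<Rightarrow> nat \<Rightarrow> 'w \<Rightarrow> complex" where
  "dprodS ks i \<omega> = (\<Sum>j<length ks. dS (ks ! j) i \<omega> * prodS (take j ks @ drop (Suc j) ks) \<omega>)"

lemma gder_S: "gder (S k) (dS k)"
proof (rule gder_cong)
  have "gder (\<lambda>\<omega>. 2 * (\<Sum>i<n. of_real (\<xi> i \<omega>) ^ k))
    (\<lambda>i \<omega>. 2 * (\<Sum>j<n. if i = j then of_nat k * of_real (\<xi> j \<omega>) ^ (k - 1) else 0))"
    by (intro gder_cmult gder_sum gder_power)
  then show "gder (S k) (\<lambda>i \<omega>. 2 * (\<Sum>j<n. if i = j then of_nat k * of_real (\<xi> j \<omega>) ^ (k - 1) else 0))"
    by (simp add: S_def[abs_def])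
qed (simp add: dS_def[abs_def])

lemma gder_prodS: "gder (prodS ks) (dprodS ks)"
  unfolding prodS_def[abs_def] dprodS_def[abs_def] by (rule gder_prod_list) (rule gder_S)

lemma sum_below_diagonal:
  fixes f :: "nat \<Rightarrow> nat \<Rightarrow> complex"
  assumes "\<And>i j. f i j = f j i"
  shows "2 * (\<Sum>i<n. \<Sum>j<i. f i j) = (\<Sum>i<n. \<Sum>j<n. f i j) - (\<Sum>i<n. f i i)"
proof (induction n)
  case (Suc n)
  have "(\<Sum>i<n. f i n) = (\<Sum>i<n. f n i)" using assms by simp
  then show ?case using Suc by (simp add: sum.distrib algebra_simps)
qed simp

text \<open>Four times the sum over unordered pairs is twice the sum over all index pairs minus
  twice the diagonal. The full sum factorises into power sums, each half of an \<open>S\<close>; the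
  diagonal gives the term with \<open>of_nat k\<close>.\<close>

lemma log_deriv_disc: "log_deriv (\<lambda>\<omega>. of_real (disc \<omega>))
   (\<lambda>k \<omega>. 1 / 2 * (\<Sum>r<k. S r \<omega> * S (k - 1 - r) \<omega>) - of_nat k * S (k - 1) \<omega>)"
proof -
  define h where "h i j k \<omega> = (\<Sum>r<k. complex_of_real (\<xi> j \<omega>) ^ (k - Suc r) * of_real (\<xi> i \<omega>) ^ r)" for i j k \<omega>
  have "log_deriv (\<lambda>\<omega>. \<Prod>a<4::nat. \<Prod>i<n. \<Prod>j<i. of_real (\<xi> i \<omega> - \<xi> j \<omega>))
      (\<lambda>k \<omega>. \<Sum>a<4::nat. \<Sum>i<n. \<Sum>j<i. h i j k \<omega>)"
    unfolding h_def by (intro log_deriv_prod log_deriv_diff) auto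
  moreover have "(\<Sum>a<4::nat. \<Sum>i<n. \<Sum>j<i. h i j k \<omega>)
     = 1 / 2 * (\<Sum>r<k. S r \<omega> * S (k - 1 - r) \<omega>) - of_nat k * S (k - 1) \<omega>" for k \<omega>
  proof -
    have sym: "h i j k \<omega> = h j i k \<omega>" for i j
      unfolding h_def by (subst sum.nat_diff_reindex[symmetric]) (auto intro!: sum.cong)
    have "(\<Sum>i<n. \<Sum>j<n. h i j k \<omega>) = (\<Sum>r<k. (\<Sum>i<n. of_real (\<xi> i \<omega>) ^ r) * (\<Sum>j<n. of_real (\<xi> j \<omega>) ^ (k - 1 - r)))"
    proof -
      have "(\<Sum>i<n. \<Sum>j<n. h i j k \<omega>) = (\<Sum>i<n. \<Sum>r<k. of_real (\<xi> i \<omega>) ^ r * (\<Sum>j<n. of_real (\<xi> j \<omega>) ^ (k - 1 - r)))"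
      proof (rule sum.cong[OF refl])
        fix i
        have "(\<Sum>j<n. h i j k \<omega>) = (\<Sum>r<k. \<Sum>j<n. of_real (\<xi> j \<omega>) ^ (k - Suc r) * of_real (\<xi> i \<omega>) ^ r)"
          unfolding h_def by (rule sum.swap)
        then show "(\<Sum>j<n. h i j k \<omega>) = (\<Sum>r<k. of_real (\<xi> i \<omega>) ^ r * (\<Sum>j<n. of_real (\<xi> j \<omega>) ^ (k - 1 - r)))"
          by (simp add: sum_distrib_left mult.commute)
      qed
      also have "\<dots> = (\<Sum>r<k. \<Sum>i<n. of_real (\<xi> i \<omega>) ^ r * (\<Sum>j<n. of_real (\<xi> j \<omega>) ^ (k - 1 - r)))"
        by (rule sum.swap)
      finally show ?thesis by (simp only: sum_distrib_right)
    qed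
    moreover have "h i i k \<omega> = of_nat k * of_real (\<xi> i \<omega>) ^ (k - 1)" for i
      unfolding h_def by (simp add: power_add[symmetric])
    ultimately have "2 * (\<Sum>i<n. \<Sum>j<i. h i j k \<omega>) =
       (\<Sum>r<k. (\<Sum>i<n. of_real (\<xi> i \<omega>) ^ r) * (\<Sum>j<n. of_real (\<xi> j \<omega>) ^ (k - 1 - r)))
         - of_nat k * (\<Sum>i<n. of_real (\<xi> i \<omega>) ^ (k - 1))"
      using sum_below_diagonal[of "\<lambda>i j. h i j k \<omega>", OF sym] by (simp add: sum_distrib_left)
    then have "2 * (2 * (\<Sum>i<n. \<Sum>j<i. h i j k \<omega>)) =
       2 * (\<Sum>r<k. (\<Sum>i<n. of_real (\<xi> i \<omega>) ^ r) * (\<Sum>j<n. of_real (\<xi> j \<omega>) ^ (k - 1 - r)))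
         - of_nat k * (2 * (\<Sum>i<n. of_real (\<xi> i \<omega>) ^ (k - 1)))"
      by (simp only: right_diff_distrib mult.left_commute)
    moreover have "(\<Sum>r<k. S r \<omega> * S (k - 1 - r) \<omega>) =
       4 * (\<Sum>r<k. (\<Sum>i<n. of_real (\<xi> i \<omega>) ^ r) * (\<Sum>j<n. of_real (\<xi> j \<omega>) ^ (k - 1 - r)))"
      unfolding sum_distrib_left[of 4] S_def by (intro sum.cong refl) simp
    ultimately show ?thesis by (simp add: S_def)
  qed
  ultimately show ?thesis by (simp add: disc_def)
qed

text \<open>\<open>stein\<close> is applied along the vector field with components
  \<open>\<xi> i ^ k\<close>. Its divergence contributes \<open>k / 2 * S (k - 1)\<close>, which
  halves the diagonal term of the weight and so produces the coefficient in \<open>loop_rhs\<close>;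
  the variance 1/2 cancels the factor 2 of \<open>S\<close>.\<close>

theorem loop_equations_prodS:
  "loop_equations (of_nat (2 * n)) (\<lambda>ks. expectation (\<lambda>\<omega>. prodS ks \<omega> * of_real (disc \<omega>)))"
  unfolding loop_equations_def
proof (intro conjI allI)
  fix ks
  show "expectation (\<lambda>\<omega>. prodS (0 # ks) \<omega> * of_real (disc \<omega>))
      = of_nat (2 * n) * expectation (\<lambda>\<omega>. prodS ks \<omega> * of_real (disc \<omega>))"
    by (simp add: prodS_def S_def mult.assoc)
next
  fix k ks
  obtain D where D: "gder (\<lambda>\<omega>. of_real (disc \<omega>)) D"
    "\<And>k \<omega>. (\<Sum>i<n. of_real (\<xi> i \<omega>) ^ k * D i \<omega>)
        = (1 / 2 * (\<Sum>r<k. S r \<omega> * S (k - 1 - r) \<omega>) - of_nat k * S (k - 1) \<omega>) * of_real (disc \<omega>)"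
    using log_deriv_disc unfolding log_deriv_def by blast
  define F where "F \<omega> = prodS ks \<omega> * of_real (disc \<omega>)" for \<omega>
  define E where "E i \<omega> = dprodS ks i \<omega> * of_real (disc \<omega>) + prodS ks \<omega> * D i \<omega>" for i \<omega>
  have gF: "gder F E"
    unfolding F_def E_def by (rule gder_mult[OF gder_prodS D(1)])
  define g where "g i \<omega> = of_nat k * of_real (\<xi> i \<omega>) ^ (k - 1) * F \<omega> + of_real (\<xi> i \<omega>) ^ k * E i \<omega>" for i \<omega>
  have st: "integrable M (g i)"
    "integrable M (\<lambda>\<omega>. of_real (\<xi> i \<omega>) * (of_real (\<xi> i \<omega>) ^ k * F \<omega>))"
    "expectation (\<lambda>\<omega>. of_real (\<xi> i \<omega>) * (of_real (\<xi> i \<omega>) ^ k * F \<omega>)) = 1 / 2 * expectation (g i)"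
    if "i < n" for i
    using bspec[OF conjunct2[OF stein[OF gder_mult[OF gder_power[of i k] gF]]], of i] that
    by (simp_all add: g_def[abs_def])
  have rF: "integrable M (\<lambda>\<omega>. prodS ls \<omega> * of_real (disc \<omega>))" for ls
    by (rule gder_integrable[OF gder_mult[OF gder_prodS D(1)]])
  have "expectation (\<lambda>\<omega>. prodS (Suc k # ks) \<omega> * of_real (disc \<omega>))
      = expectation (\<lambda>\<omega>. \<Sum>i<n. 2 * (of_real (\<xi> i \<omega>) * (of_real (\<xi> i \<omega>) ^ k * F \<omega>)))"
  proof -
    have "prodS (Suc k # ks) \<omega> * of_real (disc \<omega>) = S (Suc k) \<omega> * F \<omega>" for \<omega>
      by (simp add: prodS_def F_def)
    then show ?thesis by (simp add: S_def sum_distrib_right sum_distrib_left mult.assoc)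
  qed
  also have "\<dots> = (\<Sum>i<n. expectation (g i))"
    by (subst Bochner_Integration.integral_sum) (auto simp: st)
  also have "\<dots> = expectation (\<lambda>\<omega>. \<Sum>i<n. g i \<omega>)"
    by (subst Bochner_Integration.integral_sum) (auto simp: st)
  also have "(\<lambda>\<omega>. \<Sum>i<n. g i \<omega>) = (\<lambda>\<omega>. loop_rhs (\<lambda>ks. prodS ks \<omega> * of_real (disc \<omega>)) k ks)"
  proof
    fix \<omega>
    have 1: "(\<Sum>i<n. of_nat k * of_real (\<xi> i \<omega>) ^ (k - 1) * F \<omega>) = 1 / 2 * of_nat k * S (k - 1) \<omega> * F \<omega>"
      by (simp add: S_def sum_distrib_left sum_distrib_right)
    have 2: "(\<Sum>i<n. of_real (\<xi> i \<omega>) ^ k * dprodS ks i \<omega>) =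
       (\<Sum>j<length ks. of_nat (ks ! j) * prodS ((k + ks ! j - 1) # take j ks @ drop (Suc j) ks) \<omega>)"
    proof -
      have "(\<Sum>i<n. of_real (\<xi> i \<omega>) ^ k * dprodS ks i \<omega>) =
        (\<Sum>j<length ks. (\<Sum>i<n. of_real (\<xi> i \<omega>) ^ k * dS (ks ! j) i \<omega>) * prodS (take j ks @ drop (Suc j) ks) \<omega>)"
        unfolding dprodS_def sum_distrib_left sum_distrib_right
        by (subst sum.swap) (simp add: ac_simps)
      moreover have "(\<Sum>i<n. of_real (\<xi> i \<omega>) ^ k * dS m i \<omega>) = of_nat m * S (k + m - 1) \<omega>" for m
        by (cases m) (auto simp: dS_def S_def sum_distrib_left power_add ac_simps intro!: sum.cong)
      ultimately show ?thesis by (simp add: prodS_def mult.assoc)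
    qed
    have "(\<Sum>i<n. g i \<omega>) = (\<Sum>i<n. of_nat k * of_real (\<xi> i \<omega>) ^ (k - 1) * F \<omega>)
       + (\<Sum>i<n. of_real (\<xi> i \<omega>) ^ k * dprodS ks i \<omega>) * of_real (disc \<omega>)
       + prodS ks \<omega> * (\<Sum>i<n. of_real (\<xi> i \<omega>) ^ k * D i \<omega>)"
      unfolding g_def E_def by (simp add: distrib_left sum.distrib sum_distrib_left sum_distrib_right ac_simps)
    also have "\<dots> = 1 / 2 * ((\<Sum>r<k. S r \<omega> * S (k - 1 - r) \<omega>) - of_nat k * S (k - 1) \<omega>) * F \<omega>
       + (\<Sum>j<length ks. of_nat (ks ! j) * prodS ((k + ks ! j - 1) # take j ks @ drop (Suc j) ks) \<omega>) * of_real (disc \<omega>)"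
      unfolding 1 2 D(2) unfolding F_def by (simp add: algebra_simps)
    finally show "(\<Sum>i<n. g i \<omega>) = loop_rhs (\<lambda>ks. prodS ks \<omega> * of_real (disc \<omega>)) k ks"
      unfolding loop_rhs_def
      by (simp add: F_def prodS_def sum_distrib_right sum_distrib_left left_diff_distrib mult.assoc)
  qed
  finally show "expectation (\<lambda>\<omega>. prodS (Suc k # ks) \<omega> * of_real (disc \<omega>)) =
      loop_rhs (\<lambda>ks. expectation (\<lambda>\<omega>. prodS ks \<omega> * of_real (disc \<omega>))) k ks"
    unfolding integral_loop_rhs[of M "\<lambda>ks \<omega>. prodS ks \<omega> * of_real (disc \<omega>)", OF rF] .
qed

end

section \<open>Permutation sums against a skew form\<close>

lemma sum_lessThan_double: "(\<Sum>r<2 * n. f r) = (\<Sum>i<n. f (2 * i) + f (2 * i + 1))"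
  for f :: "nat \<Rightarrow> 'a :: comm_monoid_add"
  by (induction n) (simp_all add: ac_simps)

lemma partner_neq: "partner a \<noteq> a"
  by (auto simp: partner_def elim!: oddE)

text \<open>The shape of the matrix of pairings of \<open>skew_poly\<close>, with a free scale
  \<open>w\<close> that later takes up the normalisation of the Gaussian law.\<close>

definition skew_form :: "real \<Rightarrow> nat \<Rightarrow> nat \<Rightarrow> real" where
  "skew_form w a b = (if b = partner a then if even a then w else - w else 0)"

text \<open>In a nonzero term the pairs \<open>(\<sigma> (2 i), \<sigma> (2 i + 1))\<close> with \<open>i \<noteq> j\<close> are blocks
  \<open>{2 l, 2 l + 1}\<close>, hence so is the remaining one; permuting the blocks and the elements of a block
  shows that its contribution depends only on the sign.\<close>

lemma skew_form_perm_sum: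
  fixes w :: real
  assumes j: "j < n"
  obtains \<kappa> where "\<And>B :: nat \<Rightarrow> nat \<Rightarrow> real.
    (\<Sum>\<sigma> | \<sigma> permutes {0..<2 * n}. signof \<sigma> *
       (\<Prod>i<n. if i = j then B (\<sigma> (2 * i)) (\<sigma> (2 * i + 1)) else skew_form w (\<sigma> (2 * i)) (\<sigma> (2 * i + 1))))
     = \<kappa> * (\<Sum>l<n. B (2 * l) (2 * l + 1) - B (2 * l + 1) (2 * l))"
proof
  define P where "P = {\<sigma>. \<sigma> permutes {0..<2 * n}}"
  have finP: "finite P" by (simp add: P_def finite_permutations)
  define Q where "Q \<sigma> = (\<Prod>i\<in>{..<n} - {j}. skew_form w (\<sigma> (2 * i)) (\<sigma> (2 * i + 1)))" for \<sigma>
  define T where "T \<sigma> = signof \<sigma> * Q \<sigma>" for \<sigma>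
  define R where "R a = {\<sigma> \<in> P. \<sigma> (2 * j) = a \<and> \<sigma> (2 * j + 1) = partner a}" for a
  define K where "K a = (\<Sum>\<sigma>\<in>R a. T \<sigma>)" for a
  have block: "\<sigma> (2 * j + 1) = partner (\<sigma> (2 * j))" if "\<sigma> \<in> P" "T \<sigma> \<noteq> 0" for \<sigma>
  proof -
    have perm: "\<sigma> permutes {0..<2 * n}" using that by (simp add: P_def)
    have nz: "\<sigma> (2 * i + 1) = partner (\<sigma> (2 * i))" if "i < n" "i \<noteq> j" for i
    proof (rule ccontr)
      assume "\<sigma> (2 * i + 1) \<noteq> partner (\<sigma> (2 * i))"
      then have "skew_form w (\<sigma> (2 * i)) (\<sigma> (2 * i + 1)) = 0" by (simp add: skew_form_def)
      then have "Q \<sigma> = 0" unfolding Q_def using that by (intro prod_zero) auto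
      then show False using \<open>T \<sigma> \<noteq> 0\<close> by (simp add: T_def)
    qed
    have nz': "\<sigma> (partner y) = partner (\<sigma> y)" if "y < 2 * n" "y div 2 \<noteq> j" for y
    proof (cases "even y")
      case True
      then obtain i where "y = 2 * i" by blast
      then show ?thesis using nz[of i] that by (simp add: partner_def)
    next
      case False
      then obtain i where i: "y = 2 * i + 1" by (rule oddE)
      then have "\<sigma> y = partner (\<sigma> (2 * i))" using nz[of i] that by simp
      moreover have "partner y = 2 * i" using i by (simp add: partner_def)
      ultimately show ?thesis by simp
    qed
    have "\<sigma> (2 * j) < 2 * n"
      using permutes_in_image[OF perm, of "2 * j"] j by simp
    then have "partner (\<sigma> (2 * j)) \<in> {0..<2 * n}" by (simp add: partner_less)
    then have "partner (\<sigma> (2 * j)) \<in> \<sigma> ` {0..<2 * n}"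
      unfolding permutes_image[OF perm] .
    \<comment> \<open>The preimage of the partner cannot lie in another pair, since then its own
      partner would also be sent to \<open>\<sigma> (2 * j)\<close>.\<close>
    then obtain y where y: "y < 2 * n" "\<sigma> y = partner (\<sigma> (2 * j))"
      by (elim imageE) auto
    have "y div 2 = j"
    proof (rule ccontr)
      assume "y div 2 \<noteq> j"
      then have "\<sigma> (partner y) = \<sigma> (2 * j)" using nz'[of y] y by simp
      then have "partner y = 2 * j" using permutes_inj[OF perm] by (simp add: inj_eq)
      then have "partner y div 2 = j" by simp
      then show False using \<open>y div 2 \<noteq> j\<close> eq_partner_iff[of "partner y" y] by simp
    qed
    moreover have "y \<noteq> 2 * j"
      using y(2) partner_neq[of "\<sigma> (2 * j)"] by metis
    ultimately have "y = 2 * j + 1" by presburger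
    then show ?thesis using y by simp
  qed
  have pr: "partner (2 * l) = 2 * l + 1" "partner (2 * l + 1) = 2 * l" for l
    by (simp_all add: partner_def)
  have K_odd: "K (2 * l + 1) = - K (2 * l)" for l
  proof -
    \<comment> \<open>Exchanging the two arguments of the j-th pair leaves \<open>Q\<close> alone
      and reverses the sign.\<close>
    let ?t = "Transposition.transpose (2 * j) (2 * j + 1)"
    have t: "?t permutes {0..<2 * n}" using j by (intro permutes_swap_id) auto
    have T: "T (\<sigma> \<circ> ?t) = - T \<sigma>" if "\<sigma> \<in> P" for \<sigma>
    proof -
      have "sign (\<sigma> \<circ> ?t) = - sign \<sigma>"
        using that t by (subst sign_compose)
          (auto simp: P_def permutation_permutes sign_swap_id intro: permutation_permutes[THEN iffD2])
      moreover have "Q (\<sigma> \<circ> ?t) = Q \<sigma>"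
        unfolding Q_def
      proof (intro prod.cong refl)
        fix i assume "i \<in> {..<n} - {j}"
        then have "2 * i \<noteq> 2 * j" "2 * i \<noteq> 2 * j + 1" "2 * i + 1 \<noteq> 2 * j" "2 * i + 1 \<noteq> 2 * j + 1"
          by (simp, presburger, presburger, simp)
        then show "skew_form w ((\<sigma> \<circ> ?t) (2 * i)) ((\<sigma> \<circ> ?t) (2 * i + 1)) = skew_form w (\<sigma> (2 * i)) (\<sigma> (2 * i + 1))"
          by (simp only: o_apply transpose_apply_other not_False_eq_True)
      qed
      ultimately show ?thesis by (simp add: T_def)
    qed
    have "K (2 * l + 1) = (\<Sum>\<sigma>\<in>R (2 * l). T (\<sigma> \<circ> ?t))"
      unfolding K_def
      by (rule sum.reindex_bij_witness[of _ "\<lambda>\<sigma>. \<sigma> \<circ> ?t" "\<lambda>\<sigma>. \<sigma> \<circ> ?t"])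
        (auto simp: R_def P_def pr pr[simplified] comp_assoc intro: permutes_compose[OF t[simplified]])
    also have "\<dots> = - K (2 * l)"
      unfolding K_def sum_negf[symmetric] by (intro sum.cong refl T) (simp add: R_def)
    finally show ?thesis .
  qed
  have K_even: "K (2 * l) = K 0" if "l < n" for l
  proof (cases "l = 0")
    case False
    let ?t = "Transposition.transpose 0 (2 * l) :: nat \<Rightarrow> nat" and ?u = "Transposition.transpose 1 (2 * l + 1) :: nat \<Rightarrow> nat"
    \<comment> \<open>\<open>d\<close> exchanges block 0 with block l. It is an even permutation,
      commutes with \<open>partner\<close> and preserves parity, so it preserves
      \<open>skew_form\<close>.\<close>
    define d where "d = ?t \<circ> ?u"
    have perm: "?t permutes {0..<2 * n}" "?u permutes {0..<2 * n}"
      using that False by (auto intro!: permutes_swap_id)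
    have d: "d permutes {0..<2 * n}" unfolding d_def by (rule permutes_compose[OF perm(2,1)])
    have ne: "2 * l \<noteq> 0" "2 * l \<noteq> 1" "2 * l + 1 \<noteq> 0" "2 * l + 1 \<noteq> 1" "2 * l \<noteq> 2 * l + 1"
      using False by (simp, presburger, simp, simp, simp)
    have dval: "d x = (if x = 0 then 2 * l else if x = 1 then 2 * l + 1 else if x = 2 * l then 0
        else if x = 2 * l + 1 then 1 else x)" for x
      using ne by (simp add: d_def Transposition.transpose_def)
    have dd: "d \<circ> d = id" using ne by (simp add: fun_eq_iff dval)
    have dp: "d (partner x) = partner (d x)" for x
    proof -
      consider "x = 0" | "x = 1" | "x = 2 * l" | "x = 2 * l + 1" | "x \<notin> {0, 1, 2 * l, 2 * l + 1}" by blast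
      then show ?thesis
      proof cases
        case 5
        have "partner x \<notin> {0, 1, 2 * l, 2 * l + 1}"
        proof
          assume "partner x \<in> {0, 1, 2 * l, 2 * l + 1}"
          then have "partner (partner x) \<in> {0, 1, 2 * l, 2 * l + 1}"
            by (auto simp: partner_def) presburger+
          then show False using 5 by simp
        qed
        then show ?thesis using 5 by (simp add: dval)
      qed (use ne in \<open>simp_all add: dval partner_def\<close>)
    qed
    have de: "even (d x) = even x" for x
      by (simp add: dval)
    have sgd: "sign d = 1"
      unfolding d_def using False perm
      by (subst sign_compose) (auto simp: sign_swap_id intro: permutation_permutes[THEN iffD2])
    have skew: "skew_form w (d a) (d b) = skew_form w a b" for a b
    proof -
      have "d b = partner (d a) \<longleftrightarrow> b = partner a"
        unfolding dp[symmetric] using permutes_inj[OF d] by (simp add: inj_eq)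
      then show ?thesis by (simp add: skew_form_def de)
    qed
    have T: "T (d \<circ> \<sigma>) = T \<sigma>" if "\<sigma> \<in> P" for \<sigma>
    proof -
      have "sign (d \<circ> \<sigma>) = sign \<sigma>"
        using that d by (subst sign_compose) (auto simp: P_def sgd intro: permutation_permutes[THEN iffD2])
      then show ?thesis by (simp add: T_def Q_def skew)
    qed
    have ddx: "d (d x) = x" for x using dd by (simp add: fun_eq_iff)
    have dx: "d x = y \<longleftrightarrow> x = d y" for x y using ddx by metis
    have "K (2 * l) = (\<Sum>\<sigma>\<in>R 0. T (d \<circ> \<sigma>))"
      unfolding K_def
    proof (rule sum.reindex_bij_witness[of _ "\<lambda>\<sigma>. d \<circ> \<sigma>" "\<lambda>\<sigma>. d \<circ> \<sigma>"])
      have d0: "d 0 = 2 * l" "d (2 * l) = 0" "d (partner 0) = partner (2 * l)" "d (partner (2 * l)) = partner 0"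
        by (simp_all add: dp) (simp_all add: dval)
      fix \<sigma>
      show "\<sigma> \<in> R (2 * l) \<Longrightarrow> d \<circ> \<sigma> \<in> R 0" "\<sigma> \<in> R 0 \<Longrightarrow> d \<circ> \<sigma> \<in> R (2 * l)"
        by (auto simp: R_def P_def d0 intro: permutes_compose[OF _ d])
      show "d \<circ> (d \<circ> \<sigma>) = \<sigma>" "d \<circ> (d \<circ> \<sigma>) = \<sigma>" "T (d \<circ> (d \<circ> \<sigma>)) = T \<sigma>"
        by (simp_all add: comp_assoc[symmetric] dd)
    qed
    also have "\<dots> = K 0"
      unfolding K_def by (intro sum.cong refl T) (simp add: R_def)
    finally show ?thesis .
  qed simp
  fix B :: "nat \<Rightarrow> nat \<Rightarrow> real"
  let ?F = "\<lambda>\<sigma>. \<Prod>i<n. if i = j then B (\<sigma> (2 * i)) (\<sigma> (2 * i + 1)) else skew_form w (\<sigma> (2 * i)) (\<sigma> (2 * i + 1))"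
  let ?B = "\<lambda>\<sigma>. B (\<sigma> (2 * j)) (\<sigma> (2 * j + 1))"
  have "(\<Sum>\<sigma>\<in>P. signof \<sigma> *
       ?F \<sigma>)
     = (\<Sum>\<sigma>\<in>P. T \<sigma> * ?B \<sigma>)"
  proof (intro sum.cong refl)
    fix \<sigma>
    have "?F \<sigma>
       = ?B \<sigma> * Q \<sigma>"
      using j unfolding Q_def by (subst prod.remove[of _ j]) (auto intro!: prod.cong)
    then show "signof \<sigma> * ?F \<sigma>
       = T \<sigma> * ?B \<sigma>"
      by (simp add: T_def)
  qed
  \<comment> \<open>Grouping by the value a of \<open>\<sigma> (2 * j)\<close>; by
    \<open>block\<close> the other entry of the pair is then determined.\<close>
  also have "\<dots> = (\<Sum>a<2 * n. \<Sum>\<sigma> | \<sigma> \<in> P \<and> \<sigma> (2 * j) = a. T \<sigma> * ?B \<sigma>)"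
  proof (rule sum.group[symmetric])
    show "(\<lambda>\<sigma>. \<sigma> (2 * j)) ` P \<subseteq> {..<2 * n}"
      using j permutes_in_image[of _ "{0..<2 * n}" "2 * j"] by (auto simp: P_def)
  qed (simp_all add: finP)
  also have "\<dots> = (\<Sum>a<2 * n. K a * B a (partner a))"
  proof (intro sum.cong refl)
    fix a
    have "(\<Sum>\<sigma> | \<sigma> \<in> P \<and> \<sigma> (2 * j) = a. T \<sigma> * ?B \<sigma>)
       = (\<Sum>\<sigma>\<in>R a. T \<sigma> * ?B \<sigma>)"
      using block finP by (intro sum.mono_neutral_right) (auto simp: R_def)
    also have "\<dots> = (\<Sum>\<sigma>\<in>R a. T \<sigma> * B a (partner a))"
      by (intro sum.cong refl) (auto simp: R_def)
    finally show "(\<Sum>\<sigma> | \<sigma> \<in> P \<and> \<sigma> (2 * j) = a. T \<sigma> * ?B \<sigma>) = K a * B a (partner a)"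
      by (simp add: K_def sum_distrib_right)
  qed
  also have "\<dots> = (\<Sum>l<n. K (2 * l) * B (2 * l) (2 * l + 1) + K (2 * l + 1) * B (2 * l + 1) (2 * l))"
    unfolding sum_lessThan_double pr ..
  also have "\<dots> = (\<Sum>l<n. K 0 * (B (2 * l) (2 * l + 1) - B (2 * l + 1) (2 * l)))"
  proof (intro sum.cong refl)
    fix l assume "l \<in> {..<n}"
    then show "K (2 * l) * B (2 * l) (2 * l + 1) + K (2 * l + 1) * B (2 * l + 1) (2 * l) =
      K 0 * (B (2 * l) (2 * l + 1) - B (2 * l + 1) (2 * l))"
      unfolding K_odd by (simp add: K_even right_diff_distrib)
  qed
  finally show "(\<Sum>\<sigma> | \<sigma> permutes {0..<2 * n}. signof \<sigma> *
       ?F \<sigma>)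
     = K 0 * (\<Sum>l<n. B (2 * l) (2 * l + 1) - B (2 * l + 1) (2 * l))"
    by (simp only: P_def sum_distrib_left)
qed

section \<open>Linear statistics of the eigenvalue density\<close>

definition gauss_law :: "real measure" where
  "gauss_law = density lborel (\<lambda>x. ennreal (normal_density 0 (1 / sqrt 2) x))"

lemma prob_space_gauss_law: "prob_space gauss_law"
  unfolding gauss_law_def by (rule prob_space_normal_density) simp

lemma sets_gauss_law [measurable_cong, simp]: "sets gauss_law = sets borel"
  by (simp add: gauss_law_def)

lemma space_gauss_law [simp]: "space gauss_law = UNIV"
  by (simp add: gauss_law_def)

lemma normal_density_gweight: "normal_density 0 (1 / sqrt 2) x = gweight x / sqrt pi"
  by (simp add: normal_density_def power_divide)

lemma borel_measurable_poly [measurable]: "poly P \<in> borel_measurable borel" for P :: "real poly"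
  by (intro borel_measurable_continuous_onI continuous_intros)

lemma gauss_law_poly:
  "integrable gauss_law (poly P)" "integral\<^sup>L gauss_law (poly P) = Re (gauss_int 0 P) / sqrt pi"
proof -
  have eq: "normal_density 0 (1 / sqrt 2) x *\<^sub>R poly P x = (1 / sqrt pi) * (poly P x * exp (0 * x - x\<^sup>2))" for x
    by (simp add: normal_density_gweight)
  show "integrable gauss_law (poly P)"
    unfolding gauss_law_def
    by (subst integrable_density) (auto simp only: eq intro!: integrable_mult_right integrable_poly_gaussian, auto)
  have "integral\<^sup>L gauss_law (poly P) = (\<integral>x. (1 / sqrt pi) * (poly P x * exp (0 * x - x\<^sup>2)) \<partial>lborel)"
    unfolding gauss_law_def eq[symmetric] by (subst integral_density) auto
  also have "\<dots> = Re (gauss_int 0 P) / sqrt pi"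
    by (subst integral_mult_right_zero) (simp add: gauss_int_at_0)
  finally show "integral\<^sup>L gauss_law (poly P) = Re (gauss_int 0 P) / sqrt pi" .
qed

lemma gauss_law_power: "(\<integral>x. x ^ k \<partial>gauss_law) = gauss_moment (1 / 2) k"
proof -
  have "(\<integral>x. x ^ k \<partial>gauss_law) = (\<integral>x. normal_density 0 (1 / sqrt 2) x * x ^ k \<partial>lborel)"
    unfolding gauss_law_def by (subst integral_density) auto
  also have "\<dots> = gauss_moment (1 / 2) k"
    using has_bochner_integral_integral_eq[OF normal_density_moment[of "1 / sqrt 2" k]] by (simp add: power_divide)
  finally show ?thesis .
qed

definition gauss_prod :: "nat \<Rightarrow> (nat \<Rightarrow> real) measure" where
  "gauss_prod n = PiM {..<n} (\<lambda>_. gauss_law)"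

interpretation gauss_law: prob_space gauss_law by (rule prob_space_gauss_law)

interpretation gauss_law_prod: product_sigma_finite "\<lambda>_ :: nat. gauss_law" ..

lemma gauss_prod_poly:
  "integrable (gauss_prod n) (\<lambda>x. \<Prod>i<n. poly (P i) (x i))"
  "(\<integral>x. (\<Prod>i<n. poly (P i) (x i)) \<partial>gauss_prod n) = (\<Prod>i<n. integral\<^sup>L gauss_law (poly (P i)))"
  unfolding gauss_prod_def
  by (rule gauss_law_prod.product_integrable_prod gauss_law_prod.product_integral_prod; simp add: gauss_law_poly)+

lemma beta4_ensemble_gauss_prod: "beta4_ensemble (gauss_prod n) n (\<lambda>i x. x i)"
proof -
  interpret prob_space "gauss_prod n"
    unfolding gauss_prod_def by (rule prob_space_PiM) (rule prob_space_gauss_law)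
  have pow: "(\<Prod>i<n. x i ^ e i) = (\<Prod>i<n. poly (monom 1 (e i)) (x i))" for x :: "nat \<Rightarrow> real" and e
    by (simp add: poly_monom)
  show ?thesis
    unfolding beta4_ensemble_def
  proof
    show "(\<lambda>x. x i) \<in> borel_measurable (gauss_prod n)" if "i \<in> {..<n}" for i
      using measurable_component_singleton[OF that, of "\<lambda>_. gauss_law"]
        measurable_cong_sets[OF refl sets_gauss_law, of "gauss_prod n"]
      unfolding gauss_prod_def by blast
    show "integrable (gauss_prod n) (\<lambda>x. \<Prod>i<n. x i ^ e i)" for e
      unfolding pow by (rule gauss_prod_poly)
    show "(\<integral>x. (\<Prod>i<n. x i ^ e i) \<partial>gauss_prod n) = (\<Prod>i<n. gauss_moment (1 / 2) (e i))" for e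
    proof -
      have "poly (monom 1 k) = (\<lambda>x :: real. x ^ k)" for k by (simp add: fun_eq_iff poly_monom)
      then show ?thesis unfolding pow gauss_prod_poly by (simp only: gauss_law_power)
    qed
  qed simp
qed

text \<open>The intervals are disjoint, so all coordinates differ in this box: it is a set of
  positive mass on which the Vandermonde weight has no zero.\<close>

lemma gauss_prod_positive_box:
  "emeasure (gauss_prod n) (\<Pi>\<^sub>E i\<in>{..<n}. {real i<..<real i + 1 / 2}) \<noteq> 0"
proof -
  have pos: "emeasure gauss_law {a<..<b} \<noteq> 0" if "a < b" for a b :: real
  proof
    assume "emeasure gauss_law {a<..<b} = 0"
    then have "{a<..<b} \<in> null_sets (density lborel (\<lambda>x. ennreal (normal_density 0 (1 / sqrt 2) x)))"
      by (auto simp: null_sets_def gauss_law_def)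
    then have "AE x in lborel. x \<in> {a<..<b} \<longrightarrow> ennreal (normal_density 0 (1 / sqrt 2) x) = 0"
      by (subst (asm) null_sets_density_iff) auto
    moreover have "ennreal (normal_density 0 (1 / sqrt 2) x) \<noteq> 0" for x
      using normal_density_pos[of "1 / sqrt 2" 0 x] by (simp add: ennreal_eq_0_iff not_le)
    ultimately have "AE x in lborel. x \<notin> {a<..<b}" by simp
    then have "emeasure lborel {x \<in> space lborel. x \<in> {a<..<b}} = 0"
      by (rule emeasure_eq_0_AE)
    moreover have "{x \<in> space lborel. x \<in> {a<..<b}} = {a<..<b}" by auto
    ultimately show False using that by (simp only: emeasure_lborel_Ioo less_imp_le) simp
  qed
  have "emeasure (gauss_prod n) (\<Pi>\<^sub>E i\<in>{..<n}. {real i<..<real i + 1 / 2})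
     = (\<Prod>i<n. emeasure gauss_law {real i<..<real i + 1 / 2})"
    unfolding gauss_prod_def by (rule gauss_law_prod.emeasure_PiM) auto
  then show ?thesis using pos by simp
qed

definition vandermonde_pow4 :: "nat \<Rightarrow> (nat \<Rightarrow> real) \<Rightarrow> real" where
  "vandermonde_pow4 n x = (\<Prod>i<n. \<Prod>j<i. x i - x j) ^ 4"

text \<open>The loop equations determine moments only up to the value on the empty list, and
  normalising that value divides by this integral.\<close>

lemma integral_vandermonde_pow4_nonzero: "integral\<^sup>L (gauss_prod n) (vandermonde_pow4 n) \<noteq> 0"
proof -
  interpret beta4_ensemble "gauss_prod n" n "\<lambda>i x. x i" by (rule beta4_ensemble_gauss_prod)
  have *: "integrable (gauss_prod n) (\<lambda>x. complex_of_real (disc x))"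
    using log_deriv_disc unfolding log_deriv_def by (blast intro: gder_integrable)
  then have int: "integrable (gauss_prod n) (\<lambda>x. disc x)" using integrable_Re[OF *] by simp
  moreover have d: "disc = vandermonde_pow4 n"
    by (simp add: fun_eq_iff disc_def vandermonde_pow4_def)
  ultimately have i: "integrable (gauss_prod n) (vandermonde_pow4 n)" by simp
  show ?thesis
  proof
    assume "integral\<^sup>L (gauss_prod n) (vandermonde_pow4 n) = 0"
    then have ae: "AE x in gauss_prod n. vandermonde_pow4 n x = 0"
      using integral_nonneg_eq_0_iff_AE[OF i] by (simp add: vandermonde_pow4_def)
    have nz: "vandermonde_pow4 n x \<noteq> 0" if "x \<in> (\<Pi>\<^sub>E i\<in>{..<n}. {real i<..<real i + 1 / 2})" for x
    proof -
      have "x i \<noteq> x j" if "i < n" "j < i" for i j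
      proof -
        have "real i < x i" "x j < real j + 1 / 2"
          using \<open>x \<in> _\<close> that by (force simp: PiE_iff)+
        moreover have "real j + 1 \<le> real i" using that by linarith
        ultimately show ?thesis by linarith
      qed
      then show ?thesis by (simp add: vandermonde_pow4_def prod_zero_iff)
    qed
    have "AE x in gauss_prod n. x \<notin> (\<Pi>\<^sub>E i\<in>{..<n}. {real i<..<real i + 1 / 2})"
      by (rule eventually_mono[OF ae]) (use nz in blast)
    then have "emeasure (gauss_prod n) {x \<in> space (gauss_prod n). x \<in> (\<Pi>\<^sub>E i\<in>{..<n}. {real i<..<real i + 1 / 2})} = 0"
      by (rule emeasure_eq_0_AE)
    moreover have "{x \<in> space (gauss_prod n). x \<in> (\<Pi>\<^sub>E i\<in>{..<n}. {real i<..<real i + 1 / 2})}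
        = (\<Pi>\<^sub>E i\<in>{..<n}. {real i<..<real i + 1 / 2})"
    proof -
      have "(\<Pi>\<^sub>E i\<in>{..<n}. {real i<..<real i + 1 / 2}) \<subseteq> space (gauss_prod n)"
        unfolding gauss_prod_def space_PiM by (rule PiE_mono) simp
      then show ?thesis by blast
    qed
    ultimately show False using gauss_prod_positive_box[of n] by simp
  qed
qed

definition confluent_mat :: "(nat \<Rightarrow> real poly) \<Rightarrow> nat \<Rightarrow> (nat \<Rightarrow> real) \<Rightarrow> real mat" where
  "confluent_mat p n x = mat (2 * n) (2 * n) (\<lambda>(r, c). if even r then poly (p c) (x (r div 2))
      else poly (pderiv (p c)) (x (r div 2)) - x (r div 2) * poly (p c) (x (r div 2)))"

text \<open>The determinant is a sum of products of functions of one variable each.\<close>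

lemma integral_det_confluent:
  assumes "j < n"
  shows "integrable (gauss_prod n) (\<lambda>x. poly f (x j) * det (confluent_mat p n x))"
    and "(\<integral>x. poly f (x j) * det (confluent_mat p n x) \<partial>gauss_prod n) =
      (\<Sum>\<sigma> | \<sigma> permutes {0..<2 * n}. signof \<sigma> * (\<Prod>i<n. integral\<^sup>L gauss_law
         (poly ((if i = j then f else 1) * (p (\<sigma> (2 * i)) * weighted_deriv (p (\<sigma> (2 * i + 1))))))))"
proof -
  define g where "g \<sigma> i = (if i = j then f else 1) * (p (\<sigma> (2 * i)) * weighted_deriv (p (\<sigma> (2 * i + 1))))" for \<sigma> i
  have "poly f (x j) * det (confluent_mat p n x) = (\<Sum>\<sigma> | \<sigma> permutes {0..<2 * n}. signof \<sigma> * (\<Prod>i<n. poly (g \<sigma> i) (x i)))" for x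
  proof -
    have c: "confluent_mat p n x \<in> carrier_mat (2 * n) (2 * n)" by (simp add: confluent_mat_def)
    have "poly f (x j) * (\<Prod>r = 0..<2 * n. confluent_mat p n x $$ (r, \<sigma> r)) = (\<Prod>i<n. poly (g \<sigma> i) (x i))"
      if "\<sigma> permutes {0..<2 * n}" for \<sigma>
    proof -
      have s: "\<sigma> r < 2 * n" if "r < 2 * n" for r
        using permutes_in_image[OF \<open>\<sigma> permutes _\<close>, of r] that by simp
      \<comment> \<open>Rows 2 i and 2 i + 1 depend on \<open>x i\<close> only, hence the grouping
        in pairs.\<close>
      have "(\<Prod>r = 0..<2 * n. confluent_mat p n x $$ (r, \<sigma> r)) =
        (\<Prod>i<n. confluent_mat p n x $$ (2 * i, \<sigma> (2 * i)) * confluent_mat p n x $$ (2 * i + 1, \<sigma> (2 * i + 1)))"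
        unfolding atLeast0LessThan by (rule prod_lessThan_double)
      also have "\<dots> = (\<Prod>i<n. poly (p (\<sigma> (2 * i)) * weighted_deriv (p (\<sigma> (2 * i + 1)))) (x i))"
        using s by (intro prod.cong refl) (simp add: confluent_mat_def poly_weighted_deriv)
      finally show ?thesis
        using assms by (simp add: g_def prod.distrib poly_mult if_distrib[of poly] if_distribR prod.delta
            if_distrib[of "\<lambda>P. poly P _"] cong: if_cong)
    qed
    then show ?thesis
      unfolding det_def'[OF c] sum_distrib_left
      by (intro sum.cong refl) (simp add: mult.left_commute)
  qed
  then show "integrable (gauss_prod n) (\<lambda>x. poly f (x j) * det (confluent_mat p n x))"
    and "(\<integral>x. poly f (x j) * det (confluent_mat p n x) \<partial>gauss_prod n) =
      (\<Sum>\<sigma> | \<sigma> permutes {0..<2 * n}. signof \<sigma> * (\<Prod>i<n. integral\<^sup>L gauss_law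
         (poly ((if i = j then f else 1) * (p (\<sigma> (2 * i)) * weighted_deriv (p (\<sigma> (2 * i + 1))))))))"
    unfolding g_def[symmetric]
    by (simp_all only: Bochner_Integration.integrable_sum Bochner_Integration.integral_sum
        integrable_mult_right integral_mult_right_zero gauss_prod_poly)
qed

text \<open>For each j the integral is a constant times the skew kernel integrated against f. The
  factor 1/2 reflects that \<open>gse_density\<close> has mass 2 n for n variables.\<close>

lemma integral_linear_statistic:
  assumes "n \<ge> 1"
  shows "(\<integral>x. (\<Sum>j<n. poly f (x j)) * vandermonde_pow4 n x \<partial>gauss_prod n) =
    integral\<^sup>L (gauss_prod n) (vandermonde_pow4 n) * (1 / 2 * Re (gauss_int 0 (f * gse_density n)))"
proof -
  define w where "w = 1 / 2 / sqrt pi"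
  define L where "L = (\<Prod>c<2 * n. coeff (skew_poly c) c)"
  define Z where "Z = integral\<^sup>L (gauss_prod n) (vandermonde_pow4 n)"
  define B where "B f a b = integral\<^sup>L gauss_law (poly (f * (skew_poly a * weighted_deriv (skew_poly b))))" for f a b
  have L: "L \<noteq> 0" by (simp add: L_def prod_zero_iff coeff_skew_poly)
  have det: "det (confluent_mat skew_poly n x) = L * vandermonde_pow4 n x" for x
    unfolding confluent_mat_def L_def vandermonde_pow4_def by (rule det_confluent) (rule degree_skew_poly)
  have B1: "B 1 a b = skew_form w a b" for a b
    using skew_pairing_skew_poly[of a b]
    by (simp add: B_def gauss_law_poly skew_pairing_def skew_form_def partner_def w_def)
  \<comment> \<open>The order of the quantifiers matters: the constant must be the same for all f,
    so that it can be read off at f = 1.\<close>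
  have "\<exists>k. \<forall>f. (\<integral>x. poly f (x j) * det (confluent_mat skew_poly n x) \<partial>gauss_prod n)
      = k * (\<Sum>l<n. B f (2 * l) (2 * l + 1) - B f (2 * l + 1) (2 * l))" if jn: "j < n" for j
  proof -
    obtain k where k: "\<And>B :: nat \<Rightarrow> nat \<Rightarrow> real.
      (\<Sum>\<sigma> | \<sigma> permutes {0..<2 * n}. signof \<sigma> *
       (\<Prod>i<n. if i = j then B (\<sigma> (2 * i)) (\<sigma> (2 * i + 1)) else skew_form w (\<sigma> (2 * i)) (\<sigma> (2 * i + 1))))
      = k * (\<Sum>l<n. B (2 * l) (2 * l + 1) - B (2 * l + 1) (2 * l))"
      by (rule skew_form_perm_sum[OF jn, of w], rule that)
    have "integral\<^sup>L gauss_law (poly ((if i = j then f else 1) * (skew_poly a * weighted_deriv (skew_poly b))))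
        = (if i = j then B f a b else skew_form w a b)" for f i a b
      by (simp add: B1[symmetric]) (simp add: B_def)
    then show ?thesis
      unfolding integral_det_confluent(2)[OF jn] by (simp only:) (use k in blast)
  qed
  then have "\<forall>j\<in>{..<n}. \<exists>k. \<forall>f. (\<integral>x. poly f (x j) * det (confluent_mat skew_poly n x) \<partial>gauss_prod n)
      = k * (\<Sum>l<n. B f (2 * l) (2 * l + 1) - B f (2 * l + 1) (2 * l))" by simp
  from bchoice[OF this] obtain k where
    "\<forall>j\<in>{..<n}. \<forall>f. (\<integral>x. poly f (x j) * det (confluent_mat skew_poly n x) \<partial>gauss_prod n)
      = k j * (\<Sum>l<n. B f (2 * l) (2 * l + 1) - B f (2 * l + 1) (2 * l))" ..
  then have k: "(\<integral>x. poly f (x j) * det (confluent_mat skew_poly n x) \<partial>gauss_prod n)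
      = k j * (\<Sum>l<n. B f (2 * l) (2 * l + 1) - B f (2 * l + 1) (2 * l))" if "j < n" for j f
    using that by simp
  have Bsum: "(\<Sum>l<n. B f (2 * l) (2 * l + 1) - B f (2 * l + 1) (2 * l)) = 1 / 2 * Re (gauss_int 0 (f * gse_density n)) / sqrt pi" for f
  proof -
    have "(\<Sum>l<n. B f (2 * l) (2 * l + 1) - B f (2 * l + 1) (2 * l)) =
      Re (gauss_int 0 (f * (\<Sum>l<n. skew_poly (2 * l) * weighted_deriv (skew_poly (2 * l + 1)) - skew_poly (2 * l + 1) * weighted_deriv (skew_poly (2 * l))))) / sqrt pi"
      unfolding B_def gauss_law_poly sum_distrib_left right_diff_distrib gauss_int_sum gauss_int_diff Re_sum minus_complex.sel
        sum_divide_distrib diff_divide_distrib ..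
    then show ?thesis
      unfolding gse_density_skew by (simp add: gauss_int_smult)
  qed
  have B1sum: "(\<Sum>l<n. B 1 (2 * l) (2 * l + 1) - B 1 (2 * l + 1) (2 * l)) = real n / sqrt pi"
    unfolding B1 by (simp add: skew_form_def partner_def w_def)
  have kj: "k j = L * Z * sqrt pi / real n" if "j < n" for j
  proof -
    have "L * Z = k j * (real n / sqrt pi)"
      using k[OF that, of 1] unfolding B1sum det Z_def by simp
    then show ?thesis using assms by (simp add: field_simps)
  qed
  have int: "integrable (gauss_prod n) (\<lambda>x. poly f (x j) * vandermonde_pow4 n x)" if "j < n" for j
    using integral_det_confluent(1)[OF that, of f skew_poly] L unfolding det by (simp add: mult.left_commute)
  have each: "(\<integral>x. poly f (x j) * vandermonde_pow4 n x \<partial>gauss_prod n) = Z / real n * (1 / 2 * Re (gauss_int 0 (f * gse_density n)))"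
    if "j < n" for j
  proof -
    have "L * (\<integral>x. poly f (x j) * vandermonde_pow4 n x \<partial>gauss_prod n) = k j * (1 / 2 * Re (gauss_int 0 (f * gse_density n)) / sqrt pi)"
      using k[OF that, of f] unfolding Bsum det by (simp add: mult.left_commute)
    also have "\<dots> = L * (Z / real n * (1 / 2 * Re (gauss_int 0 (f * gse_density n))))"
      unfolding kj[OF that] by simp
    finally show ?thesis unfolding mult_left_cancel[OF L] .
  qed
  have "(\<integral>x. (\<Sum>j<n. poly f (x j)) * vandermonde_pow4 n x \<partial>gauss_prod n) = (\<Sum>j<n. \<integral>x. poly f (x j) * vandermonde_pow4 n x \<partial>gauss_prod n)"
    unfolding sum_distrib_right by (rule Bochner_Integration.integral_sum) (simp add: int)
  then show ?thesis using assms by (simp add: each Z_def)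
qed

text \<open>Both models solve the same loop equations. Division by \<open>Z\<close> makes them agree
  on the empty list, and uniqueness is then used for the list \<open>[k]\<close>.\<close>

theorem (in gse_coords) expectation_trace_power:
  assumes "n \<ge> 1"
  shows "expectation (T k) = gauss_int 0 (monom 1 k * gse_density n)"
proof -
  interpret E: beta4_ensemble "gauss_prod n" n "\<lambda>i x. x i" by (rule beta4_ensemble_gauss_prod)
  define Z where "Z = complex_of_real (integral\<^sup>L (gauss_prod n) (vandermonde_pow4 n))"
  have Z: "Z \<noteq> 0" using integral_vandermonde_pow4_nonzero by (simp add: Z_def)
  have d: "E.disc = vandermonde_pow4 n" by (simp add: fun_eq_iff E.disc_def vandermonde_pow4_def)
  have "expectation (prodT [k]) = 1 / Z * (\<integral>x. E.prodS [k] x * of_real (E.disc x) \<partial>gauss_prod n)"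
  proof (rule loop_equations_unique[OF loop_equations_prodT loop_equations_scale[OF E.loop_equations_prodS]])
    show "expectation (prodT []) = 1 / Z * (\<integral>x. E.prodS [] x * of_real (E.disc x) \<partial>gauss_prod n)"
      using Z by (simp add: prodT_def[abs_def] E.prodS_def d Z_def prob_space)
  qed
  also have "(\<integral>x. E.prodS [k] x * of_real (E.disc x) \<partial>gauss_prod n)
      = of_real (2 * (\<integral>x. (\<Sum>j<n. poly (monom 1 k) (x j)) * vandermonde_pow4 n x \<partial>gauss_prod n))"
    unfolding integral_mult_right_zero[symmetric] integral_complex_of_real[symmetric]
    by (simp add: E.prodS_def E.S_def d poly_monom mult.assoc)
  also have "1 / Z * \<dots> = of_real (Re (gauss_int 0 (monom 1 k * gse_density n)))"
    unfolding integral_linear_statistic[OF assms] using Z by (simp add: Z_def)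
  also have "\<dots> = gauss_int 0 (monom 1 k * gse_density n)"
    unfolding gauss_int_at_0 by simp
  finally show ?thesis by (simp add: prodT_def[abs_def])
qed

section \<open>The Gaussian coordinates of a GSE matrix\<close>

lemma integral_mult_prod:
  fixes f :: "'a \<Rightarrow> real" and g :: "'b \<Rightarrow> real"
  assumes "sigma_finite_measure M1" "sigma_finite_measure M2" "integrable M1 f" "integrable M2 g"
  shows "integrable (M1 \<Otimes>\<^sub>M M2) (\<lambda>(x, y). f x * g y)"
    and "(\<integral>(x, y). f x * g y \<partial>(M1 \<Otimes>\<^sub>M M2)) = integral\<^sup>L M1 f * integral\<^sup>L M2 g"
proof -
  interpret M1: sigma_finite_measure M1 by fact
  interpret M2: sigma_finite_measure M2 by fact
  interpret pair_sigma_finite M1 M2 ..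
  note [measurable] = borel_measurable_integrable[OF assms(3)] borel_measurable_integrable[OF assms(4)]
  show i: "integrable (M1 \<Otimes>\<^sub>M M2) (\<lambda>(x, y). f x * g y)"
  proof (rule Fubini_integrable)
    show "(\<lambda>(x, y). f x * g y) \<in> borel_measurable (M1 \<Otimes>\<^sub>M M2)" by measurable
    have "(\<lambda>x. \<integral>y. norm (case (x, y) of (x, y) \<Rightarrow> f x * g y) \<partial>M2) = (\<lambda>x. \<bar>f x\<bar> * (\<integral>y. \<bar>g y\<bar> \<partial>M2))"
      by (simp add: abs_mult)
    then show "integrable M1 (\<lambda>x. \<integral>y. norm (case (x, y) of (x, y) \<Rightarrow> f x * g y) \<partial>M2)"
      using assms(3) by simp
    show "AE x in M1. integrable M2 (\<lambda>y. case (x, y) of (x, y) \<Rightarrow> f x * g y)"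
      using assms(4) by simp
  qed
  show "(\<integral>(x, y). f x * g y \<partial>(M1 \<Otimes>\<^sub>M M2)) = integral\<^sup>L M1 f * integral\<^sup>L M2 g"
    using integral_fst'[OF i] by simp
qed

lemmas integral_mult_lborel = integral_mult_prod[OF sigma_finite_lborel sigma_finite_lborel, unfolded lborel_prod]

text \<open>The joint density is a product, so the nested pairs are integrated out one component at
  a time, from the inside.\<close>

lemma quat_gaussian_integral:
  fixes g0 g1 g2 g3 :: "real \<Rightarrow> real"
  assumes X: "quat_gaussian M X v" and v: "v > 0"
    and meas: "g0 \<in> borel_measurable borel" "g1 \<in> borel_measurable borel" "g2 \<in> borel_measurable borel" "g3 \<in> borel_measurable borel"
    and int: "\<And>g. g \<in> {g0, g1, g2, g3} \<Longrightarrow> integrable lborel (\<lambda>x. normal_density 0 (sqrt v) x * g x)"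
  shows "integrable M (\<lambda>\<omega>. case X \<omega> of (a, b, c, d) \<Rightarrow> g0 a * g1 b * g2 c * g3 d)"
    and "(\<integral>\<omega>. (case X \<omega> of (a, b, c, d) \<Rightarrow> g0 a * g1 b * g2 c * g3 d) \<partial>M) =
      (\<integral>x. normal_density 0 (sqrt v) x * g0 x \<partial>lborel) * (\<integral>x. normal_density 0 (sqrt v) x * g1 x \<partial>lborel) *
      (\<integral>x. normal_density 0 (sqrt v) x * g2 x \<partial>lborel) * (\<integral>x. normal_density 0 (sqrt v) x * g3 x \<partial>lborel)"
proof -
  let ?N = "normal_density 0 (sqrt v)"
  define f where "f q = (case q of (a, b, c, d) \<Rightarrow> ?N a * ?N b * ?N c * ?N d)" for q :: quat
  define g where "g q = (case q of (a, b, c, d) \<Rightarrow> g0 a * g1 b * g2 c * g3 d)" for q :: quat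
  have D: "distributed M lborel X (\<lambda>q. ennreal (f q))"
  proof -
    have "(\<lambda>q. ennreal (f q)) = (\<lambda>(a, b, c, d). ennreal (?N a * ?N b * ?N c * ?N d))"
      by (auto simp: f_def fun_eq_iff)
    then show ?thesis using X unfolding quat_gaussian_def by simp
  qed
  note [measurable] = meas
  have gm: "g \<in> borel_measurable lborel"
    unfolding g_def by (simp add: borel_prod[symmetric])
  have f0: "0 \<le> f q" for q by (auto simp: f_def split: prod.split)
  have fg: "f q * g q = (case q of (a, r) \<Rightarrow> (?N a * g0 a) * (case r of (b, r') \<Rightarrow> (?N b * g1 b) *
      (case r' of (c, d) \<Rightarrow> (?N c * g2 c) * (?N d * g3 d))))" for q
    by (auto simp: f_def g_def split: prod.split)
  note i3 = integral_mult_lborel[OF int[of g2] int[of g3], simplified]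
  note i2 = integral_mult_lborel[OF int[of g1] i3(1), simplified]
  note i1 = integral_mult_lborel[OF int[of g0] i2(1), simplified]
  have "integrable lborel (\<lambda>q. f q * g q)" unfolding fg using i1(1) .
  then have "integrable M (\<lambda>\<omega>. g (X \<omega>))"
    using distributed_integrable[OF D gm f0] by simp
  then show "integrable M (\<lambda>\<omega>. case X \<omega> of (a, b, c, d) \<Rightarrow> g0 a * g1 b * g2 c * g3 d)"
    by (simp add: g_def)
  have "(\<integral>\<omega>. g (X \<omega>) \<partial>M) = (\<integral>q. f q * g q \<partial>lborel)"
    using distributed_integral[OF D gm f0] by simp
  then show "(\<integral>\<omega>. (case X \<omega> of (a, b, c, d) \<Rightarrow> g0 a * g1 b * g2 c * g3 d) \<partial>M) =
      (\<integral>x. ?N x * g0 x \<partial>lborel) * (\<integral>x. ?N x * g1 x \<partial>lborel) * (\<integral>x. ?N x * g2 x \<partial>lborel) * (\<integral>x. ?N x * g3 x \<partial>lborel)"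
    unfolding fg i1(2) i2(2) i3(2) by (simp add: g_def)
qed

lemma integrable_normal_density_exp:
  assumes "\<sigma> > 0"
  shows "integrable lborel (\<lambda>x. normal_density 0 \<sigma> x * exp (c * \<bar>x\<bar>))"
proof -
  have e: "normal_density 0 \<sigma> x * exp (a * x) = exp (a\<^sup>2 * \<sigma>\<^sup>2 / 2) * normal_density (a * \<sigma>\<^sup>2) \<sigma> x" for a x
  proof -
    have "- (x\<^sup>2) / (2 * \<sigma>\<^sup>2) + a * x = a\<^sup>2 * \<sigma>\<^sup>2 / 2 + - ((x - a * \<sigma>\<^sup>2)\<^sup>2) / (2 * \<sigma>\<^sup>2)"
      using assms by (simp add: field_simps power2_eq_square)
    then have "exp (- (x\<^sup>2) / (2 * \<sigma>\<^sup>2)) * exp (a * x) = exp (a\<^sup>2 * \<sigma>\<^sup>2 / 2) * exp (- ((x - a * \<sigma>\<^sup>2)\<^sup>2) / (2 * \<sigma>\<^sup>2))"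
      by (simp only: exp_add[symmetric])
    then show ?thesis by (simp add: normal_density_def)
  qed
  have i: "integrable lborel (\<lambda>x. normal_density 0 \<sigma> x * exp (a * x))" for a
    unfolding e by (intro integrable_mult_right integrable_normal_density assms)
  show ?thesis
  proof (rule Bochner_Integration.integrable_bound[OF Bochner_Integration.integrable_add[OF i[of c] i[of "- c"]]])
    show "AE x in lborel. norm (normal_density 0 \<sigma> x * exp (c * \<bar>x\<bar>))
        \<le> norm (normal_density 0 \<sigma> x * exp (c * x) + normal_density 0 \<sigma> x * exp (- c * x))"
    proof (rule AE_I2)
      fix x
      have n: "0 \<le> normal_density 0 \<sigma> x" by simp
      have "exp (c * \<bar>x\<bar>) \<le> exp (c * x) + exp (- c * x)"
        by (cases "x \<ge> 0") (auto simp: abs_if)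
      then have "normal_density 0 \<sigma> x * exp (c * \<bar>x\<bar>) \<le> normal_density 0 \<sigma> x * (exp (c * x) + exp (- c * x))"
        by (rule mult_left_mono) (rule n)
      then show "norm (normal_density 0 \<sigma> x * exp (c * \<bar>x\<bar>))
        \<le> norm (normal_density 0 \<sigma> x * exp (c * x) + normal_density 0 \<sigma> x * exp (- c * x))"
        using n by (simp add: distrib_left)
    qed
  qed simp
qed

definition quat_comp :: "nat \<Rightarrow> quat \<Rightarrow> real" where
  "quat_comp k = (\<lambda>(a, b, c, d). if k = 0 then a else if k = 1 then b else if k = 2 then c else d)"

lemma quat_comp_measurable [measurable]: "quat_comp k \<in> borel_measurable borel"
  unfolding quat_comp_def by (simp add: borel_prod[symmetric])

definition gse_coord :: "real \<Rightarrow> ('w \<Rightarrow> quat mat) \<Rightarrow> nat \<times> nat \<times> nat \<Rightarrow> 'w \<Rightarrow> real" where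
  "gse_coord \<sigma> A = (\<lambda>(i, j, c) \<omega>. quat_comp c (A \<omega> $$ (i, j)) / (\<sigma> * sqrt 2))"

lemma prod_lessThan_4: "(\<Prod>c<4. f c) = f 0 * f 1 * f 2 * f (3 :: nat)" for f :: "nat \<Rightarrow> 'a :: comm_monoid_mult"
  by (simp add: lessThan_nat_numeral lessThan_Suc numeral_3_eq_3 numeral_2_eq_2 ac_simps)

context
  fixes M :: "'w measure" and n :: nat and \<sigma> :: real and A
  assumes GSE: "GSE M n \<sigma> A" and \<sigma>: "\<sigma> > 0"
begin

interpretation prob_space M using GSE by (simp add: GSE_def)

lemma A_measurable: "i \<le> j \<Longrightarrow> j < n \<Longrightarrow> (\<lambda>\<omega>. A \<omega> $$ (i, j)) \<in> borel_measurable M"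
  using GSE by (auto simp: GSE_def indep_vars_def)

lemma diag_integral:
  fixes g :: "real \<Rightarrow> real"
  assumes "i < n" "g \<in> borel_measurable borel" "integrable lborel (\<lambda>x. normal_density 0 \<sigma> x * g x)"
  shows "integrable M (\<lambda>\<omega>. g (quat_comp 0 (A \<omega> $$ (i, i))))"
    and "expectation (\<lambda>\<omega>. g (quat_comp 0 (A \<omega> $$ (i, i)))) = (\<integral>x. normal_density 0 \<sigma> x * g x \<partial>lborel)"
proof -
  have D: "distributed M lborel (\<lambda>\<omega>. fst (A \<omega> $$ (i, i))) (\<lambda>x. ennreal (normal_density 0 \<sigma> x))"
    using GSE assms(1) by (simp add: GSE_def)
  have f: "quat_comp 0 q = fst q" for q by (cases q) (simp add: quat_comp_def)
  show "integrable M (\<lambda>\<omega>. g (quat_comp 0 (A \<omega> $$ (i, i))))"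
    using distributed_integrable[OF D, of g] assms by (simp add: f)
  show "expectation (\<lambda>\<omega>. g (quat_comp 0 (A \<omega> $$ (i, i)))) = (\<integral>x. normal_density 0 \<sigma> x * g x \<partial>lborel)"
    using distributed_integral[OF D, of g] assms by (simp add: f)
qed

lemma offdiag_integral:
  fixes g :: "nat \<Rightarrow> real \<Rightarrow> real"
  assumes "i < j" "j < n" "\<And>c. g c \<in> borel_measurable borel"
    "\<And>c. integrable lborel (\<lambda>x. normal_density 0 (\<sigma> / sqrt 2) x * g c x)"
  shows "integrable M (\<lambda>\<omega>. \<Prod>c<4. g c (quat_comp c (A \<omega> $$ (i, j))))"
    and "expectation (\<lambda>\<omega>. \<Prod>c<4. g c (quat_comp c (A \<omega> $$ (i, j))))
      = (\<Prod>c<4. \<integral>x. normal_density 0 (\<sigma> / sqrt 2) x * g c x \<partial>lborel)"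
proof -
  have Q: "quat_gaussian M (\<lambda>\<omega>. A \<omega> $$ (i, j)) (\<sigma>\<^sup>2 / 2)"
    using GSE assms(1,2) by (simp add: GSE_def)
  have v: "sqrt (\<sigma>\<^sup>2 / 2) = \<sigma> / sqrt 2" using \<sigma> by (simp add: real_sqrt_divide)
  have p: "(\<Prod>c<4. g c (quat_comp c q)) = (case q of (a, b, c, d) \<Rightarrow> g 0 a * g 1 b * g 2 c * g 3 d)" for q
    by (cases q) (simp add: prod_lessThan_4 quat_comp_def)
  have "0 < \<sigma>\<^sup>2 / 2" using \<sigma> by simp
  note I = quat_gaussian_integral[OF Q this assms(3,3,3,3), of 0 1 2 3, unfolded v]
  show "integrable M (\<lambda>\<omega>. \<Prod>c<4. g c (quat_comp c (A \<omega> $$ (i, j))))"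
    unfolding p by (rule I(1)) (use assms(4) in auto)
  show "expectation (\<lambda>\<omega>. \<Prod>c<4. g c (quat_comp c (A \<omega> $$ (i, j))))
      = (\<Prod>c<4. \<integral>x. normal_density 0 (\<sigma> / sqrt 2) x * g c x \<partial>lborel)"
    unfolding p prod_lessThan_4 by (rule I(2)) (use assms(4) in auto)
qed

lemma normal_density_scaled_moment:
  assumes "\<tau> > 0"
  shows "integrable lborel (\<lambda>x. normal_density 0 \<tau> x * (x / (\<sigma> * sqrt 2)) ^ k)"
    and "(\<integral>x. normal_density 0 \<tau> x * (x / (\<sigma> * sqrt 2)) ^ k \<partial>lborel) = gauss_moment ((1 / (\<sigma> * sqrt 2))\<^sup>2 * \<tau>\<^sup>2) k"
proof -
  have e: "normal_density 0 \<tau> x * (x / (\<sigma> * sqrt 2)) ^ k = (1 / (\<sigma> * sqrt 2)) ^ k * (normal_density 0 \<tau> x * x ^ k)" for x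
    by (simp add: power_divide)
  note h = normal_density_moment[OF assms, of k]
  show "integrable lborel (\<lambda>x. normal_density 0 \<tau> x * (x / (\<sigma> * sqrt 2)) ^ k)"
    unfolding e by (intro integrable_mult_right) (rule integrable.intros[OF h])
  show "(\<integral>x. normal_density 0 \<tau> x * (x / (\<sigma> * sqrt 2)) ^ k \<partial>lborel) = gauss_moment ((1 / (\<sigma> * sqrt 2))\<^sup>2 * \<tau>\<^sup>2) k"
    unfolding e integral_mult_right_zero has_bochner_integral_integral_eq[OF h] by (rule gauss_moment_scale)
qed

text \<open>Independence is given between matrix entries, but the monomials run over real
  components. The product is therefore grouped by entries: independence separates the entries, and
  the joint density of a quaternion separates its components.\<close>

lemma gse_coords_gse_coord: "gse_coords M n (gse_coord \<sigma> A)"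
proof -
  define J where "J = (SIGMA i:{..<n}. {i..<n})"
  define C where "C ij = (if fst ij = snd ij then {0} else {..<4 :: nat})" for ij :: "nat \<times> nat"
  define g where "g e ij q = (\<Prod>c\<in>C ij. (quat_comp c q / (\<sigma> * sqrt 2)) ^ e (fst ij, snd ij, c))"
    for e :: "nat \<times> nat \<times> nat \<Rightarrow> nat" and ij q
  define m where "m e ij = (\<Prod>c\<in>C ij. gauss_moment (gse_var (fst ij, snd ij, c)) (e (fst ij, snd ij, c)))"
    for e :: "nat \<times> nat \<times> nat \<Rightarrow> nat" and ij
  have finJ: "finite J" by (auto simp: J_def)
  have prodJ: "(\<Prod>\<alpha>\<in>gse_index n. F \<alpha>) = (\<Prod>ij\<in>J. \<Prod>c\<in>C ij. F (fst ij, snd ij, c))" for F :: "_ \<Rightarrow> real"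
  proof -
    have "(\<Prod>ij\<in>J. \<Prod>c\<in>C ij. F (fst ij, snd ij, c)) = (\<Prod>(ij, c)\<in>Sigma J C. F (fst ij, snd ij, c))"
      by (rule prod.Sigma[OF finJ]) (simp add: C_def)
    also have "\<dots> = (\<Prod>\<alpha>\<in>gse_index n. F \<alpha>)"
      by (rule prod.reindex_bij_witness[of _ "\<lambda>(i, j, c). ((i, j), c)" "\<lambda>((i, j), c). (i, j, c)"])
        (auto simp: J_def C_def split: if_split_asm)
    finally show ?thesis by simp
  qed
  have X: "indep_vars (\<lambda>_. borel) (\<lambda>ij \<omega>. A \<omega> $$ ij) J"
  proof -
    have "J = {(i, j). i \<le> j \<and> j < n}" by (auto simp: J_def)
    then show ?thesis using GSE by (simp add: GSE_def)
  qed
  have gm: "g e ij \<in> borel_measurable borel" for e ij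
    unfolding g_def by measurable
  have ind: "indep_vars (\<lambda>_. borel) (\<lambda>ij \<omega>. g e ij (A \<omega> $$ ij)) J" for e
    by (rule indep_vars_compose2[OF X]) (rule gm)
  have entry: "integrable M (\<lambda>\<omega>. g e ij (A \<omega> $$ ij)) \<and> expectation (\<lambda>\<omega>. g e ij (A \<omega> $$ ij)) = m e ij"
    if "ij \<in> J" for e ij
  proof (cases "fst ij = snd ij")
    case True
    then obtain i where ij: "ij = (i, i)" by (cases ij) auto
    then have i: "i < n" using that by (auto simp: J_def)
    have sv: "(1 / (\<sigma> * sqrt 2))\<^sup>2 * \<sigma>\<^sup>2 = 1 / 2" using \<sigma> by (simp add: power_mult_distrib power_divide)
    then show ?thesis
      using diag_integral[OF i, of "\<lambda>x. (x / (\<sigma> * sqrt 2)) ^ e (i, i, 0)"] normal_density_scaled_moment[OF \<sigma>, of "e (i, i, 0)", unfolded sv]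
      by (simp add: ij g_def m_def C_def gse_var_def)
  next
    case False
    then obtain i j where ij: "ij = (i, j)" "i \<noteq> j" by (cases ij) auto
    then have i: "i < j" "j < n" using that by (auto simp: J_def)
    have t: "\<sigma> / sqrt 2 > 0" using \<sigma> by simp
    have sv: "(1 / (\<sigma> * sqrt 2))\<^sup>2 * (\<sigma> / sqrt 2)\<^sup>2 = 1 / 4" using \<sigma> by (simp add: power_mult_distrib power_divide)
    then show ?thesis
      using offdiag_integral[OF i, of "\<lambda>c x. (x / (\<sigma> * sqrt 2)) ^ e (i, j, c)"] normal_density_scaled_moment[OF t, unfolded sv]
      by (simp add: ij g_def m_def C_def gse_var_def)
  qed
  have mono: "(\<Prod>\<alpha>\<in>gse_index n. gse_coord \<sigma> A \<alpha> \<omega> ^ e \<alpha>) = (\<Prod>ij\<in>J. g e ij (A \<omega> $$ ij))" for e \<omega>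
    unfolding prodJ by (simp add: g_def gse_coord_def)
  show ?thesis
    unfolding gse_coords_def
  proof
    show "gse_coord \<sigma> A \<alpha> \<in> borel_measurable M" if "\<alpha> \<in> gse_index n" for \<alpha>
    proof -
      obtain i j c where \<alpha>: "\<alpha> = (i, j, c)" by (cases \<alpha>) auto
      have [measurable]: "(\<lambda>\<omega>. A \<omega> $$ (i, j)) \<in> borel_measurable M"
        using that by (intro A_measurable) (auto simp: \<alpha>)
      show ?thesis unfolding \<alpha> gse_coord_def prod.case by measurable
    qed
    show "integrable M (\<lambda>\<omega>. \<Prod>\<alpha>\<in>gse_index n. gse_coord \<sigma> A \<alpha> \<omega> ^ e \<alpha>)" for e
      unfolding mono by (rule indep_vars_integrable[OF finJ ind]) (simp add: entry)
    show "expectation (\<lambda>\<omega>. \<Prod>\<alpha>\<in>gse_index n. gse_coord \<sigma> A \<alpha> \<omega> ^ e \<alpha>) =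
        (\<Prod>\<alpha>\<in>gse_index n. gauss_moment (gse_var \<alpha>) (e \<alpha>))" for e
      unfolding mono prodJ by (subst indep_vars_lebesgue_integral[OF finJ ind]) (simp_all add: entry m_def)
  qed simp
qed

text \<open>Supplies the integrable bound under which the exponential series of the trace may be
  integrated term by term.\<close>

lemma gse_coord_exp_integrable:
  assumes "\<alpha> \<in> gse_index n"
  shows "integrable M (\<lambda>\<omega>. exp (c * \<bar>gse_coord \<sigma> A \<alpha> \<omega>\<bar>))"
proof -
  obtain i j k where \<alpha>: "\<alpha> = (i, j, k)" by (cases \<alpha>) auto
  define h where "h x = exp (c * \<bar>x / (\<sigma> * sqrt 2)\<bar>)" for x
  have hm: "h \<in> borel_measurable borel" unfolding h_def by measurable
  have hi: "integrable lborel (\<lambda>x. normal_density 0 \<tau> x * h x)" if "\<tau> > 0" for \<tau>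
    using integrable_normal_density_exp[OF that, of "c / (\<sigma> * sqrt 2)"] \<sigma> by (simp add: h_def abs_divide)
  show ?thesis
  proof (cases "i = j")
    case True
    then have "k = 0" "i < n" using assms by (auto simp: \<alpha>)
    then show ?thesis
      using diag_integral(1)[OF \<open>i < n\<close> hm hi[OF \<sigma>]] True by (simp add: \<alpha> gse_coord_def h_def)
  next
    case False
    then have ij: "i < j" "j < n" "k < 4" using assms by (auto simp: \<alpha>)
    have t: "\<sigma> / sqrt 2 > 0" using \<sigma> by simp
    \<comment> \<open>One component is singled out by taking the constant 1 in the other
      three.\<close>
    have "integrable M (\<lambda>\<omega>. \<Prod>c<4. (if c = k then h else (\<lambda>_. 1)) (quat_comp c (A \<omega> $$ (i, j))))"
      by (rule offdiag_integral(1)[OF ij(1,2)]) (use hm hi[OF t] t in auto)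
    moreover have "(\<Prod>c<4. (if c = k then h else (\<lambda>_. 1)) (quat_comp c q)) = h (quat_comp k q)" for q
    proof -
      have "(\<Prod>c<4. (if c = k then h else (\<lambda>_. 1)) (quat_comp c q)) = (\<Prod>c<4. if c = k then h (quat_comp c q) else 1)"
        by (intro prod.cong refl) simp
      then show ?thesis using ij(3) by simp
    qed
    ultimately show ?thesis by (simp add: \<alpha> gse_coord_def h_def)
  qed
qed

end

section \<open>The moment generating function\<close>

lemma norm_exp_partial_sum: "(\<Sum>k<m. norm (z ^ k / fact k)) \<le> exp (norm z)" for z :: complex
proof -
  have s: "(\<lambda>k. norm z ^ k / fact k) sums exp (norm z)"
    using exp_converges[of "norm z"] by (simp add: divide_inverse mult.commute)
  have "(\<Sum>k<m. norm z ^ k / fact k) \<le> exp (norm z)"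
    using sum_le_suminf[OF sums_summable[OF s], of "{..<m}"] sums_unique[OF s] by simp
  then show ?thesis by (simp add: norm_divide norm_power)
qed

lemma exp_sums_divide: "(\<lambda>k. z ^ k / fact k) sums exp z" for z :: complex
  using exp_converges[of z] by (simp add: scaleR_conv_of_real divide_inverse mult.commute)

text \<open>The exponential series is integrated term by term; \<open>w\<close> dominates because
  the exponential of |t| |x| is at most the sum of those of |t| x and - |t| x.\<close>

lemma gauss_int_sums:
  "(\<lambda>m. \<Sum>k<m. t ^ k / fact k * gauss_int 0 (monom 1 k * P)) \<longlonglongrightarrow> gauss_int t P"
proof -
  define S where "S m x = (\<Sum>k<m. t ^ k / fact k * (exp (0 * complex_of_real x) * of_real (poly (monom 1 k * P) x * gweight x)))" for m x
  define w where "w x = \<bar>poly P x * exp (norm t * x - x\<^sup>2)\<bar> + \<bar>poly P x * exp (- norm t * x - x\<^sup>2)\<bar>" for x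
  have Sx: "S m x = (\<Sum>k<m. (t * of_real x) ^ k / fact k) * of_real (poly P x * gweight x)" for m x
    unfolding S_def sum_distrib_right by (intro sum.cong refl) (simp add: poly_monom power_mult_distrib)
  have "(\<lambda>m. integral\<^sup>L lborel (S m)) \<longlonglongrightarrow>
      (\<integral>x. exp (t * complex_of_real x) * of_real (poly P x * gweight x) \<partial>lborel)"
  proof (rule integral_dominated_convergence[where w = w])
    show "integrable lborel w"
      unfolding w_def by (intro Bochner_Integration.integrable_add integrable_abs integrable_poly_gaussian)
    show "AE x in lborel. (\<lambda>m. S m x) \<longlonglongrightarrow> exp (t * complex_of_real x) * of_real (poly P x * gweight x)"
      unfolding Sx using exp_sums_divide unfolding sums_def by (intro AE_I2 tendsto_mult tendsto_const)
    show "AE x in lborel. norm (S m x) \<le> w x" for m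
    proof (rule AE_I2)
      fix x
      have "norm (\<Sum>k<m. (t * complex_of_real x) ^ k / fact k) \<le> exp (norm t * \<bar>x\<bar>)"
        using order.trans[OF norm_sum norm_exp_partial_sum[of "t * complex_of_real x"]] by (simp add: norm_mult)
      also have "\<dots> \<le> exp (norm t * x) + exp (- norm t * x)"
        by (cases "x \<ge> 0") (auto simp: abs_if)
      finally have "norm (S m x) \<le> (exp (norm t * x) + exp (- norm t * x)) * (\<bar>poly P x\<bar> * gweight x)"
        unfolding Sx norm_mult by (intro mult_mono) (simp_all add: abs_mult del: of_real_mult)
      also have "\<dots> = w x"
        unfolding w_def gweight_exp by (simp add: abs_mult algebra_simps)
      finally show "norm (S m x) \<le> w x" .
    qed
    have i: "integrable lborel (\<lambda>x. exp (u * complex_of_real x) * of_real (poly Q x * gweight x))" for u Q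
      by (rule integrable_poly_gaussian_complex)
    show "S m \<in> borel_measurable lborel" for m
      unfolding S_def
      by (intro borel_measurable_integrable Bochner_Integration.integrable_sum integrable_mult_right i)
    show "(\<lambda>x. exp (t * complex_of_real x) * of_real (poly P x * gweight x)) \<in> borel_measurable lborel"
      by (rule borel_measurable_integrable[OF i])
  qed
  moreover have "integral\<^sup>L lborel (S m) = (\<Sum>k<m. t ^ k / fact k * gauss_int 0 (monom 1 k * P))" for m
    unfolding S_def gauss_int_def
    by (simp only: Bochner_Integration.integral_sum integrable_mult_right integrable_poly_gaussian_complex integral_mult_right_zero)
  ultimately show ?thesis by (simp only: gauss_int_def)
qed

lemma smult_smult_mat: "a \<cdot>\<^sub>m (b \<cdot>\<^sub>m X) = (a * b :: 'a :: semigroup_mult) \<cdot>\<^sub>m X"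
  by (rule eq_matI) (simp_all add: mult.assoc)

lemma smult_one_mat: "(1 :: 'a :: monoid_mult) \<cdot>\<^sub>m X = X"
  by (rule eq_matI) simp_all

lemma norm_gse_basis_le_1: "norm (gse_basis \<alpha> a b) \<le> 1"
  by (cases \<alpha>) (simp add: gse_basis_def quat_unit_def cnj_sign_def sg_def norm_mult)

section \<open>Convergence of the exponential series of traces\<close>

context gse_coords
begin

text \<open>A bound for all entries of \<open>Y\<close>, as the entries of the basis matrices have
  norm at most 1.\<close>

definition R :: "'w \<Rightarrow> real" where
  "R \<omega> = (\<Sum>\<alpha>\<in>gse_index n. \<bar>\<xi> \<alpha> \<omega>\<bar>)"

lemma R_nonneg: "0 \<le> R \<omega>"
  by (simp add: R_def sum_nonneg)

lemma norm_Y_pow_le: "a < 2 * n \<Longrightarrow> b < 2 * n \<Longrightarrow> norm ((Y \<omega> ^\<^sub>m k) $$ (a, b)) \<le> (real (2 * n) * R \<omega>) ^ k"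
proof (induction k arbitrary: a b)
  case (Suc k)
  have Y1: "norm (Y \<omega> $$ (c, b)) \<le> R \<omega>" if "c < 2 * n" for c
  proof -
    have "norm (Y \<omega> $$ (c, b)) \<le> (\<Sum>\<alpha>\<in>gse_index n. norm (gse_basis \<alpha> c b * of_real (\<xi> \<alpha> \<omega>)))"
      using that Suc.prems by (simp add: Y_def norm_sum)
    also have "\<dots> \<le> R \<omega>"
      unfolding R_def norm_mult by (intro sum_mono) (simp add: norm_gse_basis_le_1 mult_left_le_one_le)
    finally show ?thesis .
  qed
  have "norm ((Y \<omega> ^\<^sub>m Suc k) $$ (a, b)) = norm (\<Sum>c<2 * n. (Y \<omega> ^\<^sub>m k) $$ (a, c) * Y \<omega> $$ (c, b))"
    using Suc.prems by (simp add: index_mult_mat_sum[of _ "2 * n"] del: index_mult_mat(1))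
  also have "\<dots> \<le> (\<Sum>c<2 * n. norm ((Y \<omega> ^\<^sub>m k) $$ (a, c) * Y \<omega> $$ (c, b)))"
    by (rule norm_sum)
  also have "\<dots> \<le> (\<Sum>c<2 * n. (real (2 * n) * R \<omega>) ^ k * R \<omega>)"
    unfolding norm_mult using Suc Y1 R_nonneg by (intro sum_mono mult_mono) auto
  finally show ?case by (simp add: mult.assoc mult.left_commute mult.commute)
qed simp

lemma norm_T_le: "norm (T k \<omega>) \<le> real (2 * n) * (real (2 * n) * R \<omega>) ^ k"
proof -
  have "norm (T k \<omega>) \<le> (\<Sum>a<2 * n. norm ((Y \<omega> ^\<^sub>m k) $$ (a, a)))"
    unfolding T_def mat_trace_sum[OF Y_pow_carrier] by (rule norm_sum)
  also have "\<dots> \<le> (\<Sum>a<2 * n. (real (2 * n) * R \<omega>) ^ k)"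
    by (intro sum_mono norm_Y_pow_le) auto
  finally show ?thesis by simp
qed

lemma exp_trace_sums:
  "(\<lambda>k. t ^ k / fact k * T k \<omega>) sums mat_trace (mat_exp (t \<cdot>\<^sub>m Y \<omega>))"
proof -
  have pow: "(t \<cdot>\<^sub>m Y \<omega>) ^\<^sub>m k = t ^ k \<cdot>\<^sub>m (Y \<omega> ^\<^sub>m k)" for k
  proof (induction k)
    case (Suc k)
    show ?case
      unfolding pow_mat.simps Suc mult_smult_distrib[OF smult_carrier_mat[OF Y_pow_carrier] Y_carrier]
        mult_smult_assoc_mat[OF Y_pow_carrier Y_carrier] smult_smult_mat by simp
  qed (simp add: smult_one_mat)
  have "(\<lambda>k. t ^ k / fact k * (Y \<omega> ^\<^sub>m k) $$ (a, a)) sums (\<Sum>k. ((t \<cdot>\<^sub>m Y \<omega>) ^\<^sub>m k) $$ (a, a) / fact k)"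
    if a: "a < 2 * n" for a
  proof -
    have d: "a < dim_row (Y \<omega> ^\<^sub>m k)" "a < dim_col (Y \<omega> ^\<^sub>m k)" for k
      using a unfolding carrier_matD[OF Y_pow_carrier] by auto
    have "summable (\<lambda>k. t ^ k / fact k * (Y \<omega> ^\<^sub>m k) $$ (a, a))"
    proof (rule summable_comparison_test')
      let ?r = "norm t * (real (2 * n) * R \<omega>)"
      show "summable (\<lambda>k. ?r ^ k / fact k)"
        using summable_exp[of ?r] by (simp add: divide_inverse mult.commute)
      show "norm (t ^ k / fact k * (Y \<omega> ^\<^sub>m k) $$ (a, a)) \<le> ?r ^ k / fact k" if "k \<ge> 0" for k
      proof -
        have "norm (t ^ k / fact k * (Y \<omega> ^\<^sub>m k) $$ (a, a)) \<le> norm (t ^ k / fact k) * (real (2 * n) * R \<omega>) ^ k"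
          unfolding norm_mult by (intro mult_left_mono norm_Y_pow_le a) simp
        then show ?thesis by (simp add: norm_divide norm_power power_mult_distrib)
      qed
    qed
    then show ?thesis
      unfolding pow using d by (simp add: summable_sums)
  qed
  then have "(\<lambda>k. \<Sum>a<2 * n. t ^ k / fact k * (Y \<omega> ^\<^sub>m k) $$ (a, a)) sums
      (\<Sum>a<2 * n. \<Sum>k. ((t \<cdot>\<^sub>m Y \<omega>) ^\<^sub>m k) $$ (a, a) / fact k)"
    by (intro sums_sum) simp
  moreover have "dim_col (Y \<omega>) = 2 * n" by (simp add: Y_def)
  then have "mat_trace (mat_exp (t \<cdot>\<^sub>m Y \<omega>)) = (\<Sum>a<2 * n. \<Sum>k. ((t \<cdot>\<^sub>m Y \<omega>) ^\<^sub>m k) $$ (a, a) / fact k)"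
    by (simp add: mat_trace_def mat_exp_def)
  moreover have "t ^ k / fact k * T k \<omega> = (\<Sum>a<2 * n. t ^ k / fact k * (Y \<omega> ^\<^sub>m k) $$ (a, a))" for k
    by (simp add: T_def mat_trace_sum[OF Y_pow_carrier] sum_distrib_left)
  ultimately show ?thesis by (simp only:)
qed

lemma expectation_exp_trace:
  assumes "n \<ge> 1" and exp_int: "\<And>c \<alpha>. \<alpha> \<in> gse_index n \<Longrightarrow> integrable M (\<lambda>\<omega>. exp (c * \<bar>\<xi> \<alpha> \<omega>\<bar>))"
  shows "integrable M (\<lambda>\<omega>. mat_trace (mat_exp (t \<cdot>\<^sub>m Y \<omega>)))"
    and "expectation (\<lambda>\<omega>. mat_trace (mat_exp (t \<cdot>\<^sub>m Y \<omega>))) = gauss_int t (gse_density n)"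
proof -
  define S where "S m \<omega> = (\<Sum>k<m. t ^ k / fact k * T k \<omega>)" for m \<omega>
  define c where "c = norm t * real (2 * n)"
  define C where "C = real (card (gse_index n))"
  define w where "w \<omega> = real (2 * n) * (1 + (\<Sum>\<alpha>\<in>gse_index n. exp (c * C * \<bar>\<xi> \<alpha> \<omega>\<bar>)))" for \<omega>
  have c: "c \<ge> 0" by (simp add: c_def)
  have wi: "integrable M w"
    unfolding w_def by (intro integrable_mult_right Bochner_Integration.integrable_add
        Bochner_Integration.integrable_sum exp_int integrable_const)
  \<comment> \<open>The largest coordinate bounds \<open>R\<close>, so the exponential of a sum is
    dominated by a sum of exponentials of one coordinate each, which \<open>exp_int\<close> covers.
    The summand 1 is for an empty index set.\<close>
  have expR: "exp (c * R \<omega>) \<le> 1 + (\<Sum>\<alpha>\<in>gse_index n. exp (c * C * \<bar>\<xi> \<alpha> \<omega>\<bar>))" for \<omega>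
  proof (cases "gse_index n = {}")
    case False
    obtain \<beta> where \<beta>: "\<beta> \<in> gse_index n" "\<And>\<alpha>. \<alpha> \<in> gse_index n \<Longrightarrow> \<bar>\<xi> \<alpha> \<omega>\<bar> \<le> \<bar>\<xi> \<beta> \<omega>\<bar>"
    proof -
      have "Max ((\<lambda>\<alpha>. \<bar>\<xi> \<alpha> \<omega>\<bar>) ` gse_index n) \<in> (\<lambda>\<alpha>. \<bar>\<xi> \<alpha> \<omega>\<bar>) ` gse_index n"
        using False by (intro Max_in) auto
      then obtain \<beta> where "\<beta> \<in> gse_index n" "Max ((\<lambda>\<alpha>. \<bar>\<xi> \<alpha> \<omega>\<bar>) ` gse_index n) = \<bar>\<xi> \<beta> \<omega>\<bar>"
        by (elim imageE) auto
      then show ?thesis using that[of \<beta>] Max_ge[of "(\<lambda>\<alpha>. \<bar>\<xi> \<alpha> \<omega>\<bar>) ` gse_index n"] by auto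
    qed
    have "R \<omega> \<le> C * \<bar>\<xi> \<beta> \<omega>\<bar>"
      unfolding R_def C_def by (rule sum_bounded_above) (rule \<beta>(2))
    then have "exp (c * R \<omega>) \<le> exp (c * C * \<bar>\<xi> \<beta> \<omega>\<bar>)"
      using mult_left_mono[OF _ c] by (simp add: mult.assoc)
    also have "\<dots> \<le> (\<Sum>\<alpha>\<in>gse_index n. exp (c * C * \<bar>\<xi> \<alpha> \<omega>\<bar>))"
      using \<beta>(1) by (intro member_le_sum) auto
    finally show ?thesis by simp
  qed (simp add: R_def)
  have lim: "(\<lambda>m. S m \<omega>) \<longlonglongrightarrow> mat_trace (mat_exp (t \<cdot>\<^sub>m Y \<omega>))" for \<omega>
    using exp_trace_sums unfolding sums_def S_def .
  have bound: "norm (S m \<omega>) \<le> w \<omega>" for m \<omega>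
  proof -
    have "norm (S m \<omega>) \<le> (\<Sum>k<m. norm (t ^ k / fact k * T k \<omega>))"
      unfolding S_def by (rule norm_sum)
    also have "\<dots> \<le> (\<Sum>k<m. real (2 * n) * norm (complex_of_real (c * R \<omega>) ^ k / fact k))"
    proof (rule sum_mono)
      fix k
      have "norm (t ^ k / fact k * T k \<omega>) \<le> norm (t ^ k / fact k) * (real (2 * n) * (real (2 * n) * R \<omega>) ^ k)"
        unfolding norm_mult by (intro mult_left_mono norm_T_le) simp
      also have "\<dots> = real (2 * n) * norm (complex_of_real (c * R \<omega>) ^ k / fact k)"
        using R_nonneg[of \<omega>] by (simp add: c_def norm_divide norm_power norm_mult power_mult_distrib)
      finally show "norm (t ^ k / fact k * T k \<omega>) \<le> real (2 * n) * norm (complex_of_real (c * R \<omega>) ^ k / fact k)" .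
    qed
    also have "\<dots> \<le> real (2 * n) * exp (norm (complex_of_real (c * R \<omega>)))"
      unfolding sum_distrib_left[symmetric] by (intro mult_left_mono norm_exp_partial_sum) simp
    also have "\<dots> \<le> w \<omega>"
      unfolding w_def using expR[of \<omega>] c R_nonneg[of \<omega>] by (intro mult_left_mono) (simp_all add: abs_mult del: of_real_mult)
    finally show ?thesis .
  qed
  have Ti: "integrable M (T k)" for k
    by (rule gder_integrable[OF gder_T])
  have Sm: "S m \<in> borel_measurable M" for m
    unfolding S_def using borel_measurable_integrable[OF Ti]
    by (intro borel_measurable_sum borel_measurable_times borel_measurable_const)
  have fm: "(\<lambda>\<omega>. mat_trace (mat_exp (t \<cdot>\<^sub>m Y \<omega>))) \<in> borel_measurable M"
    by (rule borel_measurable_LIMSEQ_metric[OF Sm lim])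
  show "integrable M (\<lambda>\<omega>. mat_trace (mat_exp (t \<cdot>\<^sub>m Y \<omega>)))"
    by (rule integrable_dominated_convergence[where s = S and w = w, OF fm Sm wi]) (intro AE_I2 lim bound)+
  have "(\<lambda>m. expectation (S m)) \<longlonglongrightarrow> expectation (\<lambda>\<omega>. mat_trace (mat_exp (t \<cdot>\<^sub>m Y \<omega>)))"
    by (rule integral_dominated_convergence[where s = S and w = w, OF fm Sm wi]) (intro AE_I2 lim bound)+
  moreover have "expectation (S m) = (\<Sum>k<m. t ^ k / fact k * gauss_int 0 (monom 1 k * gse_density n))" for m
    unfolding S_def
    by (simp only: Bochner_Integration.integral_sum integrable_mult_right Ti integral_mult_right_zero
        expectation_trace_power[OF assms(1)])
  ultimately show "expectation (\<lambda>\<omega>. mat_trace (mat_exp (t \<cdot>\<^sub>m Y \<omega>))) = gauss_int t (gse_density n)"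
    using gauss_int_sums[of t "gse_density n"] by (simp only: LIMSEQ_unique)
qed

end

section \<open>Identification with the complex image, and conclusion\<close>

lemma quat_block_index:
  assumes "u < 2" "v < 2"
  shows "quat_block q $$ (u, v) = (\<Sum>k<4. quat_unit k u v * of_real (quat_comp k q))"
proof -
  obtain a b c d where q: "q = (a, b, c, d)" by (cases q) auto
  have sum4: "(\<Sum>c<4. f c) = f 0 + f 1 + f 2 + f 3" for f :: "nat \<Rightarrow> complex"
    by (simp add: lessThan_nat_numeral lessThan_Suc numeral_3_eq_3 numeral_2_eq_2)
  have bits: "u = 0 \<or> u = 1" "v = 0 \<or> v = 1" using assms by auto
  then show ?thesis
    by (elim disjE; simp add: q sum4 quat_block_def mat_of_rows_list_def quat_unit_def quat_comp_def sg_def complex_eq_iff)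
qed

lemma quat_comp_cnj: "of_real (quat_comp k (quat_cnj q)) = cnj_sign k * of_real (quat_comp k q)"
  by (cases q) (simp add: quat_comp_def quat_cnj_def cnj_sign_def)

lemma complex_rep_eq_Y:
  assumes "gse_coords M n (gse_coord \<sigma> A)" "\<sigma> > 0" "quat_self_adjoint n (A \<omega>)"
  shows "complex_rep (A \<omega>) = of_real (\<sigma> * sqrt 2) \<cdot>\<^sub>m gse_coords.Y n (gse_coord \<sigma> A) \<omega>"
proof -
  interpret gse_coords M n "gse_coord \<sigma> A" by fact
  have dims: "dim_row (A \<omega>) = n" "dim_col (A \<omega>) = n"
    using assms(3) by (auto simp: quat_self_adjoint_def)
  have adj: "A \<omega> $$ (q, p) = quat_cnj (A \<omega> $$ (p, q))" if "p < n" "q < n" for p q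
    using assms(3) that unfolding quat_self_adjoint_def by blast
  define s where "s = complex_of_real (\<sigma> * sqrt 2)"
  have s: "s \<noteq> 0" using assms(2) by (simp add: s_def)
  have coord: "of_real (gse_coord \<sigma> A (i, j, k) \<omega>) = of_real (quat_comp k (A \<omega> $$ (i, j))) / s" for i j k
    by (simp add: gse_coord_def s_def)
  show ?thesis
  proof (rule eq_matI)
    fix a b
    assume "a < dim_row (of_real (\<sigma> * sqrt 2) \<cdot>\<^sub>m Y \<omega>)" "b < dim_col (of_real (\<sigma> * sqrt 2) \<cdot>\<^sub>m Y \<omega>)"
    then have ab: "a < 2 * n" "b < 2 * n" by (simp_all add: Y_def)
    define p q u v where "p = a div 2" and "q = b div 2" and "u = a mod 2" and "v = b mod 2"
    have pq: "p < n" "q < n" "u < 2" "v < 2" using ab by (auto simp: p_def q_def u_def v_def)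
    have "complex_rep (A \<omega>) $$ (a, b) = (\<Sum>k<4. quat_unit k u v * of_real (quat_comp k (A \<omega> $$ (p, q))))"
      using ab pq by (simp add: complex_rep_def dims quat_block_index p_def q_def u_def v_def)
    also have "\<dots> = s * (if p = q then quat_unit 0 u v * of_real (gse_coord \<sigma> A (p, p, 0) \<omega>)
     else if p < q then (\<Sum>c<4. quat_unit c u v * of_real (gse_coord \<sigma> A (p, q, c) \<omega>))
     else (\<Sum>c<4. cnj_sign c * quat_unit c u v * of_real (gse_coord \<sigma> A (q, p, c) \<omega>)))"
    proof -
      consider "p = q" | "p < q" | "q < p" by linarith
      then show ?thesis
      proof cases
        case 1
        \<comment> \<open>A diagonal entry equals its own conjugate, so its imaginary components
          vanish.\<close>
        have c1: "complex_of_real (quat_comp k (A \<omega> $$ (q, q))) = cnj_sign k * of_real (quat_comp k (A \<omega> $$ (q, q)))" for k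
          by (rule trans[OF arg_cong[OF adj[OF pq(2,2)], of "\<lambda>x. complex_of_real (quat_comp k x)"] quat_comp_cnj])
        then have "quat_comp k (A \<omega> $$ (q, q)) = 0" if "k \<noteq> 0" for k
          using c1[of k] that by (simp add: cnj_sign_def)
        then have "(\<Sum>k<4. quat_unit k u v * of_real (quat_comp k (A \<omega> $$ (q, q))))
          = (\<Sum>k\<in>{0}. quat_unit k u v * of_real (quat_comp k (A \<omega> $$ (q, q))))"
          by (intro sum.mono_neutral_right) auto
        then show ?thesis using 1 s by (simp add: coord)
      next
        case 2
        then show ?thesis using s by (simp add: coord sum_distrib_left)
      next
        case 3
        then show ?thesis using s adj[OF pq(2,1)]
          by (simp add: coord sum_distrib_left quat_comp_cnj ac_simps)
      qed
    qed
    also have "\<dots> = s * (\<Sum>\<alpha>\<in>gse_index n. gse_basis \<alpha> a b * of_real (gse_coord \<sigma> A \<alpha> \<omega>))"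
      unfolding sum_gse_index_basis[OF ab] Let_def p_def q_def u_def v_def ..
    also have "\<dots> = (of_real (\<sigma> * sqrt 2) \<cdot>\<^sub>m Y \<omega>) $$ (a, b)"
      using ab by (simp add: s_def Y_def)
    finally show "complex_rep (A \<omega>) $$ (a, b) = (of_real (\<sigma> * sqrt 2) \<cdot>\<^sub>m Y \<omega>) $$ (a, b)" .
  qed (simp_all add: complex_rep_def dims Y_def)
qed

theorem theorem6p2:
  fixes M :: "'w measure" and A :: "'w \<Rightarrow> quat mat" and n :: nat and \<sigma> :: real and s :: complex
  assumes "n \<ge> 1" and "\<sigma> > 0" and "GSE M n \<sigma> A"
  shows "integrable lborel (\<lambda>x. exp (s * of_real x) * of_real (p_GSE n \<sigma> x) :: complex) \<and>
    integrable M (\<lambda>\<omega>. trace_exp s (A \<omega>)) \<and>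
    laplace (p_GSE n \<sigma>) s = prob_space.expectation M (\<lambda>\<omega>. trace_exp s (A \<omega>)) \<and>
    prob_space.expectation M (\<lambda>\<omega>. trace_exp s (A \<omega>)) =
      - exp (of_real (\<sigma>\<^sup>2) * s\<^sup>2 / 2) *
        (\<Sum>i=0..n. of_real (\<sigma> ^ (2 * i)) * s ^ (2 * i) * 2 ^ i * fact n / (fact (2 * i) * fact (n - i)) *
          hyp1F1 (- of_nat (2 * n - 2 * i)) (1 + 2 * of_nat i) (- (of_real (\<sigma>\<^sup>2) * s\<^sup>2)))
      + of_nat (2 * n + 1) * exp (of_real (\<sigma>\<^sup>2) * s\<^sup>2 / 2) *
          hyp1F1 (1 - of_nat (2 * n + 1)) 2 (- (of_real (\<sigma>\<^sup>2) * s\<^sup>2))"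
proof -
  interpret gse_coords M n "gse_coord \<sigma> A"
    using assms(3,2) by (rule gse_coords_gse_coord)
  \<comment> \<open>The factor \<open>\<sigma> * sqrt 2\<close> restores the scale removed from the
    coordinates. It gives \<open>t\<^sup>2 = 2 * y\<close>, and \<open>exp (t\<^sup>2 / 4)\<close>
    becomes the prefactor \<open>exp (y / 2)\<close>.\<close>
  define t where "t = s * of_real (\<sigma> * sqrt 2)"
  define y where "y = of_real (\<sigma>\<^sup>2) * s\<^sup>2"
  have ty: "t\<^sup>2 = 2 * y"
    by (simp add: t_def y_def power_mult_distrib flip: of_real_power)
  \<comment> \<open>Self-adjointness is available on \<open>space M\<close>, which is enough under
    the integral.\<close>
  have te: "trace_exp s (A \<omega>) = mat_trace (mat_exp (t \<cdot>\<^sub>m Y \<omega>))" if "\<omega> \<in> space M" for \<omega>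
  proof -
    have "quat_self_adjoint n (A \<omega>)" using assms(3) that by (simp add: GSE_def)
    then have "complex_rep (A \<omega>) = of_real (\<sigma> * sqrt 2) \<cdot>\<^sub>m Y \<omega>"
      by (rule complex_rep_eq_Y[OF gse_coords_axioms assms(2)])
    then show ?thesis by (simp only: trace_exp_def t_def smult_smult_mat)
  qed
  note E = expectation_exp_trace[OF assms(1) gse_coord_exp_integrable[OF assms(3,2)], of t]
  have int: "integrable M (\<lambda>\<omega>. trace_exp s (A \<omega>))"
    using E(1) by (subst Bochner_Integration.integrable_cong[OF refl te])
  have ex: "expectation (\<lambda>\<omega>. trace_exp s (A \<omega>)) = gauss_int t (gse_density n)"
    using E(2) by (subst Bochner_Integration.integral_cong[OF refl te])
  have powers: "of_real (\<sigma> ^ (2 * i)) * s ^ (2 * i) = y ^ i" for i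
    by (simp add: y_def power_mult_distrib power_mult)
  show ?thesis
    using laplace_p_GSE[OF assms(2), where s = s and n = n] int
    unfolding ex powers y_def[symmetric] gauss_int_gse_density[OF ty, symmetric] t_def by blast
qed

end
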